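(* Let $n\ge 2$ and let $H$ be $\mathbb{R}^n$ with, in polar coordinates $(r,\Theta)$, the metric $ds^2=dr^2+h(r)^2\,d\Theta^2$, volume density $f(r)$, and perimeter density $g(r)$. Suppose that $h$ is nondecreasing, $g(r)\to\infty$ as $r\to\infty$, and $f\le cg$ for some constant $c$. Then an isoperimetric region exists for every prescribed positive volume less than the volume of $H$.
   Context: $d\Theta^2$ denotes the round metric on the unit sphere $S^{n-1}$ and $h>0$ on $(0,\infty)$; $f,g$ are positive continuous radial functions. The volume of a region is its Riemannian volume weighted by $f$; the perimeter of a region is the Riemannian $(n-1)$-dimensional area of its boundary weighted by $g$. An isoperimetric region of volume $V$ is a region of volume $V$ minimizing perimeter among all regions of volume $V$. *)

theory Defs
  imports "HOL-Analysis.Analysis"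
begin

text \<open>The space H is the Euclidean space 'a (dimension n = DIM('a)) carrying, in polar
coordinates r = norm x, Theta = x / norm x, the Riemannian metric dr^2 + h(r)^2 dTheta^2.
Everything is expressed in the Euclidean chart.\<close>

text \<open>Riemannian volume element relative to Lebesgue measure: (h(r)/r)^(n-1).\<close>
definition rvol_density :: "(real \<Rightarrow> real) \<Rightarrow> 'a::euclidean_space \<Rightarrow> real" where
  "rvol_density h x = (h (norm x) / norm x) ^ (DIM('a) - 1)"

text \<open>Riemannian length of a tangent vector v at x (x nonzero): radial part has unit
weight, tangential part is scaled by h(r)/r.\<close>
definition rnorm :: "(real \<Rightarrow> real) \<Rightarrow> 'a::euclidean_space \<Rightarrow> 'a \<Rightarrow> real" where
  "rnorm h x v = sqrt ((v \<bullet> sgn x)\<^sup>2 + (h (norm x) / norm x)\<^sup>2 * ((norm v)\<^sup>2 - (v \<bullet> sgn x)\<^sup>2))"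

definition wvol :: "(real \<Rightarrow> real) \<Rightarrow> (real \<Rightarrow> real) \<Rightarrow> 'a::euclidean_space set \<Rightarrow> ennreal" where
  "wvol f h E = (\<integral>\<^sup>+ x\<in>E. ennreal (f (norm x) * rvol_density h x) \<partial>lebesgue)"

definition divergence :: "('a::euclidean_space \<Rightarrow> 'a) \<Rightarrow> 'a \<Rightarrow> real" where
  "divergence Y x = (\<Sum>b\<in>Basis. frechet_derivative Y (at x) b \<bullet> b)"

text \<open>C^1 vector fields with compact support avoiding the origin (the polar chart's
singular point, which has zero capacity for n >= 2).\<close>
definition C1c_field :: "('a::euclidean_space \<Rightarrow> 'a) \<Rightarrow> bool" where
  "C1c_field Y \<longleftrightarrow>
     (\<exists>Y'. (\<forall>x. (Y has_derivative Y' x) (at x)) \<and> (\<forall>b\<in>Basis. continuous_on UNIV (\<lambda>x. Y' x b)))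
     \<and> (\<exists>K. compact K \<and> 0 \<notin> K \<and> (\<forall>x. x \<notin> K \<longrightarrow> Y x = 0))"

text \<open>Weighted perimeter (De Giorgi form): Riemannian (n-1)-area of the boundary weighted
by g.  With X a Riemannian vector field and mu the Riemannian volume density, the
Riemannian divergence integral satisfies  int_E div_mu X dvol = int_E div(mu X) dx;
we parametrize by Y = mu X, with constraint |X|_metric <= g(r).\<close>
definition wper :: "(real \<Rightarrow> real) \<Rightarrow> (real \<Rightarrow> real) \<Rightarrow> 'a::euclidean_space set \<Rightarrow> ereal" where
  "wper g h E = (SUP Y \<in> {Y. C1c_field Y \<and>
        (\<forall>x. x \<noteq> 0 \<longrightarrow> rnorm h x (Y x) \<le> g (norm x) * rvol_density h x)}.
      ereal (set_lebesgue_integral lebesgue E (divergence Y)))"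

definition isoperimetric_region ::
  "(real \<Rightarrow> real) \<Rightarrow> (real \<Rightarrow> real) \<Rightarrow> (real \<Rightarrow> real) \<Rightarrow> 'a::euclidean_space set \<Rightarrow> real \<Rightarrow> bool" where
  "isoperimetric_region f g h E V \<longleftrightarrow>
     E \<in> sets lebesgue \<and> wvol f h E = ennreal V \<and>
     (\<forall>F :: 'a set. F \<in> sets lebesgue \<longrightarrow> wvol f h F = ennreal V \<longrightarrow> wper g h E \<le> wper g h F)"

end

theory Submission
  imports Defs "HOL-Complex_Analysis.Great_Picard"
begin

text \<open>Direct method. Away from the origin a bound on the perimeter controls the translates of a
  set in mean, so a minimizing sequence has a subsequence converging almost everywhere, and the perimeter
  is lower semicontinuous because it is a supremum of fluxes of fixed fields. What has to be excluded is
  that volume is lost at infinity (near the origin the volume is small anyway).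

  If the total volume is finite, there is nothing to lose. If it is infinite, almost every ray
  leaving a set of finite volume crosses its boundary again; since h is nondecreasing, inward radial
  projection does not increase area, so the slice of the set at radius r has area at most the perimeter
  divided by the infimum of g beyond r, and this tends to zero. Small slices have large relative
  perimeter: at scale eps / h(r), averaging over small displacements along the sphere shows that the
  g-weighted volume of the set in a thin shell is at most a constant times eps times the weighted perimeter
  in that shell. As f is at most c g, adding up the shells bounds the volume far away by a constant
  times eps times the perimeter.\<close>

subsection \<open>Continuously differentiable functions\<close>

text \<open>The obstacle is that \<epsilon> has to be fixed before the radius beyond which the
  estimate runs, while the spheres may grow at any rate, so no fixed angle suits all radii. At
  radius a the angle is s = \<epsilon> / h(a), and then a disappears from both requirements. A
  tangential field of Euclidean size s |x| has Riemannian length of order \<epsilon> in every thin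
  shell. A slice is small compared with a ball of radius s if a constant times s / (g h^(n-1)) is
  below a constant times s^n; as s^(n-1) h^(n-1) = \<epsilon>^(n-1), this only asks that g exceed a
  constant depending on \<epsilon>.

  Perimeter is used by duality throughout. Every motion of points (translation, drift along spheres,
  radial projection) is encoded in a field whose flux the perimeter bounds, and indicators are
  replaced by C1 functions at the price of an error that tends to 0 at the end of each lemma. Fields
  supported in adjacent shells can be added, which localises the perimeter without a boundary
  measure.\<close>

definition C1_on :: "'a::euclidean_space set \<Rightarrow> ('a \<Rightarrow> 'b::real_normed_vector) \<Rightarrow> bool" where
  "C1_on U f \<longleftrightarrow> open U \<and>
     (\<exists>f'. (\<forall>x\<in>U. (f has_derivative blinfun_apply (f' x)) (at x)) \<and> continuous_on U f')"

lemma C1_onE: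
  assumes "C1_on U f"
  obtains f' where "open U" "\<And>x. x \<in> U \<Longrightarrow> (f has_derivative blinfun_apply (f' x)) (at x)"
    "continuous_on U f'"
  using assms unfolding C1_on_def by blast

lemma C1_onI:
  assumes "open U" "\<And>x. x \<in> U \<Longrightarrow> (f has_derivative blinfun_apply (f' x)) (at x)"
    "continuous_on U f'"
  shows "C1_on U f"
  using assms unfolding C1_on_def by blast

lemma C1_on_open: "C1_on U f \<Longrightarrow> open U"
  unfolding C1_on_def by blast

lemma C1_on_cong:
  assumes "C1_on U f" "\<And>x. x \<in> U \<Longrightarrow> f x = g x"
  shows "C1_on U g"
proof -
  obtain f' where f': "open U" "\<And>x. x \<in> U \<Longrightarrow> (f has_derivative blinfun_apply (f' x)) (at x)"
    "continuous_on U f'" using C1_onE[OF assms(1)] by blast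
  show ?thesis
  proof (rule C1_onI[OF f'(1) _ f'(3)])
    fix x assume "x \<in> U"
    show "(g has_derivative blinfun_apply (f' x)) (at x)"
      by (rule has_derivative_transform_within_open[OF f'(2)[OF \<open>x \<in> U\<close>] f'(1) \<open>x \<in> U\<close>])
         (simp add: assms(2))
  qed
qed

lemma C1_on_imp_continuous_on: "C1_on U f \<Longrightarrow> continuous_on U f"
  by (metis C1_onE continuous_at_imp_continuous_on has_derivative_continuous)

lemma C1_on_differentiable: "C1_on U f \<Longrightarrow> x \<in> U \<Longrightarrow> f differentiable (at x)"
  by (metis C1_onE differentiableI)

lemma C1_on_const: "open U \<Longrightarrow> C1_on U (\<lambda>x. c)"
  by (rule C1_onI[where f' = "\<lambda>x. 0"]) (auto simp: zero_blinfun.rep_eq)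

lemma C1_on_bounded_linear:
  assumes "bounded_linear f" "open U"
  shows "C1_on U f"
  by (rule C1_onI[where f' = "\<lambda>x. Blinfun f"])
     (auto simp: bounded_linear_Blinfun_apply assms intro: bounded_linear_imp_has_derivative)

lemma C1_on_ident: "open U \<Longrightarrow> C1_on U (\<lambda>x. x)"
  by (rule C1_on_bounded_linear[OF bounded_linear_ident])

lemma C1_on_add:
  assumes "C1_on U f" "C1_on U g"
  shows "C1_on U (\<lambda>x. f x + g x)"
proof -
  obtain f' where f': "open U" "\<And>x. x \<in> U \<Longrightarrow> (f has_derivative blinfun_apply (f' x)) (at x)"
    "continuous_on U f'" using C1_onE[OF assms(1)] by blast
  obtain g' where g': "\<And>x. x \<in> U \<Longrightarrow> (g has_derivative blinfun_apply (g' x)) (at x)"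
    "continuous_on U g'" using C1_onE[OF assms(2)] by blast
  show ?thesis
    by (rule C1_onI[where f' = "\<lambda>x. f' x + g' x"])
       (auto intro!: f' g' continuous_intros derivative_eq_intros simp: plus_blinfun.rep_eq)
qed

lemma C1_on_compose:
  assumes "C1_on V f" "C1_on U g" "\<And>x. x \<in> U \<Longrightarrow> g x \<in> V"
  shows "C1_on U (\<lambda>x. f (g x))"
proof -
  obtain f' where f': "\<And>x. x \<in> V \<Longrightarrow> (f has_derivative blinfun_apply (f' x)) (at x)"
    "continuous_on V f'" using C1_onE[OF assms(1)] by blast
  obtain g' where g': "open U" "\<And>x. x \<in> U \<Longrightarrow> (g has_derivative blinfun_apply (g' x)) (at x)"
    "continuous_on U g'" using C1_onE[OF assms(2)] by blast
  have c: "continuous_on U (\<lambda>x. f' (g x))"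
    by (rule continuous_on_compose2[OF f'(2) C1_on_imp_continuous_on[OF assms(2)]])
       (use assms(3) in auto)
  show ?thesis
  proof (rule C1_onI[OF g'(1), where f' = "\<lambda>x. f' (g x) o\<^sub>L g' x"])
    show "continuous_on U (\<lambda>x. f' (g x) o\<^sub>L g' x)"
      by (intro continuous_intros c g')
    fix x assume x: "x \<in> U"
    show "((\<lambda>x. f (g x)) has_derivative blinfun_apply (f' (g x) o\<^sub>L g' x)) (at x)"
      using has_derivative_compose[OF g'(2)[OF x] f'(1)[OF assms(3)[OF x]]]
      by (simp add: blinfun_compose.rep_eq o_def)
  qed
qed

lemma C1_on_bilinear:
  assumes "bounded_bilinear pr" "C1_on U f" "C1_on U g"
  shows "C1_on U (\<lambda>x. pr (f x) (g x))"
proof -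
  interpret bounded_bilinear pr by (rule assms(1))
  obtain f' where f': "open U" "\<And>x. x \<in> U \<Longrightarrow> (f has_derivative blinfun_apply (f' x)) (at x)"
    "continuous_on U f'" using C1_onE[OF assms(2)] by blast
  obtain g' where g': "\<And>x. x \<in> U \<Longrightarrow> (g has_derivative blinfun_apply (g' x)) (at x)"
    "continuous_on U g'" using C1_onE[OF assms(3)] by blast
  define D where "D x = Blinfun (\<lambda>h. pr (f x) (g' x h) + pr (f' x h) (g x))" for x
  have bl: "bounded_linear (\<lambda>h. pr (f x) (g' x h) + pr (f' x h) (g x))" for x
    by (intro bounded_linear_add bounded_linear_compose[OF bounded_linear_right]
        bounded_linear_compose[OF bounded_linear_left] blinfun.bounded_linear_right)
  have D: "blinfun_apply (D x) = (\<lambda>h. pr (f x) (g' x h) + pr (f' x h) (g x))" for x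
    unfolding D_def by (rule bounded_linear_Blinfun_apply[OF bl])
  show ?thesis
  proof (rule C1_onI[OF f'(1), where f' = D])
    \<comment> \<open>In finite dimension, continuity in operator norm may be tested on single
      vectors.\<close>
    show "continuous_on U D"
      by (rule continuous_on_blinfun_componentwise, unfold D)
         (intro continuous_intros continuous_on C1_on_imp_continuous_on assms f' g')
    fix x assume x: "x \<in> U"
    show "((\<lambda>x. pr (f x) (g x)) has_derivative blinfun_apply (D x)) (at x)"
      unfolding D by (rule FDERIV[OF f'(2)[OF x] g'(1)[OF x]])
  qed
qed

lemmas C1_on_inner = C1_on_bilinear[OF bounded_bilinear_inner]
lemmas C1_on_mult = C1_on_bilinear[OF bounded_bilinear_mult]
lemmas C1_on_scaleR = C1_on_bilinear[OF bounded_bilinear_scaleR]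

lemma C1_on_uminus:
  assumes "C1_on U f" shows "C1_on U (\<lambda>x. - f x)"
  using C1_on_scaleR[OF C1_on_const[OF C1_on_open[OF assms], of "-1"] assms] by simp

lemma C1_on_diff:
  assumes "C1_on U f" "C1_on U g" shows "C1_on U (\<lambda>x. f x - g x)"
  using C1_on_add[OF assms(1) C1_on_uminus[OF assms(2)]] by simp

lemma C1_on_real:
  fixes f :: "real \<Rightarrow> real"
  assumes "open U" "\<And>x. x \<in> U \<Longrightarrow> (f has_real_derivative f' x) (at x)" "continuous_on U f'"
  shows "C1_on U f"
proof (rule C1_onI[OF assms(1), where f' = "\<lambda>x. f' x *\<^sub>R id_blinfun"])
  fix x assume "x \<in> U"
  then show "(f has_derivative blinfun_apply (f' x *\<^sub>R id_blinfun)) (at x)"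
    using assms(2)[of x] by (simp add: has_field_derivative_def scaleR_blinfun.rep_eq)
qed (intro continuous_intros assms)

lemma C1_on_inverse: "C1_on (- {0}) (inverse :: real \<Rightarrow> real)"
proof (rule C1_on_real[where f' = "\<lambda>x. - (inverse x ^ Suc (Suc 0))"])
  show "continuous_on (- {0}) (\<lambda>x::real. - (inverse x ^ Suc (Suc 0)))"
    by (intro continuous_intros) auto
  show "(inverse has_real_derivative - (inverse x ^ Suc (Suc 0))) (at x)" if "x \<in> - {0}" for x :: real
    using that by (intro DERIV_inverse) auto
qed auto

lemma C1_on_norm: "C1_on (- {0}) (norm :: 'a::euclidean_space \<Rightarrow> real)"
proof -
  have 1: "C1_on {0<..} (sqrt :: real \<Rightarrow> real)"
    by (rule C1_on_real[where f' = "\<lambda>x. inverse (sqrt x) / 2"])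
       (auto intro!: DERIV_real_sqrt continuous_intros)
  show ?thesis
    by (rule C1_on_cong[OF C1_on_compose[OF 1 C1_on_inner[OF C1_on_ident C1_on_ident]]])
       (auto simp: norm_eq_sqrt_inner)
qed

lemma C1_on_sgn: "C1_on (- {0}) (sgn :: 'a::euclidean_space \<Rightarrow> 'a)"
proof (rule C1_on_cong)
  show "C1_on (- {0}) (\<lambda>x::'a. inverse (norm x) *\<^sub>R x)"
    by (rule C1_on_scaleR[OF C1_on_compose[OF C1_on_inverse C1_on_norm] C1_on_ident]) auto
qed (simp add: sgn_div_norm)

text \<open>Fields built from \<open>norm\<close> and \<open>sgn\<close> are C1 only off the origin.
  If they vanish off a compact K inside U, then U and the complement of K are open and cover the
  space, and on the overlap uniqueness of derivatives makes the two candidates agree.\<close>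

lemma C1_on_extend:
  assumes "C1_on U f" "compact K" "K \<subseteq> U" "\<And>x. x \<notin> K \<Longrightarrow> f x = 0"
  shows "C1_on UNIV f"
proof -
  obtain f' where f': "open U" "\<And>x. x \<in> U \<Longrightarrow> (f has_derivative blinfun_apply (f' x)) (at x)"
    "continuous_on U f'" using C1_onE[OF assms(1)] by blast
  have oK: "open (- K)" using assms(2) by (simp add: compact_imp_closed open_Compl)
  have d0: "(f has_derivative blinfun_apply 0) (at x)" if "x \<in> - K" for x
  proof -
    have "((\<lambda>_. 0) has_derivative blinfun_apply 0) (at x)" by (simp add: zero_blinfun.rep_eq)
    then show ?thesis
      by (rule has_derivative_transform_within_open[OF _ oK that]) (simp add: assms(4))
  qed
  define D where "D x = (if x \<in> U then f' x else 0)" for x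
  have eq0: "D x = 0" if "x \<in> - K" for x
  proof (cases "x \<in> U")
    case True
    have "blinfun_apply (f' x) = blinfun_apply 0"
      by (rule has_derivative_unique[OF f'(2)[OF True] d0[OF that]])
    then show ?thesis by (simp add: D_def blinfun_apply_inject)
  qed (simp add: D_def)
  have "continuous_on (U \<union> - K) D"
  proof (rule continuous_on_open_Un[OF f'(1) oK])
    show "continuous_on U D" using f'(3) by (rule continuous_on_eq) (simp add: D_def)
    show "continuous_on (- K) D" by (rule continuous_on_eq[of _ "\<lambda>_. 0"]) (auto simp: eq0)
  qed
  moreover have "U \<union> - K = UNIV" using assms(3) by auto
  moreover have "(f has_derivative blinfun_apply (D x)) (at x)" for x
    by (cases "x \<in> U") (use f'(2) d0[of x] assms(3) in \<open>auto simp: D_def\<close>)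
  ultimately show ?thesis
    by (intro C1_onI[where f' = D]) auto
qed

section \<open>Divergence, and the derivatives of the norm and of \<open>sgn\<close>\<close>

lemma divergence_eq:
  assumes "(Y has_derivative D) (at x)"
  shows "divergence Y x = (\<Sum>b\<in>Basis. D b \<bullet> b)"
  using frechet_derivative_at[OF assms] by (simp add: divergence_def)

lemma C1_on_imp_C1c_field:
  fixes Y :: "'a::euclidean_space \<Rightarrow> 'a"
  assumes "C1_on U Y" "compact K" "K \<subseteq> U" "0 \<notin> K" "\<And>x. x \<notin> K \<Longrightarrow> Y x = 0"
  shows "C1c_field Y"
proof -
  obtain D where "\<And>x. (Y has_derivative blinfun_apply (D x)) (at x)" "continuous_on UNIV D"
    using C1_onE[OF C1_on_extend[OF assms(1,2,3,5)]] by (metis UNIV_I)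
  then have "\<exists>Y'. (\<forall>x. (Y has_derivative Y' x) (at x)) \<and> (\<forall>b\<in>Basis. continuous_on UNIV (\<lambda>x. Y' x b))"
    by (intro exI[of _ "\<lambda>x. blinfun_apply (D x)"]) (auto intro!: continuous_intros)
  then show ?thesis unfolding C1c_field_def using assms by blast
qed

lemma C1c_field_divergence:
  fixes Y :: "'a::euclidean_space \<Rightarrow> 'a"
  assumes "C1c_field Y" "\<And>x. x \<notin> K \<Longrightarrow> Y x = 0" "closed K"
  shows "continuous_on UNIV (divergence Y)" "\<And>x. x \<notin> K \<Longrightarrow> divergence Y x = 0"
proof -
  obtain Y' where Y': "\<And>x. (Y has_derivative Y' x) (at x)"
    "\<And>b. b\<in>Basis \<Longrightarrow> continuous_on UNIV (\<lambda>x. Y' x b)"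
    using assms(1) unfolding C1c_field_def by blast
  have "divergence Y = (\<lambda>x. \<Sum>b\<in>Basis. Y' x b \<bullet> b)"
    using divergence_eq[OF Y'(1)] by auto
  then show "continuous_on UNIV (divergence Y)"
    by (auto intro!: continuous_intros Y')
  fix x assume x: "x \<notin> K"
  have "(Y has_derivative (\<lambda>_. 0)) (at x)"
    by (rule has_derivative_transform_within_open[OF has_derivative_const[of 0] open_Compl[OF assms(3)]])
       (use x assms(2) in auto)
  then show "divergence Y x = 0" by (simp add: divergence_eq)
qed

lemma divergence_scaleR:
  fixes Z :: "'a::euclidean_space \<Rightarrow> 'a"
  assumes "(p has_derivative p') (at x)" "(Z has_derivative Z') (at x)"
  shows "divergence (\<lambda>x. p x *\<^sub>R Z x) x = p' (Z x) + p x * divergence Z x"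
proof -
  have lin: "linear p'" using assms(1) has_derivative_linear by blast
  have "((\<lambda>x. p x *\<^sub>R Z x) has_derivative (\<lambda>h. p x *\<^sub>R Z' h + p' h *\<^sub>R Z x)) (at x)"
    by (rule has_derivative_scaleR[OF assms])
  then have "divergence (\<lambda>x. p x *\<^sub>R Z x) x = (\<Sum>b\<in>Basis. (p x *\<^sub>R Z' b + p' b *\<^sub>R Z x) \<bullet> b)"
    by (rule divergence_eq)
  also have "\<dots> = (\<Sum>b\<in>Basis. p' b * (Z x \<bullet> b)) + p x * (\<Sum>b\<in>Basis. Z' b \<bullet> b)"
    by (simp add: inner_add_left sum.distrib sum_distrib_left add.commute)
  also have "(\<Sum>b\<in>Basis. p' b * (Z x \<bullet> b)) = p' (\<Sum>b\<in>Basis. (Z x \<bullet> b) *\<^sub>R b)"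
    by (simp add: linear_sum[OF lin] linear_cmul[OF lin] mult.commute)
  finally show ?thesis by (simp add: euclidean_representation divergence_eq[OF assms(2)])
qed

lemma divergence_ident: "divergence (\<lambda>x. x) (x::'a::euclidean_space) = real DIM('a)"
  by (subst divergence_eq[OF has_derivative_ident]) simp

lemma has_derivative_norm': 
  assumes "(x::'a::euclidean_space) \<noteq> 0" shows "(norm has_derivative (\<lambda>v. v \<bullet> sgn x)) (at x)"
  using has_derivative_norm[OF assms] by (simp add: inner_commute)

lemma has_derivative_sgn:
  fixes z :: "'a::euclidean_space"
  assumes "z \<noteq> 0"
  shows "(sgn has_derivative (\<lambda>v. (1 / norm z) *\<^sub>R (v - (v \<bullet> sgn z) *\<^sub>R sgn z))) (at z)"
proof -
  have "((\<lambda>x. inverse (norm x) *\<^sub>R x) has_derivative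
     (\<lambda>v. inverse (norm z) *\<^sub>R v + (- (inverse (norm z) * (v \<bullet> sgn z) * inverse (norm z))) *\<^sub>R z)) (at z)"
    by (rule has_derivative_scaleR[OF Deriv.has_derivative_inverse[OF _ has_derivative_norm'[OF assms]]])
       (use assms in auto)
  moreover have "(\<lambda>x::'a. inverse (norm x) *\<^sub>R x) = sgn" by (auto simp: sgn_div_norm)
  moreover have "inverse (norm z) *\<^sub>R v + (- (inverse (norm z) * (v \<bullet> sgn z) * inverse (norm z))) *\<^sub>R z
    = (1 / norm z) *\<^sub>R (v - (v \<bullet> sgn z) *\<^sub>R sgn z)" for v
    by (simp add: sgn_div_norm algebra_simps divide_inverse)
  ultimately show ?thesis by simp
qed

section \<open>C1 cutoff functions and approximation of indicator functions\<close>

lemma C1_on_pos_square: "C1_on UNIV (\<lambda>t::real. (max 0 t)\<^sup>2)"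
proof (rule C1_on_real[where f' = "\<lambda>t. 2 * max 0 t"])
  fix t :: real
  consider "t < 0" | "t = 0" | "t > 0" by linarith
  then show "((\<lambda>t. (max 0 t)\<^sup>2) has_real_derivative 2 * max 0 t) (at t)"
  proof cases
    case 1
    show ?thesis
      by (rule has_field_derivative_transform_within_open[where S = "{..<0}" and f = "\<lambda>_. 0"])
         (use 1 in auto)
  next
    case 2
    have "((\<lambda>t::real. (max 0 t)\<^sup>2) has_real_derivative 0) (at 0)"
      unfolding has_field_derivative_iff
    proof (rule Lim_null_comparison)
      show "\<forall>\<^sub>F y in at (0::real). norm (((max 0 y)\<^sup>2 - (max 0 0)\<^sup>2) / (y - 0)) \<le> \<bar>y\<bar>"
        by (auto simp: max_def power2_eq_square intro!: always_eventually)
      show "((\<lambda>y::real. \<bar>y\<bar>) \<longlongrightarrow> 0) (at 0)"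
        by (auto intro!: tendsto_eq_intros)
    qed
    then show ?thesis using 2 by simp
  next
    case 3
    show ?thesis
      by (rule has_field_derivative_transform_within_open[where S = "{0<..}" and f = "\<lambda>t. t\<^sup>2"])
         (use 3 in \<open>auto intro!: derivative_eq_intros\<close>)
  qed
qed (auto intro!: continuous_intros)

lemma C1_on_sum:
  assumes "finite I" "open U" "\<And>i. i \<in> I \<Longrightarrow> C1_on U (f i)"
  shows "C1_on U (\<lambda>x. \<Sum>i\<in>I. f i x)"
  using assms(1,3) by (induction I) (auto intro!: C1_on_add C1_on_const assms(2))

lemma C1_on_divide_const:
  fixes f :: "'a::euclidean_space \<Rightarrow> real"
  assumes "C1_on U f"
  shows "C1_on U (\<lambda>x. f x / c)"
  unfolding divide_inverse by (rule C1_on_mult[OF assms C1_on_const[OF C1_on_open[OF assms]]])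

text \<open>The bumps \<open>b y\<close> of a finite cover add up to S, which by compactness is at
  least some c > 0 on K. The C1 clamp t -> 1 - (max 0 (1 - t/c))^2 sends all values from c upwards
  to 1 and the value 0 to 0.\<close>

lemma C1_urysohn:
  fixes K :: "'a::euclidean_space set"
  assumes "compact K" "open W" "K \<subseteq> W"
  obtains p :: "'a \<Rightarrow> real" and L where "C1_on UNIV p" "compact L" "L \<subseteq> W" "\<And>x. 0 \<le> p x" "\<And>x. p x \<le> 1"
    "\<And>x. x \<in> K \<Longrightarrow> p x = 1" "\<And>x. x \<notin> L \<Longrightarrow> p x = 0"
proof (cases "K = {}")
  case True
  show ?thesis by (rule that[of "\<lambda>_. 0" "{}"]) (use True in \<open>auto intro: C1_on_const\<close>)
next
  case False
  have "\<exists>r>0. cball x r \<subseteq> W" if "x \<in> K" for x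
    using assms that open_contains_cball by blast
  then obtain r where r: "\<And>x. x \<in> K \<Longrightarrow> r x > 0" "\<And>x. x \<in> K \<Longrightarrow> cball x (r x) \<subseteq> W" by metis
  have "K \<subseteq> (\<Union>x\<in>K. ball x (r x))" using r(1) by force
  then obtain I where I: "I \<subseteq> K" "finite I" "K \<subseteq> (\<Union>x\<in>I. ball x (r x))"
    using compactE_image[OF assms(1), of K "\<lambda>x. ball x (r x)"] by auto
  define b where "b y x = (max 0 (1 - ((x - y) \<bullet> (x - y)) / (r y)\<^sup>2))\<^sup>2" for x y
  define S where "S x = (\<Sum>y\<in>I. b y x)" for x
  have C1b: "C1_on UNIV (b y)" for y
    unfolding b_def
    by (rule C1_on_compose[OF C1_on_pos_square C1_on_diff[OF C1_on_const C1_on_divide_const[OF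
          C1_on_inner[OF C1_on_diff C1_on_diff]]]]) (auto intro: C1_on_const C1_on_ident)
  have C1S: "C1_on UNIV S" unfolding S_def by (intro C1_on_sum C1b I) auto
  have b0: "b y x \<ge> 0" for x y by (simp add: b_def)
  have bpos: "b y x > 0" if "y \<in> I" "x \<in> ball y (r y)" for x y
  proof -
    have "r y > 0" using that I r by auto
    have "(x - y) \<bullet> (x - y) < (r y)\<^sup>2"
      unfolding power2_norm_eq_inner[symmetric]
      by (rule power_strict_mono) (use that \<open>r y > 0\<close> in \<open>auto simp: dist_norm norm_minus_commute\<close>)
    then show ?thesis using \<open>r y > 0\<close> by (simp add: b_def zero_less_power divide_less_eq)
  qed
  have bz: "b y x = 0" if "y \<in> I" "x \<notin> cball y (r y)" for x y
  proof -
    have "r y > 0" using that I r by auto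
    have "(r y)\<^sup>2 \<le> (x - y) \<bullet> (x - y)"
      unfolding power2_norm_eq_inner[symmetric]
      by (rule power_mono) (use that \<open>r y > 0\<close> in \<open>auto simp: dist_norm norm_minus_commute\<close>)
    then show ?thesis using \<open>r y > 0\<close> by (simp add: b_def max_def le_divide_eq)
  qed
  have Spos: "S x > 0" if xK: "x \<in> K" for x
  proof -
    obtain y where "y \<in> I" "x \<in> ball y (r y)" using I(3) xK by blast
    then show ?thesis unfolding S_def using bpos b0 I(2) by (intro sum_pos2[of I y]) auto
  qed
  obtain x0 where x0: "x0 \<in> K" "\<And>x. x \<in> K \<Longrightarrow> S x0 \<le> S x"
    using continuous_attains_inf[OF assms(1) False continuous_on_subset[OF C1_on_imp_continuous_on[OF C1S]]] by auto
  define c where "c = S x0"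
  have c: "c > 0" using Spos x0 by (simp add: c_def)
  define p where "p x = 1 - (max 0 (1 - S x / c))\<^sup>2" for x
  have S0: "S x \<ge> 0" for x unfolding S_def by (intro sum_nonneg b0)
  have rng: "0 \<le> max 0 (1 - S x / c)" "max 0 (1 - S x / c) \<le> 1" for x using S0[of x] c by auto
  show ?thesis
  proof (rule that[of p "\<Union>y\<in>I. cball y (r y)"])
    show "C1_on UNIV p" unfolding p_def
      by (rule C1_on_diff[OF C1_on_const C1_on_compose[OF C1_on_pos_square C1_on_diff[OF C1_on_const C1_on_divide_const[OF C1S]]]]) auto
    show "compact (\<Union>y\<in>I. cball y (r y))" using I by auto
    show "(\<Union>y\<in>I. cball y (r y)) \<subseteq> W" using I r by blast
    show "0 \<le> p x" for x using power_le_one[OF rng, of x 2] by (simp add: p_def)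
    show "p x \<le> 1" for x by (simp add: p_def)
    show "p x = 1" if "x \<in> K" for x using x0(2)[OF that] c by (simp add: p_def c_def max_def)
    show "p x = 0" if "x \<notin> (\<Union>y\<in>I. cball y (r y))" for x
      using that bz by (simp add: p_def S_def sum.neutral)
  qed
qed

text \<open>Regularity of M gives a compact K inside B and an open W around B with W - K of measure
  below e. A cutoff that is 1 on K and supported in W and U differs from the indicator of B only on
  W - K, by at most 1.\<close>

lemma C1_approx_indicator:
  fixes M :: "'a::euclidean_space measure"
  assumes "sets M = sets borel" "finite_measure M" "B \<in> sets borel" "open U" "B \<subseteq> U" "e > 0"
  obtains p :: "'a \<Rightarrow> real" and L where "C1_on UNIV p" "compact L" "L \<subseteq> U" "\<And>x. 0 \<le> p x" "\<And>x. p x \<le> 1"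
    "\<And>x. x \<notin> L \<Longrightarrow> p x = 0" "(\<integral>x. \<bar>p x - indicator B x\<bar> \<partial>M) < e"
proof -
  interpret finite_measure M by fact
  have fin: "emeasure M (space M) \<noteq> \<infinity>" by simp
  have e2: "ennreal (measure M B) < ennreal (measure M B + e / 2)" using assms(6) by (subst ennreal_less_iff) auto
  obtain W where W: "B \<subseteq> W" "open W" "emeasure M W < ennreal (measure M B + e / 2)"
    using outer_regular[OF assms(1) fin assms(3)] e2 unfolding emeasure_eq_measure
    by (auto simp: INF_less_iff)
  obtain K where K: "K \<subseteq> B" "compact K" "measure M B < measure M K + e / 2"
  proof (cases "measure M B < e / 2")
    \<comment> \<open>The empty set serves as K here. In the other case
      \<open>measure M B - e / 2\<close> is nonnegative, so that \<open>ennreal\<close> does not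
      truncate it.\<close>
    case True
    then show ?thesis using that[of "{}"] by simp
  next
    case False
    then have "ennreal (measure M B - e / 2) < ennreal (measure M B)" using assms(6) by (subst ennreal_less_iff) auto
    also have "\<dots> = (SUP K \<in> {K. K \<subseteq> B \<and> compact K}. emeasure M K)"
      using inner_regular[OF assms(1) fin assms(3)] unfolding emeasure_eq_measure by simp
    finally obtain K where "K \<subseteq> B" "compact K" "ennreal (measure M B - e / 2) < emeasure M K"
      unfolding less_SUP_iff by auto
    then show ?thesis using that[of K] False
      by (auto simp: emeasure_eq_measure ennreal_less_iff)
  qed
  obtain p L where p: "C1_on UNIV p" "compact L" "L \<subseteq> W \<inter> U" "\<And>x. 0 \<le> p x" "\<And>x. p x \<le> 1"
    "\<And>x. x \<in> K \<Longrightarrow> p x = 1" "\<And>x. x \<notin> L \<Longrightarrow> p x = (0::real)"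
  proof (rule C1_urysohn[OF K(2), of "W \<inter> U"])
    show "open (W \<inter> U)" using W assms by auto
    show "K \<subseteq> W \<inter> U" using W assms K by auto
  qed blast
  have meas: "K \<in> sets M" "W \<in> sets M" "B \<in> sets M"
    using K(2) W(2) assms by (auto intro: compact_imp_closed borel_closed)
  have "(\<integral>x. \<bar>p x - indicator B x\<bar> \<partial>M) \<le> (\<integral>x. indicator (W - K) x \<partial>M)"
  proof (rule integral_mono')
    show "integrable M (\<lambda>x. indicator (W - K) x :: real)" using meas by (auto simp: less_top[symmetric])
    fix x
    show "\<bar>p x - indicator B x\<bar> \<le> indicator (W - K) x"
    proof (cases "x \<in> W - K")
      case True
      then show ?thesis using p(4)[of x] p(5)[of x] by (auto simp: indicator_def)
    next
      case False
      then show ?thesis using p(3,6,7) K(1) W(1) by (cases "x \<in> K") (auto simp: indicator_def subset_iff)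
    qed
  qed auto
  also have "\<dots> = measure M W - measure M K"
    using meas K W by (simp add: finite_measure_Diff order.trans)
  also have "\<dots> < e"
  proof -
    have "measure M W < measure M B + e / 2"
      using W(3) unfolding emeasure_eq_measure by (subst (asm) ennreal_less_iff) auto
    then show ?thesis using K(3) by linarith
  qed
  finally show ?thesis using that[OF p(1,2) _ p(4,5,7)] p(3) by blast
qed

text \<open>Lebesgue measure is made finite by restricting it to U. The cutoff and the indicator
  both vanish off U, so the error is the same for the unrestricted measure.\<close>

lemma C1_approx_indicator_lborel:
  fixes B U :: "'a::euclidean_space set"
  assumes "open U" and fin: "emeasure lborel U < \<infinity>" and B[measurable]: "B \<in> sets borel" and BU: "B \<subseteq> U" and e: "e > 0"
  obtains p :: "'a \<Rightarrow> real" and L where "C1_on UNIV p" "\<And>x. 0 \<le> p x" "\<And>x. p x \<le> 1"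
    "compact L" "L \<subseteq> U" "\<And>x. x \<notin> L \<Longrightarrow> p x = 0"
    "integrable lborel (\<lambda>x. \<bar>p x - indicator B x\<bar>)" "(\<integral>x. \<bar>p x - indicator B x\<bar> \<partial>lborel) < e"
proof -
  have U[measurable]: "U \<in> sets borel" using assms(1) by simp
  let ?M = "density lborel (\<lambda>x. ennreal (indicator U x)) :: 'a measure"
  have fM: "finite_measure ?M"
    by (rule finite_measureI) (use fin in \<open>auto simp: emeasure_density less_top ennreal_indicator\<close>)
  have sM: "sets ?M = sets borel" by simp
  obtain p :: "'a \<Rightarrow> real" and L where p: "C1_on UNIV p" "compact L" "L \<subseteq> U" "\<And>x. 0 \<le> p x" "\<And>x. p x \<le> 1"
    "\<And>x. x \<notin> L \<Longrightarrow> p x = 0" "(\<integral>x. \<bar>p x - indicator B x\<bar> \<partial>?M) < e"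
    using C1_approx_indicator[OF sM fM B assms(1) BU e] by blast
  have [measurable]: "p \<in> borel_measurable borel"
    by (rule borel_measurable_continuous_onI[OF C1_on_imp_continuous_on[OF p(1)]])
  define F where "F x = \<bar>p x - indicator B x\<bar>" for x
  have Fm[measurable]: "F \<in> borel_measurable borel" unfolding F_def by measurable
  have FU: "(\<lambda>x. indicator U x *\<^sub>R F x) = F"
    using p(3,6) BU by (auto simp: F_def indicator_def fun_eq_iff)
  have F2: "norm (F x) \<le> 2" for x using p(4,5)[of x] by (auto simp: F_def indicator_def)
  have "integrable ?M F" by (rule finite_measure.integrable_const_bound[OF fM, where B = 2]) (use F2 in auto)
  then have "integrable lborel (\<lambda>x. indicator U x *\<^sub>R F x)" by (subst (asm) integrable_density) auto
  then have Fi: "integrable lborel F" unfolding FU .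
  have "(\<integral>x. F x \<partial>?M) = (\<integral>x. indicator U x *\<^sub>R F x \<partial>lborel)" by (subst integral_density) auto
  then have Fe: "(\<integral>x. F x \<partial>lborel) < e" using p(7) unfolding FU F_def[symmetric] by linarith
  show ?thesis by (rule that[OF p(1,4,5,2,3,6) Fi[unfolded F_def[abs_def]] Fe[unfolded F_def]])
qed

text \<open>Fubini and the fundamental theorem of calculus in t. The time interval has length 1, so
  a bound on the rate of change at every time bounds the total change by the same B. In the
  applications to translations and to drifts the rate is recognised as a divergence, up to an
  error.\<close>

lemma flow_estimate:
  fixes u d :: "real \<Rightarrow> 'a::euclidean_space \<Rightarrow> real"
  assumes E: "E \<in> sets borel" and K: "compact K"
    and deriv: "\<And>t x. 0 \<le> t \<Longrightarrow> t \<le> 1 \<Longrightarrow> ((\<lambda>t. u t x) has_real_derivative d t x) (at t)"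
    and cont: "continuous_on ({0..1} \<times> K) (\<lambda>(t, x). d t x)"
    and supp: "\<And>t x. 0 \<le> t \<Longrightarrow> t \<le> 1 \<Longrightarrow> x \<notin> K \<Longrightarrow> d t x = 0"
    and bound: "\<And>t. 0 \<le> t \<Longrightarrow> t \<le> 1 \<Longrightarrow> (\<integral>x. indicator E x * d t x \<partial>lborel) \<le> B"
  shows "(\<integral>x. indicator E x * (u 1 x - u 0 x) \<partial>lborel) \<le> B"
proof -
  let ?C = "{0..1::real} \<times> K"
  have cC: "compact ?C" by (intro compact_Times K) auto
  have sC: "?C \<in> sets borel" using cC by (intro borel_closed compact_imp_closed)
  obtain D where "\<forall>y\<in>(\<lambda>(t, x). d t x) ` ?C. norm y \<le> D"
    using compact_imp_bounded[OF compact_continuous_image[OF cont cC]]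
    unfolding bounded_iff by blast
  then have D: "\<And>t x. (t, x) \<in> ?C \<Longrightarrow> \<bar>d t x\<bar> \<le> D" by force
  \<comment> \<open>Continuity of d is known only on the compact product; extending by zero yields a
    Borel function on the whole product space.\<close>
  define g where "g z = indicator ?C z * (case z of (t, x) \<Rightarrow> d t x)" for z
  have gm: "g \<in> borel_measurable borel"
    using borel_measurable_continuous_on_indicator[OF sC cont] by (simp add: g_def[abs_def])
  define f where "f z = indicator E (snd z) * g z" for z
  have fm: "f \<in> borel_measurable borel"
  proof -
    have "snd \<in> (borel :: (real \<times> 'a) measure) \<rightarrow>\<^sub>M borel"
      by (rule borel_measurable_continuous_onI) (intro continuous_intros)
    then have "(\<lambda>z::real \<times> 'a. indicator E (snd z) :: real) \<in> borel_measurable borel"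
      by (rule measurable_compose[OF _ borel_measurable_indicator[OF E]])
    then show ?thesis unfolding f_def[abs_def] using gm by (rule borel_measurable_times)
  qed
  have gint: "integrable lborel (\<lambda>z. indicator ?C z *\<^sub>R D)"
    using cC sC by (intro integrable_real_indicator integrable_scaleR_left emeasure_compact_finite) auto
  have fi: "integrable lborel f"
  proof (rule Bochner_Integration.integrable_bound[OF gint])
    show "f \<in> borel_measurable lborel" using fm by simp
    show "AE z in lborel. norm (f z) \<le> norm (indicator ?C z *\<^sub>R D)"
    proof (rule AE_I2)
      fix z :: "real \<times> 'a"
      obtain t x where z: "z = (t, x)" by (cases z)
      show "norm (f z) \<le> norm (indicator ?C z *\<^sub>R D)"
        using D[of t x] by (auto simp: z f_def g_def indicator_def split: if_splits)
    qed
  qed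
  have fi': "integrable (lborel \<Otimes>\<^sub>M lborel) f" using fi by (simp add: lborel_prod)
  have feq: "f (t, x) = indicator {0..1} t * (indicator E x * d t x)" for t x
    using supp[of t x] by (auto simp: f_def g_def indicator_def)
  have "(\<integral>x. indicator E x * (u 1 x - u 0 x) \<partial>lborel) = (\<integral>x. (\<integral>t. f (t, x) \<partial>lborel) \<partial>lborel)"
  proof (rule Bochner_Integration.integral_cong[OF refl])
    fix x :: 'a
    have c: "continuous_on {0..1} (\<lambda>t. d t x)"
    proof (cases "x \<in> K")
      case True
      have "continuous_on {0..1} (\<lambda>t. case (t, x) of (t, x) \<Rightarrow> d t x)"
        by (rule continuous_on_compose2[OF cont]) (auto intro!: continuous_intros True)
      then show ?thesis by simp
    next
      case False
      show ?thesis
        by (rule continuous_on_eq[of _ "\<lambda>_. 0", OF continuous_on_const]) (use False in \<open>auto simp: supp\<close>)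
    qed
    have "(\<integral>t. indicator {0..1} t *\<^sub>R d t x \<partial>lborel) = u 1 x - u 0 x"
    proof (rule integral_FTC_Icc[where F="\<lambda>t. u t x" and f="\<lambda>t. d t x", OF _ _ c])
      fix t :: real assume "0 \<le> t" "t \<le> 1"
      then have "((\<lambda>t. u t x) has_vector_derivative d t x) (at t)"
        using deriv[of t x] by (simp add: has_real_derivative_iff_has_vector_derivative)
      then show "((\<lambda>t. u t x) has_vector_derivative d t x) (at t within {0..1})"
        by (rule has_vector_derivative_at_within)
    qed simp
    moreover have "(\<integral>t. f (t, x) \<partial>lborel) = indicator E x * (\<integral>t. indicator {0..1} t *\<^sub>R d t x \<partial>lborel)"
      unfolding feq by (subst integral_mult_right_zero[symmetric]) (simp add: mult_ac)
    ultimately show "indicator E x * (u 1 x - u 0 x) = (\<integral>t. f (t, x) \<partial>lborel)" by simp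
  qed
  also have "\<dots> = (\<integral>t. (\<integral>x. f (t, x) \<partial>lborel) \<partial>lborel)"
    using lborel_pair.Fubini_integral[of "\<lambda>t x. f (t, x)"] fi' by simp
  also have "\<dots> \<le> (\<integral>t. indicator {0..1::real} t *\<^sub>R B \<partial>lborel)"
  proof (rule Bochner_Integration.integral_mono)
    show "integrable lborel (\<lambda>t. \<integral>x. f (t, x) \<partial>lborel)"
      using lborel_pair.integrable_fst[of "\<lambda>t x. f (t, x)"] fi' by simp
    show "integrable lborel (\<lambda>t. indicator {0..1::real} t *\<^sub>R B)" by simp
    fix t :: real
    have "(\<integral>x. f (t, x) \<partial>lborel) = indicator {0..1} t * (\<integral>x. indicator E x * d t x \<partial>lborel)"
      unfolding feq by (rule integral_mult_right_zero)
    then show "(\<integral>x. f (t, x) \<partial>lborel) \<le> indicator {0..1} t *\<^sub>R B"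
      using bound[of t] by (auto simp: indicator_def)
  qed
  also have "\<dots> = B" by simp
  finally show ?thesis .
qed

subsection \<open>Integration in spherical shells\<close>

text \<open>The image of Lebesgue measure under the norm is determined by its values on the
  half-lines {..a}. These are ball volumes, and their derivative in a is the density.\<close>

lemma nn_integral_norm:
  fixes F :: "real \<Rightarrow> ennreal"
  assumes F: "F \<in> borel_measurable borel"
  shows "(\<integral>\<^sup>+x. F (norm (x::'a::euclidean_space)) \<partial>lborel) =
    (\<integral>\<^sup>+r. F r * ennreal (real DIM('a) * unit_ball_vol (real DIM('a)) * r ^ (DIM('a) - 1)) * indicator {0..} r \<partial>lborel)"
proof -
  let ?n = "DIM('a)" and ?w = "unit_ball_vol (real DIM('a))"
  let ?d = "\<lambda>r. ennreal (real ?n * ?w * r ^ (?n - 1)) * indicator {0..} r"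
  have n: "?n \<ge> 1" by (simp add: Suc_leI)
  have eq: "distr lborel borel (norm :: 'a \<Rightarrow> real) = density lborel ?d" (is "?M = ?N")
  proof (rule measure_eqI_generator_eq[where E = "range (\<lambda>a. {..a::real})" and \<Omega> = UNIV and A = "\<lambda>i. {..real i}"])
    show "Int_stable (range (\<lambda>a. {..a::real}))" by (auto simp: Int_stable_def)
    show "sets ?M = sigma_sets UNIV (range (\<lambda>a. {..a::real}))" by (simp add: borel_eq_atMost)
    show "sets ?N = sigma_sets UNIV (range (\<lambda>a. {..a::real}))" by (simp add: borel_eq_atMost)
    show "range (\<lambda>i. {..real i}) \<subseteq> range (\<lambda>a. {..a::real})" by auto
    show "(\<Union>i. {..real i}) = UNIV" using real_arch_simple by auto
    have vM: "emeasure ?M {..a} = (if a < 0 then 0 else ennreal (?w * a ^ ?n))" for a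
    proof -
      have "emeasure ?M {..a} = emeasure lborel {x::'a. norm x \<le> a}"
        by (subst emeasure_distr) (auto simp: vimage_def)
      moreover have "{x::'a. norm x \<le> a} = (if a < 0 then {} else cball 0 a)"
        by (auto simp: not_less dist_norm dest: order_trans[OF norm_ge_zero])
      ultimately show ?thesis by (auto simp: emeasure_cball)
    qed
    show "emeasure ?M {..real i} \<noteq> \<infinity>" for i by (simp add: vM)
    fix X assume "X \<in> range (\<lambda>a. {..a::real})"
    then obtain a where X: "X = {..a}" by auto
    have "emeasure ?N {..a} = (\<integral>\<^sup>+r. ennreal (real ?n * ?w * r ^ (?n - 1)) * indicator {0..a} r \<partial>lborel)"
      by (subst emeasure_density) (auto intro!: nn_integral_cong simp: indicator_def)
    also have "\<dots> = (if a < 0 then 0 else ennreal (?w * a ^ ?n))"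
    proof (cases "a < 0")
      case False
      have "(\<integral>\<^sup>+r. ennreal (real ?n * ?w * r ^ (?n - 1)) * indicator {0..a} r \<partial>lborel)
        = ennreal (?w * a ^ ?n - ?w * 0 ^ ?n)"
      proof (rule nn_integral_FTC_Icc)
        show "((\<lambda>r. ?w * r ^ ?n) has_real_derivative real ?n * ?w * r ^ (?n - 1)) (at r)" for r
          by (auto intro!: derivative_eq_intros)
      qed (use False in auto)
      then show ?thesis using n False by (simp add: zero_power)
    qed auto
    finally show "emeasure ?M X = emeasure ?N X" by (simp add: X vM)
  qed auto
  have "(\<integral>\<^sup>+x. F (norm (x::'a)) \<partial>lborel) = (\<integral>\<^sup>+r. F r \<partial>?M)"
    using F by (subst nn_integral_distr) auto
  also have "\<dots> = (\<integral>\<^sup>+r. ?d r * F r \<partial>lborel)" unfolding eq using F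
    by (subst nn_integral_density) auto
  finally show ?thesis by (simp add: mult_ac)
qed

lemma nn_integral_scaleR:
  fixes G :: "'a::euclidean_space \<Rightarrow> ennreal"
  assumes "G \<in> borel_measurable borel" "c > 0"
  shows "(\<integral>\<^sup>+x. G x \<partial>lborel) = ennreal (c ^ DIM('a)) * (\<integral>\<^sup>+y. G (c *\<^sub>R y) \<partial>lborel)"
  using assms
  by (subst lborel_affine[of c 0]) (auto simp: nn_integral_density nn_integral_distr nn_integral_cmult)

lemma nn_integral_translate:
  fixes G :: "'a::euclidean_space \<Rightarrow> ennreal"
  assumes "G \<in> borel_measurable borel"
  shows "(\<integral>\<^sup>+y. G (t + y) \<partial>lborel) = (\<integral>\<^sup>+x. G x \<partial>lborel)"
  using assms
  by (subst (2) lborel_affine[of 1 t]) (auto simp: nn_integral_density nn_integral_distr nn_integral_cmult)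

lemma measurable_sgn_euclidean [measurable]: "(sgn :: 'a::euclidean_space \<Rightarrow> 'a) \<in> borel_measurable borel"
  unfolding sgn_div_norm[abs_def] by measurable

text \<open>Averaging over a thickened sphere in place of the unit sphere keeps everything in
  terms of Lebesgue measure; only scalings and Fubini are needed.\<close>

lemma nn_integral_spherical_average:
  fixes F :: "'a::euclidean_space \<Rightarrow> ennreal" and A :: "real set"
  assumes F[measurable]: "F \<in> borel_measurable borel" and A[measurable]: "A \<in> sets borel" and pos: "A \<subseteq> {0<..}"
  shows "(\<integral>\<^sup>+x. (\<integral>\<^sup>+z. indicator A (norm z) * F (norm x *\<^sub>R sgn z) \<partial>lborel) \<partial>(lborel :: 'a measure)) =
    (\<integral>\<^sup>+v. indicator A (1 / norm v) * ennreal (inverse (norm v) ^ (2 * DIM('a))) \<partial>(lborel :: 'a measure)) * (\<integral>\<^sup>+x. F x \<partial>lborel)"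
proof -
  let ?n = "DIM('a)"
  let ?i = "\<lambda>r. indicator A r :: ennreal"
  have "(\<integral>\<^sup>+x. (\<integral>\<^sup>+z. ?i (norm z) * F (norm x *\<^sub>R sgn z) \<partial>lborel) \<partial>(lborel :: 'a measure)) =
    (\<integral>\<^sup>+z. (\<integral>\<^sup>+x. ?i (norm z) * F (norm (x::'a) *\<^sub>R sgn (z::'a)) \<partial>lborel) \<partial>lborel)"
    by (rule lborel_pair.Fubini') measurable
  \<comment> \<open>Substituting x = |z| y turns |x| sgn z into |y| z, so that F no longer sees the
    normalisation of z.\<close>
  also have "\<dots> = (\<integral>\<^sup>+z. (\<integral>\<^sup>+y. ?i (norm z) * ennreal (norm z ^ ?n) * F (norm (y::'a) *\<^sub>R (z::'a)) \<partial>lborel) \<partial>lborel)"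
  proof (rule nn_integral_cong)
    fix z :: 'a
    show "(\<integral>\<^sup>+x. ?i (norm z) * F (norm (x::'a) *\<^sub>R sgn z) \<partial>lborel)
      = (\<integral>\<^sup>+y. ?i (norm z) * ennreal (norm z ^ ?n) * F (norm (y::'a) *\<^sub>R z) \<partial>lborel)"
    proof (cases "norm z \<in> A")
      case True
      then have z: "norm z > 0" using pos by auto
      have "(\<integral>\<^sup>+x. F (norm (x::'a) *\<^sub>R sgn z) \<partial>lborel)
        = ennreal (norm z ^ ?n) * (\<integral>\<^sup>+x. F (norm (norm z *\<^sub>R (x::'a)) *\<^sub>R sgn z) \<partial>lborel)"
        by (rule nn_integral_scaleR[OF _ z]) measurable
      moreover have "norm (norm z *\<^sub>R x) *\<^sub>R sgn z = norm x *\<^sub>R z" for x :: 'a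
        using z by (simp add: sgn_div_norm)
      ultimately show ?thesis using True
        by (simp add: nn_integral_cmult)
    qed simp
  qed
  also have "\<dots> = (\<integral>\<^sup>+y. (\<integral>\<^sup>+z. ?i (norm z) * ennreal (norm z ^ ?n) * F (norm (y::'a) *\<^sub>R (z::'a)) \<partial>lborel) \<partial>lborel)"
    by (rule lborel_pair.Fubini') measurable
  \<comment> \<open>Next u = |y| z. One factor |y|^(-n) comes from the change of volume, the other
    from |z|^n = (|u| / |y|)^n.\<close>
  also have "\<dots> = (\<integral>\<^sup>+y. (\<integral>\<^sup>+u. ?i (norm u / norm y) * ennreal (inverse (norm y) ^ (2 * ?n) * norm u ^ ?n) * F (u::'a) \<partial>lborel) \<partial>(lborel :: 'a measure))"
  proof (rule nn_integral_cong_AE)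
    show "AE y in (lborel :: 'a measure). (\<integral>\<^sup>+z. ?i (norm z) * ennreal (norm z ^ ?n) * F (norm (y::'a) *\<^sub>R (z::'a)) \<partial>lborel)
      = (\<integral>\<^sup>+u. ?i (norm u / norm y) * ennreal (inverse (norm y) ^ (2 * ?n) * norm u ^ ?n) * F (u::'a) \<partial>lborel)"
      using AE_lborel_singleton[of "0::'a"]
    proof eventually_elim
      case (elim y)
      then have y: "inverse (norm y) > 0" by simp
      have "(\<integral>\<^sup>+z. ?i (norm z) * ennreal (norm z ^ ?n) * F (norm y *\<^sub>R (z::'a)) \<partial>lborel)
        = ennreal (inverse (norm y) ^ ?n) * (\<integral>\<^sup>+z. ?i (norm (inverse (norm y) *\<^sub>R (z::'a))) * ennreal (norm (inverse (norm y) *\<^sub>R (z::'a)) ^ ?n)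
             * F (norm y *\<^sub>R (inverse (norm y) *\<^sub>R z)) \<partial>lborel)"
        by (rule nn_integral_scaleR[OF _ y]) measurable
      also have "\<dots> = (\<integral>\<^sup>+z. ennreal (inverse (norm y) ^ ?n) * (?i (norm (inverse (norm y) *\<^sub>R (z::'a))) * ennreal (norm (inverse (norm y) *\<^sub>R (z::'a)) ^ ?n)
             * F (norm y *\<^sub>R (inverse (norm y) *\<^sub>R z))) \<partial>lborel)"
        by (rule nn_integral_cmult[symmetric]) measurable
      also have "\<dots> = (\<integral>\<^sup>+u. ?i (norm u / norm y) * ennreal (inverse (norm y) ^ (2 * ?n) * norm u ^ ?n) * F (u::'a) \<partial>lborel)"
      proof (rule nn_integral_cong)
        fix u :: 'a
        have 1: "norm (inverse (norm y) *\<^sub>R u) = norm u / norm y" by (simp add: divide_inverse mult.commute)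
        have 2: "norm y *\<^sub>R (inverse (norm y) *\<^sub>R u) = u" using elim by simp
        have 3: "ennreal (inverse (norm y) ^ (2 * ?n) * norm u ^ ?n)
          = ennreal (inverse (norm y) ^ ?n) * ennreal ((norm u / norm y) ^ ?n)"
        proof -
          have "inverse (norm y) ^ (2 * ?n) * norm u ^ ?n = inverse (norm y) ^ ?n * (norm u / norm y) ^ ?n"
          proof -
            have "inverse (norm y) ^ (2 * ?n) = inverse (norm y) ^ ?n * inverse (norm y) ^ ?n"
              by (simp only: mult_2 power_add)
            moreover have "(norm u / norm y) ^ ?n = norm u ^ ?n * inverse (norm y) ^ ?n"
              by (simp only: divide_inverse power_mult_distrib)
            ultimately show ?thesis by (metis mult.assoc mult.commute)
          qed
          then show ?thesis by (simp add: ennreal_mult)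
        qed
        show "ennreal (inverse (norm y) ^ ?n) * (?i (norm (inverse (norm y) *\<^sub>R u)) * ennreal (norm (inverse (norm y) *\<^sub>R u) ^ ?n)
             * F (norm y *\<^sub>R (inverse (norm y) *\<^sub>R u)))
          = ?i (norm u / norm y) * ennreal (inverse (norm y) ^ (2 * ?n) * norm u ^ ?n) * F u"
          unfolding 1 2 3 by (simp add: mult_ac)
      qed
      finally show ?case .
    qed
  qed
  also have "\<dots> = (\<integral>\<^sup>+u. (\<integral>\<^sup>+y. ?i (norm u / norm y) * ennreal (inverse (norm y) ^ (2 * ?n) * norm u ^ ?n) * F (u::'a) \<partial>(lborel :: 'a measure)) \<partial>lborel)"
    by (rule lborel_pair.Fubini') measurable
  \<comment> \<open>Finally y = |u| v: all powers of |u| cancel, and the inner integral becomes a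
    constant.\<close>
  also have "\<dots> = (\<integral>\<^sup>+u. (\<integral>\<^sup>+v. ?i (1 / norm v) * ennreal (inverse (norm v) ^ (2 * ?n)) \<partial>(lborel :: 'a measure)) * F (u::'a) \<partial>lborel)"
  proof (rule nn_integral_cong_AE)
    show "AE u in (lborel :: 'a measure). (\<integral>\<^sup>+y. ?i (norm u / norm y) * ennreal (inverse (norm y) ^ (2 * ?n) * norm u ^ ?n) * F (u::'a) \<partial>(lborel :: 'a measure))
      = (\<integral>\<^sup>+v. ?i (1 / norm v) * ennreal (inverse (norm v) ^ (2 * ?n)) \<partial>(lborel :: 'a measure)) * F (u::'a)"
      using AE_lborel_singleton[of "0::'a"]
    proof eventually_elim
      case (elim u)
      then have u: "norm u > 0" by simp
      have "(\<integral>\<^sup>+y. ?i (norm u / norm y) * ennreal (inverse (norm y) ^ (2 * ?n) * norm u ^ ?n) * F u \<partial>(lborel :: 'a measure))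
        = (\<integral>\<^sup>+y. ?i (norm u / norm y) * ennreal (inverse (norm y) ^ (2 * ?n) * norm u ^ ?n) \<partial>(lborel :: 'a measure)) * F u"
        by (rule nn_integral_multc) measurable
      also have "(\<integral>\<^sup>+y. ?i (norm u / norm y) * ennreal (inverse (norm y) ^ (2 * ?n) * norm u ^ ?n) \<partial>(lborel :: 'a measure))
        = ennreal (norm u ^ ?n) * (\<integral>\<^sup>+v. ?i (norm u / norm (norm u *\<^sub>R v)) * ennreal (inverse (norm (norm u *\<^sub>R v)) ^ (2 * ?n) * norm u ^ ?n) \<partial>(lborel :: 'a measure))"
        by (rule nn_integral_scaleR[OF _ u]) measurable
      also have "\<dots> = (\<integral>\<^sup>+v. ennreal (norm u ^ ?n) * (?i (norm u / norm (norm u *\<^sub>R v)) * ennreal (inverse (norm (norm u *\<^sub>R v)) ^ (2 * ?n) * norm u ^ ?n)) \<partial>(lborel :: 'a measure))"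
        by (rule nn_integral_cmult[symmetric]) measurable
      also have "\<dots> = (\<integral>\<^sup>+v. ?i (1 / norm v) * ennreal (inverse (norm v) ^ (2 * ?n)) \<partial>(lborel :: 'a measure))"
      proof (rule nn_integral_cong)
        fix v :: 'a
        have 1: "norm u / norm (norm u *\<^sub>R v) = 1 / norm v" using u by simp
        have "norm u ^ ?n * (inverse (norm (norm u *\<^sub>R v)) ^ (2 * ?n) * norm u ^ ?n) = inverse (norm v) ^ (2 * ?n)"
          using u by (simp add: power_mult_distrib mult_2 mult_2_right power_add field_simps)
        then have 2: "ennreal (norm u ^ ?n) * ennreal (inverse (norm (norm u *\<^sub>R v)) ^ (2 * ?n) * norm u ^ ?n) = ennreal (inverse (norm v) ^ (2 * ?n))"
          by (subst ennreal_mult[symmetric]) auto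
        show "ennreal (norm u ^ ?n) * (?i (norm u / norm (norm u *\<^sub>R v)) * ennreal (inverse (norm (norm u *\<^sub>R v)) ^ (2 * ?n) * norm u ^ ?n))
          = ?i (1 / norm v) * ennreal (inverse (norm v) ^ (2 * ?n))"
          unfolding 1 2[symmetric] by (simp only: mult_ac)
      qed
      finally show ?case .
    qed
  qed
  also have "\<dots> = (\<integral>\<^sup>+v. ?i (1 / norm v) * ennreal (inverse (norm v) ^ (2 * ?n)) \<partial>(lborel :: 'a measure)) * (\<integral>\<^sup>+x. F x \<partial>lborel)"
    by (rule nn_integral_cmult) measurable
  finally show ?thesis .
qed

text \<open>The condition on 1 / |v| confines v to a shell of thickness at most 3 s on which the
  integrand is bounded. Linearity in s matters: set against a ball volume of order s^n it leaves
  s^(n-1), the power that matches h^(n-1).\<close>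

lemma spherical_average_constant_le:
  obtains c :: real where "c > 0" "\<And>s. 0 < s \<Longrightarrow> s \<le> 1/2 \<Longrightarrow>
    (\<integral>\<^sup>+v. indicator {1-s..1+s} (1 / norm v) * ennreal (inverse (norm v) ^ (2 * DIM('a))) \<partial>(lborel :: 'a::euclidean_space measure)) \<le> ennreal (c * s)"
proof
  let ?n = "DIM('a)"
  let ?w = "real ?n * unit_ball_vol (real ?n)"
  let ?c = "2 ^ (2 * ?n) * (?w * 2 ^ (?n - 1)) * 3"
  show "?c > 0" by simp
  fix s :: real assume s: "0 < s" "s \<le> 1/2"
  let ?J = "{1/(1+s)..1/(1-s)}"
  have len: "1/(1-s) - 1/(1+s) \<le> 3 * s"
  proof -
    have "s * s \<le> 1/2 * (1/2)" by (rule mult_mono) (use s in auto)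
    then have "3 * s * (1 - s * s) \<ge> 3 * s * (3/4)" using s by (intro mult_left_mono) auto
    then have "2 * s \<le> 3 * s * (1 - s * s)" using s by simp
    moreover have "1/(1-s) - 1/(1+s) = 2 * s / (1 - s * s)" using s by (simp add: field_simps)
    moreover have "1 - s * s > 0" using \<open>s * s \<le> 1/2 * (1/2)\<close> by simp
    ultimately show ?thesis by (simp add: divide_le_eq)
  qed
  have "(\<integral>\<^sup>+v. indicator {1-s..1+s} (1 / norm v) * ennreal (inverse (norm v) ^ (2 * ?n)) \<partial>(lborel :: 'a measure))
    = (\<integral>\<^sup>+r. indicator {1-s..1+s} (1 / r) * ennreal (inverse r ^ (2 * ?n)) * ennreal (?w * r ^ (?n - 1)) * indicator {0..} r \<partial>lborel)"
    by (rule nn_integral_norm) measurable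
  also have "\<dots> \<le> (\<integral>\<^sup>+r. ennreal (2 ^ (2 * ?n) * (?w * 2 ^ (?n - 1))) * indicator ?J r \<partial>lborel)"
  proof (rule nn_integral_mono)
    fix r :: real
    show "indicator {1-s..1+s} (1 / r) * ennreal (inverse r ^ (2 * ?n)) * ennreal (?w * r ^ (?n - 1)) * indicator {0..} r
      \<le> ennreal (2 ^ (2 * ?n) * (?w * 2 ^ (?n - 1))) * indicator ?J r"
    proof (cases "1 - s \<le> 1 / r \<and> 1 / r \<le> 1 + s \<and> 0 \<le> r")
      case True
      then have r: "r > 0" using s by (cases "r = 0") auto
      have J: "r \<in> ?J" using True r s by (auto simp: field_simps)
      have "r \<le> 2"
      proof -
        have "r * (1/2) \<le> r * (1 - s)" using r s by (intro mult_left_mono) auto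
        also have "\<dots> \<le> 1" using True r by (simp add: field_simps)
        finally show ?thesis by simp
      qed
      moreover have "inverse r \<le> 2" using True s by (auto simp: inverse_eq_divide)
      ultimately have "inverse r ^ (2 * ?n) * (?w * r ^ (?n - 1)) \<le> 2 ^ (2 * ?n) * (?w * 2 ^ (?n - 1))"
        using r by (intro mult_mono power_mono mult_left_mono) auto
      then have "ennreal (inverse r ^ (2 * ?n)) * ennreal (?w * r ^ (?n - 1)) \<le> ennreal (2 ^ (2 * ?n) * (?w * 2 ^ (?n - 1)))"
        using r by (subst ennreal_mult[symmetric]) (auto intro!: ennreal_leI)
      then show ?thesis using J True by (simp add: indicator_def)
    qed (auto simp: indicator_def)
  qed
  also have "\<dots> = ennreal (2 ^ (2 * ?n) * (?w * 2 ^ (?n - 1))) * ennreal (1/(1-s) - 1/(1+s))"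
    using s by (subst nn_integral_cmult_indicator) (auto simp: field_simps)
  also have "\<dots> = ennreal (2 ^ (2 * ?n) * (?w * 2 ^ (?n - 1)) * (1/(1-s) - 1/(1+s)))"
    by (rule ennreal_mult[symmetric]) (use s in \<open>auto intro!: frac_le\<close>)
  also have "\<dots> \<le> ennreal (?c * s)"
    using len by (intro ennreal_leI) (simp add: mult.assoc)
  finally show "(\<integral>\<^sup>+v. indicator {1-s..1+s} (1 / norm v) * ennreal (inverse (norm v) ^ (2 * ?n)) \<partial>(lborel :: 'a measure)) \<le> ennreal (?c * s)" .
qed

subsection \<open>Moving points along spheres\<close>

text \<open>For w uniformly distributed in a small ball, the point reached at time 1 is the radial
  projection onto the sphere through x of a uniformly distributed point near x. So the probability of
  landing in a set is controlled by the volume of the cone over its slice, and no measure on the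
  sphere is needed.\<close>

definition sphere_drift :: "'a::euclidean_space \<Rightarrow> real \<Rightarrow> 'a \<Rightarrow> 'a" where
  "sphere_drift w t x = norm x *\<^sub>R sgn (sgn x + t *\<^sub>R w)"

text \<open>The differential of \<open>sgn\<close> at z: projection orthogonal to z, divided by the
  length of z.\<close>

abbreviation sgn_deriv :: "'a::euclidean_space \<Rightarrow> 'a \<Rightarrow> 'a" where
  "sgn_deriv z v \<equiv> (1 / norm z) *\<^sub>R (v - (v \<bullet> sgn z) *\<^sub>R sgn z)"

lemma norm_sgn_nonzero: "x \<noteq> 0 \<Longrightarrow> norm (sgn (x::'a::euclidean_space)) = 1"
  by (simp add: norm_sgn)

lemma sgn_add_nonzero:
  fixes x w :: "'a::euclidean_space"
  assumes "x \<noteq> 0" "norm w \<le> s" "s \<le> 1/2" "0 \<le> t" "t \<le> 1"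
  shows "sgn x + t *\<^sub>R w \<noteq> 0"
proof
  assume "sgn x + t *\<^sub>R w = 0"
  then have "norm (sgn x) = norm (t *\<^sub>R w)" by (metis add_eq_0_iff norm_minus_cancel)
  moreover have "norm (t *\<^sub>R w) \<le> 1 * (1/2)" unfolding norm_scaleR by (rule mult_mono) (use assms in auto)
  ultimately show False using norm_sgn_nonzero[OF assms(1)] by simp
qed

lemma norm_sphere_drift:
  fixes x w :: "'a::euclidean_space"
  assumes "norm w \<le> s" "s \<le> 1/2" "0 \<le> t" "t \<le> 1"
  shows "norm (sphere_drift w t x) = norm x"
  using sgn_add_nonzero[OF _ assms, of x]
  by (cases "x = 0") (auto simp: sphere_drift_def norm_sgn)

lemma divergence_diff:
  assumes "(Y has_derivative D) (at x)" "(Z has_derivative F) (at x)"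
  shows "divergence (\<lambda>x. Y x - Z x) x = divergence Y x - divergence Z x"
  using divergence_eq[OF has_derivative_diff[OF assms]] divergence_eq[OF assms(1)] divergence_eq[OF assms(2)]
  by (simp add: inner_diff_left sum_subtractf)

text \<open>A velocity may be altered by multiples of the current point without changing the motion
  of its direction; \<open>drift_field\<close> uses this to make the velocity tangential.\<close>

lemma sgn_deriv_self: "sgn_deriv z (z::'a::euclidean_space) = 0"
  by (cases "z = 0") (auto simp: sgn_div_norm power2_norm_eq_inner[symmetric] power2_eq_square field_simps)

lemma linear_sgn_deriv: "linear (sgn_deriv (z::'a::euclidean_space))"
  by (rule linearI) (auto simp: inner_add_left algebra_simps)

lemma sphere_drift_time_derivative:
  fixes x w :: "'a::euclidean_space"
  assumes "norm w \<le> s" "s \<le> 1/2" "0 \<le> t" "t \<le> 1"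
    and p: "(p has_derivative blinfun_apply p') (at (sphere_drift w t x))"
  shows "((\<lambda>t. p (sphere_drift w t x)) has_real_derivative
    blinfun_apply p' (norm x *\<^sub>R sgn_deriv (sgn x + t *\<^sub>R w) w)) (at t)"
proof (cases "x = 0")
  case True
  then show ?thesis by (simp add: sphere_drift_def)
next
  case False
  let ?z = "sgn x + t *\<^sub>R w"
  have 1: "((\<lambda>t. sgn x + t *\<^sub>R w) has_derivative (\<lambda>h. h *\<^sub>R w)) (at t)"
    by (auto intro!: derivative_eq_intros)
  have 2: "((\<lambda>t. sgn (sgn x + t *\<^sub>R w)) has_derivative (\<lambda>h. sgn_deriv ?z (h *\<^sub>R w))) (at t)"
    by (rule has_derivative_compose[OF 1 has_derivative_sgn[OF sgn_add_nonzero[OF False assms(1-4)]]])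
  have 3: "((\<lambda>t. sphere_drift w t x) has_derivative (\<lambda>h. norm x *\<^sub>R sgn_deriv ?z (h *\<^sub>R w))) (at t)"
    unfolding sphere_drift_def by (rule has_derivative_scaleR_right[OF 2])
  have 4: "((\<lambda>t. p (sphere_drift w t x)) has_derivative (\<lambda>h. blinfun_apply p' (norm x *\<^sub>R sgn_deriv ?z (h *\<^sub>R w)))) (at t)"
    by (rule has_derivative_compose[OF 3 p])
  have "(\<lambda>h. blinfun_apply p' (norm x *\<^sub>R sgn_deriv ?z (h *\<^sub>R w))) = (*) (blinfun_apply p' (norm x *\<^sub>R sgn_deriv ?z w))"
  proof
    fix h
    have "sgn_deriv ?z (h *\<^sub>R w) = h *\<^sub>R sgn_deriv ?z w" by (rule linear_cmul[OF linear_sgn_deriv])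
    then have "norm x *\<^sub>R sgn_deriv ?z (h *\<^sub>R w) = h *\<^sub>R (norm x *\<^sub>R sgn_deriv ?z w)"
      by (metis scaleR_left_commute)
    then show "blinfun_apply p' (norm x *\<^sub>R sgn_deriv ?z (h *\<^sub>R w)) = blinfun_apply p' (norm x *\<^sub>R sgn_deriv ?z w) * h"
      by (simp only: blinfun.scaleR_right real_scaleR_def mult.commute)
  qed
  with 4 show ?thesis unfolding has_field_derivative_def by simp
qed

text \<open>The drift preserves norms, so a function supported in L, composed with the drift, is
  supported in the union of the spheres that meet L.\<close>

lemma compact_norm_hull:
  assumes "compact (L :: 'a::euclidean_space set)"
  shows "compact {x::'a. norm x \<in> norm ` L}"
proof -
  have c: "compact (norm ` L)" by (rule compact_continuous_image[OF continuous_on_norm_id assms])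
  have "{x::'a. norm x \<in> norm ` L} = norm -` (norm ` L)" by auto
  then have "closed {x::'a. norm x \<in> norm ` L}"
    using continuous_closed_vimage[OF compact_imp_closed[OF c], of norm] by simp
  moreover have "bounded {x::'a. norm x \<in> norm ` L}"
  proof -
    obtain b where "\<forall>y\<in>norm ` L. norm y \<le> b" using compact_imp_bounded[OF c] unfolding bounded_iff by blast
    then have "norm x \<le> b" if "x \<in> {x::'a. norm x \<in> norm ` L}" for x using that by fastforce
    then show ?thesis by (rule boundedI)
  qed
  ultimately show ?thesis by (simp add: compact_eq_bounded_closed)
qed

text \<open>The time derivative of the drift at x equals its space derivative in direction
  q U, where U = |x| (w - (w . sgn x) sgn x) and q = 1 / (1 + t (w . sgn x)). Since U is tangential and
  has small divergence, integrating a time derivative over a set costs only tangential perimeter.\<close>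

lemma drift_field:
  fixes p :: "'a::euclidean_space \<Rightarrow> real" and w :: 'a
  assumes pC1: "\<And>x. (p has_derivative blinfun_apply (p' x)) (at x)" "continuous_on UNIV p'"
    and p1: "\<And>x. \<bar>p x\<bar> \<le> 1" and L: "compact L" "0 \<notin> L" "\<And>x. x \<notin> L \<Longrightarrow> p x = 0"
    and w: "norm w \<le> s" "s \<le> 1/2" and t: "0 \<le> t" "t \<le> 1"
  obtains Y :: "'a \<Rightarrow> 'a" where "C1c_field Y" "\<And>x. norm x \<notin> norm ` L \<Longrightarrow> Y x = 0" "\<And>x. Y x \<bullet> x = 0"
    "\<And>x. norm (Y x) \<le> 2 * s * norm x"
    "\<And>x. \<bar>divergence Y x - blinfun_apply (p' (sphere_drift w t x)) (norm x *\<^sub>R sgn_deriv (sgn x + t *\<^sub>R w) w)\<bar>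
        \<le> 2 * real DIM('a) * s * \<bar>p (sphere_drift w t x)\<bar>"
proof -
  let ?T = "sphere_drift w t" and ?n = "real DIM('a)"
  define q where "q x = inverse (1 + t * (w \<bullet> sgn x))" for x
  define U where "U x = norm x *\<^sub>R w - (w \<bullet> sgn x) *\<^sub>R x" for x
  define r where "r x = p (?T x) * q x" for x
  define Y where "Y x = r x *\<^sub>R U x" for x
  define K where "K = {x::'a. norm x \<in> norm ` L}"
  have s0: "0 \<le> s" using w(1) norm_ge_zero order_trans by blast
  have z0: "sgn x + t *\<^sub>R w \<noteq> 0" if "x \<noteq> 0" for x
    by (rule sgn_add_nonzero[OF that w t])
  have cb: "\<bar>w \<bullet> sgn x\<bar> \<le> s" for x
  proof -
    have "\<bar>w \<bullet> sgn x\<bar> \<le> norm w * norm (sgn x)" by (rule Cauchy_Schwarz_ineq2)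
    also have "\<dots> \<le> norm w * 1" by (rule mult_left_mono) (auto simp: norm_sgn)
    finally show ?thesis using w by simp
  qed
  have tc: "\<bar>t * (w \<bullet> sgn x)\<bar> \<le> 1/2" for x
  proof -
    have "\<bar>t * (w \<bullet> sgn x)\<bar> \<le> 1 * s" unfolding abs_mult using cb[of x] t by (intro mult_mono) auto
    then show ?thesis using w by simp
  qed
  \<comment> \<open>This is where \<open>s \<le> 1/2\<close> keeps the denominator of q away from
    zero.\<close>
  have d0: "1 + t * (w \<bullet> sgn x) \<ge> 1/2" for x using tc[of x] by linarith
  have d0nz: "1 + t * (w \<bullet> sgn x) \<noteq> 0" for x using d0[of x] by linarith
  have qpos: "0 < q x" "q x \<le> 2" for x
  proof -
    show "0 < q x" using d0[of x] by (simp add: q_def)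
    have "inverse (1 + t * (w \<bullet> sgn x)) \<le> inverse (1/2)" by (rule le_imp_inverse_le[OF d0]) simp
    then show "q x \<le> 2" by (simp add: q_def)
  qed
  have cK: "compact K" unfolding K_def by (rule compact_norm_hull[OF L(1)])
  have K0: "0 \<notin> K" using L(2) by (auto simp: K_def)
  have TK: "p (?T x) = 0" if "x \<notin> K" for x
    using L(3)[of "?T x"] norm_sphere_drift[OF w t, of x] that unfolding K_def
    by (metis (no_types, lifting) image_eqI mem_Collect_eq)
  have Csgn: "C1_on (- {0}) (\<lambda>x::'a. sgn x)" by (rule C1_on_sgn)
  have o: "open (- {0::'a})" by (rule open_Compl[OF closed_singleton])
  have Cz: "C1_on (- {0}) (\<lambda>x::'a. sgn x + t *\<^sub>R w)" by (rule C1_on_add[OF Csgn C1_on_const[OF o]])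
  have CT: "C1_on (- {0}) ?T" unfolding sphere_drift_def
    by (rule C1_on_scaleR[OF C1_on_norm C1_on_compose[OF C1_on_sgn Cz]]) (use z0 in auto)
  have Cp: "C1_on UNIV p" by (rule C1_onI[OF _ pC1]) auto
  have Ccs: "C1_on (- {0}) (\<lambda>x::'a. w \<bullet> sgn x)" by (rule C1_on_inner[OF C1_on_const[OF o] Csgn])
  have Cq: "C1_on (- {0}) q" unfolding q_def
    by (rule C1_on_compose[OF C1_on_inverse C1_on_add[OF C1_on_const[OF o] C1_on_mult[OF C1_on_const[OF o] Ccs]]])
       (use d0nz in auto)
  have CU: "C1_on (- {0}) U" unfolding U_def
    by (rule C1_on_diff[OF C1_on_scaleR[OF C1_on_norm C1_on_const[OF o]] C1_on_scaleR[OF Ccs C1_on_ident[OF o]]])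
  have Cr: "C1_on (- {0}) r" unfolding r_def
    by (rule C1_on_mult[OF C1_on_compose[OF Cp CT] Cq]) auto
  have CY: "C1_on (- {0}) Y" unfolding Y_def by (rule C1_on_scaleR[OF Cr CU])
  have Y0: "Y x = 0" if "x \<notin> K" for x using TK[OF that] by (simp add: Y_def r_def)
  have C1c: "C1c_field Y"
    by (rule C1_on_imp_C1c_field[OF CY cK _ K0 Y0]) (use K0 in auto)
  have sx: "sgn x \<bullet> sgn x = 1" if "x \<noteq> 0" for x :: 'a
    using norm_sgn_nonzero[OF that] by (simp add: norm_eq_sqrt_inner)
  have xs: "norm x *\<^sub>R sgn x = x" for x :: 'a
    by (cases "x = 0") (auto simp: sgn_div_norm)
  have UU: "U x = norm x *\<^sub>R (w - (w \<bullet> sgn x) *\<^sub>R sgn x)" for x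
    unfolding U_def scaleR_diff_right by (metis scaleR_left_commute xs)
  have Us: "U x \<bullet> sgn x = 0" for x
    by (cases "x = 0") (auto simp: UU inner_diff_left sx)
  have Ux: "U x \<bullet> x = 0" for x using Us[of x] xs[of x] by (metis inner_scaleR_right mult_zero_right)
  have nU: "norm (U x) \<le> s * norm x" for x
  proof (cases "x = 0")
    case False
    have "(norm (w - (w \<bullet> sgn x) *\<^sub>R sgn x))\<^sup>2 = (norm w)\<^sup>2 - (w \<bullet> sgn x)\<^sup>2"
      unfolding power2_norm_eq_inner using sx[OF False]
      by (simp add: inner_diff_left inner_diff_right inner_commute power2_eq_square)
    also have "\<dots> \<le> (norm w)\<^sup>2" by simp
    finally have "norm (w - (w \<bullet> sgn x) *\<^sub>R sgn x) \<le> norm w" by (rule power2_le_imp_le) simp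
    then have "norm (w - (w \<bullet> sgn x) *\<^sub>R sgn x) \<le> s" using w(1) by (rule order_trans)
    then show ?thesis unfolding UU norm_scaleR abs_norm_cancel mult.commute[of s]
      by (rule mult_left_mono) simp
  qed (simp add: U_def)
  have rb: "\<bar>r x\<bar> \<le> 2" for x
  proof -
    have "\<bar>r x\<bar> \<le> 1 * 2" unfolding r_def abs_mult using qpos[of x] by (intro mult_mono p1) auto
    then show ?thesis by simp
  qed
  have nY: "norm (Y x) \<le> 2 * s * norm x" for x
  proof -
    have "norm (Y x) \<le> 2 * (s * norm x)" unfolding Y_def norm_scaleR real_norm_def
      by (intro mult_mono rb nU) auto
    then show ?thesis by simp
  qed
  have YdK: "divergence Y 0 = 0"
    using C1c_field_divergence(2)[OF C1c Y0 compact_imp_closed[OF cK] K0] .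
  have div: "\<bar>divergence Y x - blinfun_apply (p' (?T x)) (norm x *\<^sub>R sgn_deriv (sgn x + t *\<^sub>R w) w)\<bar>
        \<le> 2 * ?n * s * \<bar>p (?T x)\<bar>" for x
  proof (cases "x = 0")
    case True
    then show ?thesis using YdK s0 by simp
  next
    case False
    let ?z = "sgn x + t *\<^sub>R w" and ?c = "w \<bullet> sgn x"
    have dsgn: "(sgn has_derivative sgn_deriv x) (at x)" by (rule has_derivative_sgn[OF False])
    have dn: "(norm has_derivative (\<lambda>v. v \<bullet> sgn x)) (at x)" by (rule has_derivative_norm'[OF False])
    have dz: "((\<lambda>x. sgn x + t *\<^sub>R w) has_derivative sgn_deriv x) (at x)"
      using has_derivative_add[OF dsgn has_derivative_const[of "t *\<^sub>R w"]] by simp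
    have dsz: "((\<lambda>x. sgn (sgn x + t *\<^sub>R w)) has_derivative (\<lambda>v. sgn_deriv ?z (sgn_deriv x v))) (at x)"
      by (rule has_derivative_compose[OF dz has_derivative_sgn[OF z0[OF False]]])
    have dT: "(?T has_derivative (\<lambda>v. norm x *\<^sub>R sgn_deriv ?z (sgn_deriv x v) + (v \<bullet> sgn x) *\<^sub>R sgn ?z)) (at x)"
      unfolding sphere_drift_def by (rule has_derivative_scaleR[OF dn dsz])
    have dpT: "((\<lambda>x. p (?T x)) has_derivative (\<lambda>v. blinfun_apply (p' (?T x)) (norm x *\<^sub>R sgn_deriv ?z (sgn_deriv x v) + (v \<bullet> sgn x) *\<^sub>R sgn ?z))) (at x)"
      by (rule has_derivative_compose[OF dT pC1(1)])
    have dc: "((\<lambda>x. w \<bullet> sgn x) has_derivative (\<lambda>v. w \<bullet> sgn_deriv x v)) (at x)"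
      by (rule has_derivative_inner_right[OF dsgn])
    have dq1: "((\<lambda>x. 1 + t * (w \<bullet> sgn x)) has_derivative (\<lambda>v. t * (w \<bullet> sgn_deriv x v))) (at x)"
      using has_derivative_add[OF has_derivative_const[of 1] has_derivative_mult_right[OF dc, of t]] by simp
    have dq: "(q has_derivative (\<lambda>v. - (q x * (t * (w \<bullet> sgn_deriv x v)) * q x))) (at x)"
      unfolding q_def by (rule Deriv.has_derivative_inverse[OF _ dq1]) (use d0[of x] in auto)
    have dr: "(r has_derivative (\<lambda>v. p (?T x) * (- (q x * (t * (w \<bullet> sgn_deriv x v)) * q x)) +
        blinfun_apply (p' (?T x)) (norm x *\<^sub>R sgn_deriv ?z (sgn_deriv x v) + (v \<bullet> sgn x) *\<^sub>R sgn ?z) * q x)) (at x)"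
      unfolding r_def by (rule has_derivative_mult[OF dpT dq])
    obtain U' where dU: "(U has_derivative U') (at x)"
      using C1_on_differentiable[OF CU, of x] False unfolding differentiable_def by auto
    have d1: "((\<lambda>x::'a. norm x *\<^sub>R w) has_derivative (\<lambda>v. norm x *\<^sub>R 0 + (v \<bullet> sgn x) *\<^sub>R w)) (at x)"
      by (rule has_derivative_scaleR[OF dn has_derivative_const])
    have d2: "((\<lambda>x. (w \<bullet> sgn x) *\<^sub>R x) has_derivative (\<lambda>v. (w \<bullet> sgn x) *\<^sub>R v + (w \<bullet> sgn_deriv x v) *\<^sub>R x)) (at x)"
      by (rule has_derivative_scaleR[OF dc has_derivative_ident])
    have divc: "divergence (\<lambda>_. w) x = 0"
      by (subst divergence_eq[OF has_derivative_const]) simp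
    have divU: "divergence U x = (1 - ?n) * ?c"
    proof -
      have "divergence U x = divergence (\<lambda>x. norm x *\<^sub>R w) x - divergence (\<lambda>x. (w \<bullet> sgn x) *\<^sub>R x) x"
        unfolding U_def by (rule divergence_diff[OF d1 d2])
      also have "divergence (\<lambda>x. norm x *\<^sub>R w) x = ?c"
        using divergence_scaleR[OF dn has_derivative_const] by (simp add: divc)
      also have "divergence (\<lambda>x. (w \<bullet> sgn x) *\<^sub>R x) x = w \<bullet> sgn_deriv x x + ?c * ?n"
        using divergence_scaleR[OF dc has_derivative_ident] by (simp add: divergence_ident)
      finally show ?thesis by (simp only: sgn_deriv_self inner_zero_right) (simp add: algebra_simps)
    qed
    let ?\<tau> = "w - ?c *\<^sub>R sgn x"
    have sU: "sgn_deriv x (U x) = ?\<tau>"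
      unfolding Us using False by (simp add: UU)
    \<comment> \<open>w and q times its tangential part differ by a multiple of the drifted
      direction \<open>?z\<close>, which \<open>sgn_deriv\<close> kills. The identity 1 - t q (w .
      sgn x) = q is the reason for the choice of q.\<close>
    have wt: "q x *\<^sub>R ?\<tau> = w - (q x * ?c) *\<^sub>R ?z"
    proof -
      have "1 - q x * ?c * t = q x" using d0[of x] by (simp add: q_def field_simps)
      moreover have "w - (q x * ?c) *\<^sub>R ?z = (1 - q x * ?c * t) *\<^sub>R w - (q x * ?c) *\<^sub>R sgn x"
        by (simp add: algebra_simps)
      ultimately have "w - (q x * ?c) *\<^sub>R ?z = q x *\<^sub>R w - (q x * ?c) *\<^sub>R sgn x" by (simp only:)
      then show ?thesis by (simp add: scaleR_diff_right)
    qed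
    have flow: "q x *\<^sub>R (norm x *\<^sub>R sgn_deriv ?z ?\<tau>) = norm x *\<^sub>R sgn_deriv ?z w"
    proof -
      have "q x *\<^sub>R sgn_deriv ?z ?\<tau> = sgn_deriv ?z (q x *\<^sub>R ?\<tau>)" by (rule linear_cmul[OF linear_sgn_deriv, symmetric])
      also have "\<dots> = sgn_deriv ?z w - (q x * ?c) *\<^sub>R sgn_deriv ?z ?z"
        unfolding wt by (simp only: linear_diff[OF linear_sgn_deriv] linear_cmul[OF linear_sgn_deriv])
      also have "\<dots> = sgn_deriv ?z w" by (simp only: sgn_deriv_self scaleR_zero_right diff_zero)
      finally have f: "q x *\<^sub>R sgn_deriv ?z ?\<tau> = sgn_deriv ?z w" .
      show ?thesis by (rule trans[OF scaleR_left_commute arg_cong[OF f, of "\<lambda>v. norm x *\<^sub>R v"]])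
    qed
    let ?D = "blinfun_apply (p' (?T x)) (norm x *\<^sub>R sgn_deriv ?z w)"
    have D: "blinfun_apply (p' (?T x)) (norm x *\<^sub>R sgn_deriv ?z ?\<tau> + (U x \<bullet> sgn x) *\<^sub>R sgn ?z) * q x = ?D"
    proof -
      have "?D = blinfun_apply (p' (?T x)) (q x *\<^sub>R (norm x *\<^sub>R sgn_deriv ?z ?\<tau>))" by (rule arg_cong[OF flow[symmetric], of "blinfun_apply (p' (?T x))"])
      also have "\<dots> = q x * blinfun_apply (p' (?T x)) (norm x *\<^sub>R sgn_deriv ?z ?\<tau>)"
        by (simp only: blinfun.scaleR_right real_scaleR_def)
      finally show ?thesis by (simp only: Us scaleR_zero_left add_0_right mult.commute)
    qed
    have wtau: "w \<bullet> ?\<tau> = (norm w)\<^sup>2 - ?c\<^sup>2"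
      unfolding power2_norm_eq_inner by (simp add: inner_diff_right power2_eq_square)
    \<comment> \<open>The derivative of p along the field is exactly \<open>?D\<close>. The
      remaining terms, from the derivative of q and from the divergence of U, contain p
      undifferentiated and are the error.\<close>
    have "divergence Y x = p (?T x) * (- (q x * (t * (w \<bullet> ?\<tau>)) * q x)) + ?D + r x * ((1 - ?n) * ?c)"
      unfolding Y_def using divergence_scaleR[OF dr dU] unfolding sU D divU .
    then have eq: "divergence Y x - ?D = p (?T x) * (- (q x * (t * (w \<bullet> ?\<tau>)) * q x) + q x * ((1 - ?n) * ?c))"
      by (simp add: r_def algebra_simps)
    have n1: "?n \<ge> 1" by (simp add: Suc_leI)
    have "\<bar>- (q x * (t * (w \<bullet> ?\<tau>)) * q x) + q x * ((1 - ?n) * ?c)\<bar>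
      \<le> \<bar>q x * (t * (w \<bullet> ?\<tau>)) * q x\<bar> + \<bar>q x * ((1 - ?n) * ?c)\<bar>" by linarith
    \<comment> \<open>The sum is 4 s^2 + 2 (n - 1) s, and 4 s^2 is at most 2 s since s is at most
      1/2.\<close>
    also have "\<dots> \<le> 2 * (1 * s\<^sup>2) * 2 + 2 * ((?n - 1) * s)"
    proof (rule add_mono)
      have "\<bar>w \<bullet> ?\<tau>\<bar> \<le> s\<^sup>2"
      proof -
        have "?c\<^sup>2 \<le> (norm w)\<^sup>2" using Cauchy_Schwarz_ineq2[of w "sgn x"] norm_sgn_nonzero[OF False]
          by (intro abs_le_square_iff[THEN iffD1]) auto
        moreover have "(norm w)\<^sup>2 \<le> s\<^sup>2" using w by (intro power_mono) auto
        ultimately show ?thesis unfolding wtau using zero_le_power2[of ?c] by linarith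
      qed
      then show "\<bar>q x * (t * (w \<bullet> ?\<tau>)) * q x\<bar> \<le> 2 * (1 * s\<^sup>2) * 2"
        unfolding abs_mult using qpos[of x] t by (intro mult_mono) auto
      show "\<bar>q x * ((1 - ?n) * ?c)\<bar> \<le> 2 * ((?n - 1) * s)"
        unfolding abs_mult using qpos[of x] cb[of x] n1 by (intro mult_mono) auto
    qed
    also have "\<dots> \<le> 2 * ?n * s"
    proof -
      have "s * s \<le> (1/2) * s" using w s0 by (intro mult_right_mono) auto
      then show ?thesis by (simp add: power2_eq_square algebra_simps)
    qed
    finally have "\<bar>p (?T x)\<bar> * \<bar>- (q x * (t * (w \<bullet> ?\<tau>)) * q x) + q x * ((1 - ?n) * ?c)\<bar> \<le> \<bar>p (?T x)\<bar> * (2 * ?n * s)"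
      by (rule mult_left_mono) simp
    then show ?thesis unfolding eq abs_mult by (simp add: mult.commute)
  qed
  show ?thesis
    by (rule that[OF C1c _ _ nY div]) (use Y0 in \<open>auto simp: K_def Y_def Ux\<close>)
qed

section \<open>Compactly supported fields, and the effect of a drift inside a shell\<close>

definition shell :: "real \<Rightarrow> real \<Rightarrow> 'a::euclidean_space set" where
  "shell a b = {x. a < norm x \<and> norm x < b}"

lemma open_shell: "open (shell a b :: 'a::euclidean_space set)"
  unfolding shell_def by (intro open_Collect_conj open_Collect_less continuous_intros)

lemma shell_borel [measurable]: "(shell a b :: 'a::euclidean_space set) \<in> sets borel"
  using open_shell by (rule borel_open)

lemma emeasure_shell_finite: "emeasure lborel (shell a b :: 'a::euclidean_space set) < \<infinity>"
  by (rule emeasure_bounded_finite, rule bounded_subset[of "cball 0 b"]) (auto simp: shell_def)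

lemma integrable_indicator_compact_support:
  fixes d :: "'a::euclidean_space \<Rightarrow> real"
  assumes "E \<in> sets borel" "compact K" "continuous_on K d" "\<And>x. x \<notin> K \<Longrightarrow> d x = 0"
  shows "integrable lborel (\<lambda>x. indicator E x * d x)"
proof -
  have "integrable lborel (\<lambda>x. indicator K x *\<^sub>R d x)" by (rule borel_integrable_compact[OF assms(2,3)])
  then have "integrable lborel (\<lambda>x. indicator E x *\<^sub>R (indicator K x *\<^sub>R d x))"
    by (rule integrable_mult_indicator[rotated]) (use assms(1) in auto)
  moreover have "(\<lambda>x. indicator E x *\<^sub>R (indicator K x *\<^sub>R d x)) = (\<lambda>x. indicator E x * d x)"
    using assms(4) by (auto simp: indicator_def fun_eq_iff)
  ultimately show ?thesis by simp
qed

lemma integrable_divergence: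
  assumes "C1c_field Y" "E \<in> sets borel"
  shows "integrable lborel (\<lambda>x. indicator E x * divergence Y x)"
proof -
  obtain K where K: "compact K" "\<And>x. x \<notin> K \<Longrightarrow> Y x = 0" using assms unfolding C1c_field_def by blast
  note c = C1c_field_divergence[OF assms(1) K(2) compact_imp_closed[OF K(1)]]
  show ?thesis
    by (rule integrable_indicator_compact_support[OF assms(2) K(1) continuous_on_subset[OF c(1)] c(2)]) auto
qed

lemma C1c_field_scaleR:
  assumes "C1c_field Y"
  shows "C1c_field (\<lambda>x. c *\<^sub>R Y x)" "divergence (\<lambda>x. c *\<^sub>R Y x) x = c * divergence Y x"
proof -
  obtain Y' K where Y': "\<And>x. (Y has_derivative Y' x) (at x)" "\<forall>b\<in>Basis. continuous_on UNIV (\<lambda>x. Y' x b)"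
    and K: "compact K" "0 \<notin> K" "\<forall>x. x \<notin> K \<longrightarrow> Y x = 0"
    using assms unfolding C1c_field_def by blast
  have d: "((\<lambda>x. c *\<^sub>R Y x) has_derivative (\<lambda>v. c *\<^sub>R Y' x v)) (at x)" for x
    by (rule has_derivative_scaleR_right[OF Y'(1)])
  show "C1c_field (\<lambda>x. c *\<^sub>R Y x)" unfolding C1c_field_def
    by (intro conjI exI[of _ "\<lambda>x v. c *\<^sub>R Y' x v"] exI[of _ K]) (use d Y' K in \<open>auto intro!: continuous_intros\<close>)
  show "divergence (\<lambda>x. c *\<^sub>R Y x) x = c * divergence Y x"
    unfolding divergence_eq[OF d] divergence_eq[OF Y'(1)] by (simp add: sum_distrib_left)
qed

lemma C1c_field_add:
  assumes "C1c_field Y" "C1c_field Z"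
  shows "C1c_field (\<lambda>x. Y x + Z x)" "divergence (\<lambda>x. Y x + Z x) x = divergence Y x + divergence Z x"
proof -
  obtain Y' K where Y': "\<And>x. (Y has_derivative Y' x) (at x)" "\<forall>b\<in>Basis. continuous_on UNIV (\<lambda>x. Y' x b)"
    and K: "compact K" "0 \<notin> K" "\<forall>x. x \<notin> K \<longrightarrow> Y x = 0"
    using assms(1) unfolding C1c_field_def by blast
  obtain Z' J where Z': "\<And>x. (Z has_derivative Z' x) (at x)" "\<forall>b\<in>Basis. continuous_on UNIV (\<lambda>x. Z' x b)"
    and J: "compact J" "0 \<notin> J" "\<forall>x. x \<notin> J \<longrightarrow> Z x = 0"
    using assms(2) unfolding C1c_field_def by blast
  have d: "((\<lambda>x. Y x + Z x) has_derivative (\<lambda>v. Y' x v + Z' x v)) (at x)" for x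
    by (rule has_derivative_add[OF Y'(1) Z'(1)])
  show "C1c_field (\<lambda>x. Y x + Z x)" unfolding C1c_field_def
    by (intro conjI exI[of _ "\<lambda>x v. Y' x v + Z' x v"] exI[of _ "K \<union> J"]) (use d Y' K Z' J in \<open>auto intro!: continuous_intros\<close>)
  show "divergence (\<lambda>x. Y x + Z x) x = divergence Y x + divergence Z x"
    unfolding divergence_eq[OF d] divergence_eq[OF Y'(1)] divergence_eq[OF Z'(1)]
    by (simp add: inner_add_left sum.distrib)
qed

lemma C1c_field_zero: "C1c_field (\<lambda>x::'a::euclidean_space. 0)"
  unfolding C1c_field_def
  by (intro conjI exI[of _ "\<lambda>x v. 0"] exI[of _ "{}"]) auto

lemma divergence_zero: "divergence (\<lambda>x::'a::euclidean_space. 0) = (\<lambda>x. 0)"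
  by (rule ext, subst divergence_eq[OF has_derivative_const]) simp

lemma sphere_drift_measurable [measurable (raw)]:
  fixes f g :: "'b \<Rightarrow> 'a::euclidean_space"
  assumes [measurable]: "f \<in> borel_measurable M" "g \<in> borel_measurable M"
  shows "(\<lambda>x. sphere_drift (f x) t (g x)) \<in> borel_measurable M"
  unfolding sphere_drift_def by measurable

lemma has_derivative_zero_off_compact:
  fixes p :: "'a::euclidean_space \<Rightarrow> 'b::real_normed_vector"
  assumes "\<And>x. (p has_derivative blinfun_apply (p' x)) (at x)" "compact L" "\<And>x. x \<notin> L \<Longrightarrow> p x = 0" "y \<notin> L"
  shows "p' y = 0"
proof -
  have "(p has_derivative (\<lambda>_. 0)) (at y)"
    by (rule has_derivative_transform_within_open[OF has_derivative_const[of 0] open_Compl[OF compact_imp_closed[OF assms(2)]]])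
       (use assms(3,4) in auto)
  then have "blinfun_apply (p' y) = (\<lambda>_. 0)" using assms(1) has_derivative_unique by blast
  then show ?thesis by (intro blinfun_eqI) simp
qed

text \<open>Minus the time derivative of p along the drift is, up to the error of
  \<open>drift_field\<close>, the divergence of a tangential field, whose flux through E is at most
  B. The error is at most 2 n s at each point of the shell. Integrated over time: what p loses on E
  by being drifted is paid for by perimeter and by this error.\<close>

lemma drift_estimate:
  fixes p :: "'a::euclidean_space \<Rightarrow> real" and w :: 'a
  assumes E: "E \<in> sets borel" and a: "0 < a"
    and p: "C1_on UNIV p" "\<And>x. 0 \<le> p x" "\<And>x. p x \<le> 1"
    and L: "compact L" "L \<subseteq> shell a b" "\<And>x. x \<notin> L \<Longrightarrow> p x = 0"
    and w: "norm w \<le> s" "s \<le> 1/2"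
    and per: "\<And>Y K. C1c_field Y \<Longrightarrow> compact K \<Longrightarrow> K \<subseteq> shell a b \<Longrightarrow> (\<And>x. x \<notin> K \<Longrightarrow> Y x = 0) \<Longrightarrow>
      (\<And>x. Y x \<bullet> x = 0) \<Longrightarrow> (\<And>x. norm (Y x) \<le> 2 * s * norm x) \<Longrightarrow>
      (\<integral>x. indicator E x * divergence Y x \<partial>lborel) \<le> B"
  shows "(\<integral>x. indicator E x * p x \<partial>lborel) \<le> (\<integral>x. indicator E x * p (sphere_drift w 1 x) \<partial>lborel)
    + (B + 2 * real DIM('a) * s * measure lborel (E \<inter> shell a b))"
proof -
  let ?S = "shell a b :: 'a set" and ?n = "real DIM('a)"
  obtain p' where p': "\<And>x. (p has_derivative blinfun_apply (p' x)) (at x)" "continuous_on UNIV p'"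
    using C1_onE[OF p(1)] by (metis UNIV_I)
  define K where "K = {x::'a. norm x \<in> norm ` L}"
  have K: "compact K" unfolding K_def by (rule compact_norm_hull[OF L(1)])
  have KS: "K \<subseteq> ?S" using L(2) unfolding K_def shell_def by auto
  have L0: "0 \<notin> L" and K0: "0 \<notin> K" using L(2) KS a by (auto simp: shell_def)
  have s0: "0 \<le> s" using w(1) norm_ge_zero order_trans by blast
  have p'0: "p' y = 0" if "y \<notin> L" for y
    using has_derivative_zero_off_compact[OF p'(1) L(1) _ that] L(3) by blast
  have TL: "sphere_drift w t x \<notin> L" if "x \<notin> K" "0 \<le> t" "t \<le> 1" for x t
    using norm_sphere_drift[OF w that(2,3), of x] that(1) unfolding K_def
    by (metis (no_types, lifting) image_eqI mem_Collect_eq)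
  define v where "v t x = norm x *\<^sub>R sgn_deriv (sgn x + t *\<^sub>R w) w" for t and x :: 'a
  define d where "d t x = - blinfun_apply (p' (sphere_drift w t x)) (v t x)" for t x
  have d0: "d t x = 0" if "0 \<le> t" "t \<le> 1" "x \<notin> K" for t x
    using p'0[OF TL[OF that(3,1,2)]] by (simp add: d_def)
  have z0: "sgn x + t *\<^sub>R w \<noteq> 0" if "x \<in> K" "0 \<le> t" "t \<le> 1" for x t
    using sgn_add_nonzero[OF _ w that(2,3), of x] that K0 by auto
  have cz: "continuous_on ({0..1} \<times> K) (\<lambda>z. sgn (snd z) + fst z *\<^sub>R w)"
    by (intro continuous_intros) (use K0 in auto)
  have cs: "continuous_on ({0..1} \<times> K) (\<lambda>z. sgn (sgn (snd z) + fst z *\<^sub>R w))"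
    by (intro continuous_on_sgn cz) (use z0 in auto)
  have cT: "continuous_on ({0..1} \<times> K) (\<lambda>z. sphere_drift w (fst z) (snd z))"
    unfolding sphere_drift_def by (intro continuous_intros cs)
  have cv: "continuous_on ({0..1} \<times> K) (\<lambda>z. v (fst z) (snd z))"
    unfolding v_def by (intro continuous_intros cs cz) (use z0 in auto)
  have cd: "continuous_on ({0..1} \<times> K) (\<lambda>(t, x). d t x)"
    unfolding d_def case_prod_beta
    by (intro continuous_intros cv continuous_on_compose2[OF p'(2) cT]) auto
  have cdt: "continuous_on K (d t)" if "0 \<le> t" "t \<le> 1" for t
  proof -
    have "continuous_on K (\<lambda>x. (\<lambda>(t, x). d t x) (t, x))"
      by (rule continuous_on_compose2[OF cd]) (use that in \<open>auto intro!: continuous_intros\<close>)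
    then show ?thesis by simp
  qed
  have fin: "emeasure lborel (E \<inter> ?S) < \<infinity>"
    using emeasure_mono[of "E \<inter> ?S" ?S lborel] emeasure_shell_finite[of a b] by (auto intro: le_less_trans)
  have main: "(\<integral>x. indicator E x * (- p (sphere_drift w 1 x) - - p (sphere_drift w 0 x)) \<partial>lborel)
    \<le> B + 2 * ?n * s * measure lborel (E \<inter> ?S)"
  proof (rule flow_estimate[OF E K, where d = d and u = "\<lambda>t x. - p (sphere_drift w t x)"])
    fix t :: real and x :: 'a assume t: "0 \<le> t" "t \<le> 1"
    show "((\<lambda>t. - p (sphere_drift w t x)) has_real_derivative d t x) (at t)"
      unfolding d_def v_def
      by (rule DERIV_minus[OF sphere_drift_time_derivative[OF w t p'(1)]])
    show "x \<notin> K \<Longrightarrow> d t x = 0" by (rule d0[OF t])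
  next
    fix t :: real assume t: "0 \<le> t" "t \<le> 1"
    have pabs: "\<bar>p x\<bar> \<le> 1" for x using p(2,3)[of x] by simp
    obtain Y where Y: "C1c_field Y" "\<And>x. norm x \<notin> norm ` L \<Longrightarrow> Y x = 0" "\<And>x. Y x \<bullet> x = 0"
      "\<And>x. norm (Y x) \<le> 2 * s * norm x"
      "\<And>x. \<bar>divergence Y x - blinfun_apply (p' (sphere_drift w t x)) (norm x *\<^sub>R sgn_deriv (sgn x + t *\<^sub>R w) w)\<bar>
        \<le> 2 * ?n * s * \<bar>p (sphere_drift w t x)\<bar>"
      using drift_field[OF p' pabs L(1) L0 L(3) w t] by blast
    define Z where "Z x = (- 1) *\<^sub>R Y x" for x
    have Zc: "C1c_field Z" and Zd: "\<And>x. divergence Z x = - divergence Y x"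
      using C1c_field_scaleR[OF Y(1), of "-1"] unfolding Z_def[abs_def] by auto
    have ZB: "(\<integral>x. indicator E x * divergence Z x \<partial>lborel) \<le> B"
      by (rule per[OF Zc K KS]) (use Y in \<open>auto simp: Z_def K_def\<close>)
    have "(\<integral>x. indicator E x * d t x \<partial>lborel)
      \<le> (\<integral>x. indicator E x * divergence Z x + 2 * ?n * s * indicator (E \<inter> ?S) x \<partial>lborel)"
    proof (rule Bochner_Integration.integral_mono)
      show "integrable lborel (\<lambda>x. indicator E x * d t x)"
        by (rule integrable_indicator_compact_support[OF E K cdt[OF t] d0[OF t]])
      show "integrable lborel (\<lambda>x. indicator E x * divergence Z x + 2 * ?n * s * indicator (E \<inter> ?S) x)"
        using E fin by (intro Bochner_Integration.integrable_add integrable_divergence[OF Zc E] integrable_mult_right integrable_real_indicator) auto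
      fix x
      have Yd: "\<bar>divergence Y x + d t x\<bar> \<le> 2 * ?n * s * \<bar>p (sphere_drift w t x)\<bar>"
        using Y(5)[of x] unfolding d_def v_def by (simp only: diff_conv_add_uminus)
      have "d t x \<le> divergence Z x + 2 * ?n * s * indicator ?S x"
      proof (cases "x \<in> K")
        case True
        then have "x \<in> ?S" using KS by auto
        have "2 * ?n * s * \<bar>p (sphere_drift w t x)\<bar> \<le> 2 * ?n * s * 1"
          by (rule mult_left_mono[OF pabs]) (use s0 in simp)
        moreover have i1: "(indicator ?S x :: real) = 1" using \<open>x \<in> ?S\<close> by simp
        ultimately show ?thesis using Yd unfolding Zd i1 by linarith
      next
        case False
        have "p (sphere_drift w t x) = 0" by (rule L(3)[OF TL[OF False t]])
        then have "divergence Y x + d t x = 0" using Yd by simp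
        moreover have "0 \<le> 2 * ?n * s * indicator ?S x" using s0 by simp
        ultimately show ?thesis unfolding Zd by linarith
      qed
      then show "indicator E x * d t x \<le> indicator E x * divergence Z x + 2 * ?n * s * indicator (E \<inter> ?S) x"
        by (auto simp: indicator_def)
    qed
    also have "\<dots> = (\<integral>x. indicator E x * divergence Z x \<partial>lborel) + 2 * ?n * s * measure lborel (E \<inter> ?S)"
      using E fin by (subst Bochner_Integration.integral_add) (auto intro!: integrable_divergence[OF Zc E])
    finally show "(\<integral>x. indicator E x * d t x \<partial>lborel) \<le> B + 2 * ?n * s * measure lborel (E \<inter> ?S)"
      using ZB by linarith
  qed (rule cd)
  have T0: "sphere_drift w 0 x = x" for x by (cases "x = 0") (auto simp: sphere_drift_def sgn_div_norm)
  have cp: "continuous_on UNIV p" by (rule C1_on_imp_continuous_on[OF p(1)])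
  have cT1: "continuous_on K (sphere_drift w 1)"
  proof -
    have "continuous_on K (\<lambda>x. (\<lambda>z. sphere_drift w (fst z) (snd z)) (1, x))"
      by (rule continuous_on_compose2[OF cT]) (auto intro!: continuous_intros)
    then show ?thesis by simp
  qed
  have i1: "integrable lborel (\<lambda>x. indicator E x * p x)"
    by (rule integrable_indicator_compact_support[OF E L(1) continuous_on_subset[OF cp] L(3)]) auto
  have i2: "integrable lborel (\<lambda>x. indicator E x * p (sphere_drift w 1 x))"
    by (rule integrable_indicator_compact_support[OF E K continuous_on_compose2[OF cp cT1]])
       (use TL[of _ 1] in \<open>auto intro!: L(3)\<close>)
  have "(\<integral>x. indicator E x * (- p (sphere_drift w 1 x) - - p (sphere_drift w 0 x)) \<partial>lborel)
    = (\<integral>x. indicator E x * p x - indicator E x * p (sphere_drift w 1 x) \<partial>lborel)"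
    unfolding T0 by (intro Bochner_Integration.integral_cong) (auto simp: algebra_simps)
  also have "\<dots> = (\<integral>x. indicator E x * p x \<partial>lborel) - (\<integral>x. indicator E x * p (sphere_drift w 1 x) \<partial>lborel)"
    by (rule Bochner_Integration.integral_diff[OF i1 i2])
  finally show ?thesis using main by linarith
qed

text \<open>An isoperimetric inequality at scale s for sets whose slices are small compared with a
  ball of radius s: on average half of the set is drifted out of itself, which has to be paid for by
  perimeter.\<close>

lemma tangential_shell_estimate:
  fixes E :: "'a::euclidean_space set"
  assumes E[measurable]: "E \<in> sets borel" and a: "0 < a"
    and s: "0 < s" "s \<le> 1 / (8 * real DIM('a))"
    and slices: "AE x in (lborel :: 'a measure). x \<in> shell a b \<longrightarrow>
      (\<integral>\<^sup>+z. indicator {1-s..1+s} (norm z) * indicator (E \<inter> shell a b) (norm x *\<^sub>R sgn z) \<partial>lborel)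
        \<le> ennreal (measure lborel (ball (0::'a) s) / 2)"
    and per: "\<And>Y K. C1c_field Y \<Longrightarrow> compact K \<Longrightarrow> K \<subseteq> shell a b \<Longrightarrow> (\<And>x. x \<notin> K \<Longrightarrow> Y x = 0) \<Longrightarrow>
      (\<And>x. Y x \<bullet> x = 0) \<Longrightarrow> (\<And>x. norm (Y x) \<le> 2 * s * norm x) \<Longrightarrow>
      (\<integral>x. indicator E x * divergence Y x \<partial>lborel) \<le> B"
  shows "measure lborel (E \<inter> shell a b) \<le> 4 * B"
proof -
  let ?S = "shell a b :: 'a set" and ?n = "real DIM('a)"
  define m where "m = measure lborel (E \<inter> ?S)"
  define c0 where "c0 = measure lborel (ball (0::'a) s)"
  \<comment> \<open>The cost of one drift: the flux bound B, and the divergence error 2 n s m, which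
    is at most m / 4 because s is at most 1 / (8 n).\<close>
  define D where "D = B + m / 4"
  have n1: "?n \<ge> 1" by (simp add: Suc_leI)
  have s8: "s * (8 * ?n) \<le> 1" using s n1 by (simp add: field_simps)
  have s2: "s \<le> 1/2"
  proof -
    have "s * 2 \<le> s * (8 * ?n)" proof (rule mult_left_mono)
      show "2 \<le> 8 * ?n" using n1 by linarith
    qed (use s in simp)
    then show ?thesis using s8 by linarith
  qed
  have c0: "c0 > 0" unfolding c0_def using s by (subst content_ball) auto
  have ec0: "emeasure lborel (ball (0::'a) s) = ennreal c0"
    unfolding c0_def using s by (subst emeasure_ball) (auto simp: content_ball)
  have [measurable]: "ball (0::'a) s \<in> sets borel" by simp
  have m0: "0 \<le> m" by (simp add: m_def)
  have B0: "0 \<le> B" using per[OF C1c_field_zero, of "{}"] s by (simp add: divergence_zero)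
  have D0: "0 \<le> D" using B0 m0 by (simp add: D_def)
  have fin: "emeasure lborel (E \<inter> ?S) < \<infinity>"
    using emeasure_mono[of "E \<inter> ?S" ?S lborel] emeasure_shell_finite[of a b] by (auto intro: le_less_trans)
  have em: "emeasure lborel (E \<inter> ?S) = ennreal m"
    unfolding m_def using fin by (simp add: emeasure_eq_ennreal_measure less_top)
  have nsm: "2 * ?n * s * m \<le> m / 4"
  proof -
    have "(s * (8 * ?n)) * m \<le> 1 * m" by (rule mult_right_mono[OF s8 m0])
    then show ?thesis by (simp add: algebra_simps)
  qed
  obtain c where c: "c > 0" "\<And>s. 0 < s \<Longrightarrow> s \<le> 1/2 \<Longrightarrow>
    (\<integral>\<^sup>+v. indicator {1-s..1+s} (1 / norm v) * ennreal (inverse (norm v) ^ (2 * DIM('a))) \<partial>(lborel :: 'a measure)) \<le> ennreal (c * s)"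
    using spherical_average_constant_le[where 'a = 'a] by blast
  \<comment> \<open>Up to e this says m <= m/2 + m/4 + B. The term m/2 is the share that lands in E
    again, by the slice hypothesis; e measures the replacement of the indicator by a C1
    function.\<close>
  have key: "c0 * (m - e) \<le> c0 / 2 * m + c * s * e + c0 * D" if e: "e > 0" for e
  proof -
    have ES: "E \<inter> ?S \<in> sets borel" by measurable
    obtain p :: "'a \<Rightarrow> real" and L where p: "C1_on UNIV p" "\<And>x. 0 \<le> p x" "\<And>x. p x \<le> 1"
      and L: "compact L" "L \<subseteq> ?S" "\<And>x. x \<notin> L \<Longrightarrow> p x = 0"
      and pi: "integrable lborel (\<lambda>x. \<bar>p x - indicator (E \<inter> ?S) x\<bar>)"
      and pe: "(\<integral>x. \<bar>p x - indicator (E \<inter> ?S) x\<bar> \<partial>lborel) < e"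
      using C1_approx_indicator_lborel[OF open_shell emeasure_shell_finite ES Int_lower2 e] by blast
    have pm[measurable]: "p \<in> borel_measurable borel"
      by (rule borel_measurable_continuous_onI[OF C1_on_imp_continuous_on[OF p(1)]])
    define F where "F x = \<bar>p x - indicator (E \<inter> ?S) x\<bar>" for x
    have Fm[measurable]: "F \<in> borel_measurable borel" unfolding F_def by measurable
    have F0: "0 \<le> F x" for x by (simp add: F_def)
    have Fint: "integrable lborel F" using pi by (simp add: F_def[abs_def])
    have Fe: "(\<integral>x. F x \<partial>lborel) < e" using pe unfolding F_def .
    have nF: "(\<integral>\<^sup>+x. ennreal (F x) \<partial>lborel) \<le> ennreal e"
      using Fe by (subst nn_integral_eq_integral[OF Fint]) (use F0 in \<open>auto intro!: ennreal_leI\<close>)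
    define I0 where "I0 = (\<integral>x. indicator E x * p x \<partial>lborel)"
    have i1: "integrable lborel (\<lambda>x. indicator E x * p x)"
      by (rule integrable_indicator_compact_support[OF E L(1) continuous_on_subset[OF C1_on_imp_continuous_on[OF p(1)]] L(3)]) auto
    have I00: "0 \<le> I0" unfolding I0_def by (intro Bochner_Integration.integral_nonneg) (auto simp: p)
    have "m = (\<integral>x. indicator (E \<inter> ?S) x \<partial>lborel)" by (simp add: m_def)
    also have "\<dots> \<le> (\<integral>x. indicator E x * p x + F x \<partial>lborel)"
    proof (rule Bochner_Integration.integral_mono)
      show "integrable lborel (indicat_real (E \<inter> ?S))" using fin by (intro integrable_real_indicator) auto
      show "integrable lborel (\<lambda>x. indicator E x * p x + F x)" by (intro Bochner_Integration.integrable_add i1 Fint)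
      show "indicat_real (E \<inter> ?S) x \<le> indicator E x * p x + F x" for x
        using p(2)[of x] by (auto simp: F_def indicator_def)
    qed
    also have "\<dots> = I0 + (\<integral>x. F x \<partial>lborel)" unfolding I0_def by (rule Bochner_Integration.integral_add[OF i1 Fint])
    finally have mI: "m - e \<le> I0" using Fe by linarith
    define N where "N w = (\<integral>\<^sup>+x. ennreal (indicator E x * p (sphere_drift w 1 x)) \<partial>lborel)" for w
    have Nm: "(\<lambda>z. ennreal (indicator E (snd z) * p (sphere_drift (fst z) 1 (snd z)))) \<in> borel_measurable (borel \<Otimes>\<^sub>M borel)"
      by measurable
    have step: "ennreal I0 \<le> N w + ennreal D" if w: "norm w \<le> s" for w
    proof -
      have "I0 \<le> (\<integral>x. indicator E x * p (sphere_drift w 1 x) \<partial>lborel) + D"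
      proof -
        have "I0 \<le> (\<integral>x. indicator E x * p (sphere_drift w 1 x) \<partial>lborel) + (B + 2 * ?n * s * m)"
          unfolding I0_def m_def
        proof (rule drift_estimate[OF E a p L w s2])
          fix Y :: "'a \<Rightarrow> 'a" and K
          assume Y: "C1c_field Y" "compact K" "K \<subseteq> ?S" "\<And>x. x \<notin> K \<Longrightarrow> Y x = 0" "\<And>x. Y x \<bullet> x = 0"
            "\<And>x. norm (Y x) \<le> 2 * s * norm x"
          show "(\<integral>x. indicator E x * divergence Y x \<partial>lborel) \<le> B" by (rule per[OF Y])
        qed
        then show ?thesis using nsm unfolding D_def by linarith
      qed
      moreover have "(\<integral>x. indicator E x * p (sphere_drift w 1 x) \<partial>lborel) = enn2real (N w)"
        unfolding N_def by (rule integral_eq_nn_integral) (auto simp: p)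
      ultimately have "ennreal I0 \<le> ennreal (enn2real (N w) + D)" by (simp add: ennreal_leI)
      also have "\<dots> = ennreal (enn2real (N w)) + ennreal D" using D0 by (intro ennreal_plus) auto
      also have "\<dots> \<le> N w + ennreal D" by (intro add_right_mono) (simp add: ennreal_enn2real_if)
      finally show ?thesis .
    qed
    let ?b = "\<lambda>w::'a. indicator (ball 0 s) w :: ennreal"
    let ?A = "{1-s..1+s}"
    define Q where "Q x = (\<integral>\<^sup>+z. indicator ?A (norm z) * ennreal (F (norm x *\<^sub>R sgn z)) \<partial>(lborel :: 'a measure))" for x :: 'a
    have Qm[measurable]: "Q \<in> borel_measurable borel" unfolding Q_def by measurable
    \<comment> \<open>The drift inequality is averaged over all w in the ball of radius s.\<close>
    have "ennreal (c0 * I0) = (\<integral>\<^sup>+w. ennreal I0 * ?b w \<partial>lborel)"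
      using c0 I00 by (simp add: nn_integral_cmult_indicator ec0 ennreal_mult mult.commute)
    also have "\<dots> \<le> (\<integral>\<^sup>+w. N w * ?b w + ennreal D * ?b w \<partial>lborel)"
      by (rule nn_integral_mono) (use step in \<open>auto simp: indicator_def dist_norm\<close>)
    also have "\<dots> = (\<integral>\<^sup>+w. N w * ?b w \<partial>lborel) + ennreal D * ennreal c0"
      unfolding N_def by (subst nn_integral_add) (auto simp: nn_integral_cmult_indicator ec0)
    also have "(\<integral>\<^sup>+w. N w * ?b w \<partial>lborel)
      = (\<integral>\<^sup>+w. (\<integral>\<^sup>+x. ennreal (indicator E x * p (sphere_drift w 1 x)) * ?b w \<partial>lborel) \<partial>lborel)"
      unfolding N_def by (simp add: nn_integral_multc)
    also have "\<dots> = (\<integral>\<^sup>+x. (\<integral>\<^sup>+w. ennreal (indicator E x * p (sphere_drift w 1 x)) * ?b w \<partial>lborel) \<partial>lborel)"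
      by (rule lborel_pair.Fubini') measurable
    also have "\<dots> \<le> (\<integral>\<^sup>+x. ennreal (c0 / 2) * indicator (E \<inter> ?S) x + Q x \<partial>lborel)"
    proof (rule nn_integral_mono_AE)
      show "AE x in lborel. (\<integral>\<^sup>+w. ennreal (indicator E x * p (sphere_drift w 1 x)) * ?b w \<partial>lborel)
        \<le> ennreal (c0 / 2) * indicator (E \<inter> ?S) x + Q x"
        using slices
      proof eventually_elim
        case (elim x)
        show ?case
        proof (cases "x \<in> E \<inter> ?S")
          case False
          have z: "ennreal (indicator E x * p (sphere_drift w 1 x)) * ?b w = 0" for w
          proof (cases "w \<in> ball 0 s \<and> x \<in> E")
            case True
            then have "norm (sphere_drift w 1 x) = norm x"
              using norm_sphere_drift[of w s 1 x] s2 by (auto simp: dist_norm)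
            then have "sphere_drift w 1 x \<notin> ?S" using False True by (auto simp: shell_def)
            then have "p (sphere_drift w 1 x) = 0" using L by blast
            then show ?thesis by simp
          qed (auto simp: indicator_def)
          show ?thesis unfolding z by simp
        next
          case True
          \<comment> \<open>With z = sgn x + w the drifted point is |x| sgn z, and |w| < s puts |z|
            between 1 - s and 1 + s: this is the integral in the slice hypothesis.\<close>
          define G where "G z = indicator (ball 0 s) (z - sgn x) * ennreal (p (norm x *\<^sub>R sgn z))" for z
          have Gm[measurable]: "G \<in> borel_measurable borel" unfolding G_def by measurable
          have x0: "x \<noteq> 0" using True a by (auto simp: shell_def)
          have "(\<integral>\<^sup>+w. ennreal (indicator E x * p (sphere_drift w 1 x)) * ?b w \<partial>lborel)
            = (\<integral>\<^sup>+w. G (sgn x + w) \<partial>lborel)"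
            using True by (intro nn_integral_cong) (simp add: G_def sphere_drift_def mult.commute)
          also have "\<dots> = (\<integral>\<^sup>+z. G z \<partial>lborel)" by (rule nn_integral_translate) measurable
          also have "\<dots> \<le> (\<integral>\<^sup>+z. indicator ?A (norm z) * indicator (E \<inter> ?S) (norm x *\<^sub>R sgn z)
             + indicator ?A (norm z) * ennreal (F (norm x *\<^sub>R sgn z)) \<partial>lborel)"
          proof (rule nn_integral_mono)
            fix z :: 'a
            let ?y = "norm x *\<^sub>R sgn z"
            show "G z \<le> indicator ?A (norm z) * indicator (E \<inter> ?S) ?y + indicator ?A (norm z) * ennreal (F ?y)"
            proof (cases "z - sgn x \<in> ball 0 s")
              case True
              then have "norm (z - sgn x) < s" by (simp add: dist_norm norm_minus_commute)
              then have "norm z \<in> ?A"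
                using norm_triangle_ineq3[of z "sgn x"] norm_sgn_nonzero[OF x0] by (auto simp: abs_le_iff)
              moreover have "ennreal (p ?y) \<le> indicator (E \<inter> ?S) ?y + ennreal (F ?y)"
              proof (cases "?y \<in> E \<inter> ?S")
                case True
                have "ennreal (p ?y) \<le> 1" using p(3)[of ?y] by simp
                also have "\<dots> \<le> 1 + ennreal (F ?y)" by (rule add_increasing2) auto
                finally show ?thesis using True by simp
              next
                case False
                then show ?thesis using p(2)[of ?y] by (simp add: F_def)
              qed
              ultimately show ?thesis using True by (simp add: G_def)
            qed (simp add: G_def)
          qed
          also have "\<dots> = (\<integral>\<^sup>+z. indicator ?A (norm z) * indicator (E \<inter> ?S) (norm x *\<^sub>R sgn z) \<partial>lborel) + Q x"
            unfolding Q_def by (rule nn_integral_add) measurable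
          also have "\<dots> \<le> ennreal (c0 / 2) + Q x"
            using elim True by (intro add_right_mono) (auto simp: c0_def)
          finally show ?thesis using True by simp
        qed
      qed
    qed
    also have "\<dots> = ennreal (c0 / 2) * ennreal m + (\<integral>\<^sup>+x. Q x \<partial>lborel)"
      by (subst nn_integral_add) (auto simp: nn_integral_cmult_indicator em)
    \<comment> \<open>The approximation error is evaluated at drifted points. Integrated over x it
      is a multiple of its plain integral by the spherical average, so it remains of order
      e.\<close>
    also have "(\<integral>\<^sup>+x. Q x \<partial>lborel) =
      (\<integral>\<^sup>+v. indicator ?A (1 / norm v) * ennreal (inverse (norm v) ^ (2 * DIM('a))) \<partial>(lborel :: 'a measure)) * (\<integral>\<^sup>+x. ennreal (F x) \<partial>lborel)"
      unfolding Q_def by (rule nn_integral_spherical_average) (use s s2 in auto)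
    also have "\<dots> \<le> ennreal (c * s) * ennreal e"
      by (intro mult_mono c(2) s s2 nF) auto
    finally have "ennreal (c0 * I0) \<le> ennreal (c0 / 2) * ennreal m + ennreal (c * s) * ennreal e + ennreal D * ennreal c0"
      by (simp add: add_mono)
    also have "\<dots> = ennreal (c0 / 2 * m + c * s * e + D * c0)"
    proof -
      have "ennreal (c0 / 2) * ennreal m = ennreal (c0 / 2 * m)"
        by (rule ennreal_mult[symmetric]) (use c0 m0 in auto)
      moreover have "ennreal (c * s) * ennreal e = ennreal (c * s * e)"
        by (rule ennreal_mult[symmetric]) (use c s e in auto)
      moreover have "ennreal D * ennreal c0 = ennreal (D * c0)"
        by (rule ennreal_mult[symmetric]) (use c0 D0 in auto)
      ultimately show ?thesis using c0 m0 c s e D0 by (simp only:) (simp add: ennreal_plus)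
    qed
    finally have "c0 * I0 \<le> c0 / 2 * m + c * s * e + D * c0"
      using c0 m0 c s e D0 by (subst (asm) ennreal_le_iff) auto
    moreover have "c0 * (m - e) \<le> c0 * I0" using mI c0 by (intro mult_left_mono) auto
    ultimately show ?thesis by (simp add: mult.commute)
  qed
  show ?thesis
  proof (rule ccontr)
    assume "\<not> ?thesis"
    then have gap: "m / 4 - B > 0" by (simp add: m_def)
    \<comment> \<open>Half of the value at which both sides of \<open>key\<close> would
      balance.\<close>
    define e where "e = c0 * (m / 4 - B) / (2 * (c0 + c * s))"
    have cs: "c0 + c * s > 0" using c0 c s by (simp add: add_pos_pos)
    have e: "e > 0" unfolding e_def using gap c0 cs by simp
    have "c0 * (m / 4 - B) \<le> (c0 + c * s) * e" using key[OF e] unfolding D_def by (simp add: algebra_simps)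
    also have "\<dots> = c0 * (m / 4 - B) / 2" using cs unfolding e_def by (simp add: field_simps)
    finally show False using gap c0 by (simp add: mult_pos_pos)
  qed
qed

subsection \<open>The weighted space\<close>

text \<open>The dimension is a separate parameter because H, G and similar real functions depend on it
  but not on a point of the space.\<close>

locale radial_weights =
  fixes f g h :: "real \<Rightarrow> real" and c :: real and n :: nat and ty :: "'a::euclidean_space itself"
  assumes dim_n: "DIM('a) = n" and dim: "n \<ge> 2"
    and h_pos: "\<forall>r>0. h r > 0"
    and h_cont: "continuous_on {0<..} h"
    and h_mono: "mono_on {0<..} h"
    and f_pos: "\<forall>r\<ge>0. f r > 0" and f_cont: "continuous_on {0..} f"
    and g_pos: "\<forall>r\<ge>0. g r > 0" and g_cont: "continuous_on {0..} g"
    and g_inf: "filterlim g at_top at_top"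
    and fg: "\<forall>r\<ge>0. f r \<le> c * g r"
begin

declare dim_n [simp]

abbreviation "\<mu> \<equiv> (rvol_density h :: 'a \<Rightarrow> real)"
text \<open>The area of the unit sphere in dimension n.\<close>

abbreviation "\<kappa> \<equiv> real n * unit_ball_vol (real n)"

definition W :: "'a measure" where
  "W = density lborel (\<lambda>x. ennreal (f (norm x) * \<mu> x))"

text \<open>Up to the factor \<kappa>, the derivative of the weighted volume of balls with respect
  to the radius; see \<open>W_radial\<close>.\<close>

definition H :: "real \<Rightarrow> real" where
  "H r = f r * h r ^ (n - 1)"

lemma c_pos: "c > 0"
proof -
  have "0 < f 0" "f 0 \<le> c * g 0" "0 < g 0" using fg f_pos g_pos by auto
  then have "0 < c * g 0" by linarith
  then show ?thesis using \<open>0 < g 0\<close> by (rule zero_less_mult_pos2)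
qed

lemma \<kappa>_pos: "\<kappa> > 0" using dim by simp

lemma h_le: "0 < r \<Longrightarrow> r \<le> s \<Longrightarrow> h r \<le> h s"
  using h_mono by (auto simp: mono_on_def)

lemma rvol_pos: "x \<noteq> 0 \<Longrightarrow> \<mu> x > 0"
  using h_pos by (simp add: rvol_density_def)

lemma rvol_0: "\<mu> 0 = 0"
  using dim by (simp add: rvol_density_def)

lemma rvol_nonneg: "\<mu> x \<ge> 0"
  using rvol_pos[of x] rvol_0 by (cases "x = 0") auto

lemma H_pos: "r > 0 \<Longrightarrow> H r > 0"
  using h_pos f_pos by (simp add: H_def)

lemma H_cont: "continuous_on {0<..} H"
  unfolding H_def by (intro continuous_intros h_cont continuous_on_subset[OF f_cont]) auto

text \<open>h is controlled only on the open half-line. The indicator turns the radial factor into a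
  Borel function of a real variable, and at the origin both sides are 0 because n is at least
  2.\<close>

lemma weight_eq: "f (norm x) * \<mu> x = indicator {0<..} (norm x) * (H (norm x) * inverse (norm x) ^ (n - 1))"
  by (cases "x = 0") (simp_all add: rvol_0, simp add: rvol_density_def H_def divide_inverse power_mult_distrib)

lemma radial_measurable:
  fixes u :: "real \<Rightarrow> real"
  assumes "continuous_on {0<..} u"
  shows "(\<lambda>r. indicator {0<..} r * u r :: real) \<in> borel_measurable borel"
  using borel_measurable_continuous_on_indicator[OF borel_open[OF open_greaterThan] assms] by simp

lemma weight_measurable [measurable]: "(\<lambda>x. f (norm x) * \<mu> x) \<in> borel_measurable borel"
proof -
  have "(\<lambda>r. indicator {0<..} r * (H r * inverse r ^ (n - 1)) :: real) \<in> borel_measurable borel"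
    by (intro radial_measurable continuous_intros H_cont) auto
  then show ?thesis unfolding weight_eq by (rule measurable_compose[rotated]) auto
qed

lemma sets_W [simp, measurable_cong]: "sets W = sets borel" by (simp add: W_def)
lemma space_W [simp]: "space W = UNIV" by (simp add: W_def)

lemma wvol_eq:
  assumes "E \<in> sets borel"
  shows "wvol f h (E :: 'a set) = emeasure W E"
proof -
  have "wvol f h E = (\<integral>\<^sup>+ x. ennreal (f (norm x) * \<mu> x) * indicator E x \<partial>lborel)"
    unfolding wvol_def by (simp add: nn_integral_completion)
  then show ?thesis unfolding W_def using assms by (simp add: emeasure_density)
qed

lemma W_radial:
  assumes F[measurable]: "F \<in> borel_measurable borel"
  shows "(\<integral>\<^sup>+x. F (norm x) \<partial>W) = (\<integral>\<^sup>+r. F r * ennreal (\<kappa> * (indicator {0<..} r * H r)) \<partial>lborel)"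
proof -
  have [measurable]: "(\<lambda>r. indicator {0<..} r * (H r * inverse r ^ (n - 1)) :: real) \<in> borel_measurable borel"
    by (intro radial_measurable continuous_intros H_cont) auto
  have "(\<integral>\<^sup>+x. F (norm x) \<partial>W) = (\<integral>\<^sup>+x. ennreal (f (norm x) * \<mu> x) * F (norm x) \<partial>lborel)"
    unfolding W_def by (rule nn_integral_density) measurable
  also have "\<dots> = (\<integral>\<^sup>+x. ennreal (indicator {0<..} (norm (x::'a)) * (H (norm x) * inverse (norm x) ^ (n - 1))) * F (norm x) \<partial>lborel)"
    unfolding weight_eq ..
  also have "\<dots> = (\<integral>\<^sup>+r. (ennreal (indicator {0<..} r * (H r * inverse r ^ (n - 1))) * F r) * ennreal (\<kappa> * r ^ (n - 1)) * indicator {0..} r \<partial>lborel)"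
    by (rule nn_integral_norm[where 'a = 'a, unfolded dim_n]) measurable
  also have "\<dots> = (\<integral>\<^sup>+r. F r * ennreal (\<kappa> * (indicator {0<..} r * H r)) \<partial>lborel)"
  proof (rule nn_integral_cong)
    fix r :: real
    show "(ennreal (indicator {0<..} r * (H r * inverse r ^ (n - 1))) * F r) * ennreal (\<kappa> * r ^ (n - 1)) * indicator {0..} r
      = F r * ennreal (\<kappa> * (indicator {0<..} r * H r))"
    proof (cases "r > 0")
      case True
      have "ennreal (H r * inverse r ^ (n - 1)) * ennreal (\<kappa> * r ^ (n - 1))
        = ennreal ((H r * inverse r ^ (n - 1)) * (\<kappa> * r ^ (n - 1)))"
        by (rule ennreal_mult[symmetric]) (use True H_pos[OF True] in auto)
      also have "(H r * inverse r ^ (n - 1)) * (\<kappa> * r ^ (n - 1)) = \<kappa> * H r * (inverse r * r) ^ (n - 1)"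
        by (simp only: power_mult_distrib mult_ac)
      also have "\<dots> = \<kappa> * H r" using True by simp
      finally show ?thesis using True by (simp add: mult_ac)
    qed simp
  qed
  finally show ?thesis .
qed

text \<open>Monotonicity bounds h on (0, R] by \<open>h R\<close>, however h behaves near 0, and f
  is bounded on the compact interval, so the volume of balls is Lipschitz in the radius. This gives
  finiteness of balls and, by continuity, sets of prescribed volume.\<close>

lemma W_cball_increment:
  assumes "0 < R"
  shows "\<exists>D\<ge>0. \<forall>r s. 0 \<le> r \<and> r \<le> s \<and> s \<le> R \<longrightarrow> emeasure W {x. r < norm x \<and> norm x \<le> s} \<le> ennreal (D * (s - r))"
proof -
  have "compact (f ` {0..R})" by (intro compact_continuous_image continuous_on_subset[OF f_cont]) auto
  then obtain M where M: "\<forall>y\<in>f ` {0..R}. norm y \<le> M" using compact_imp_bounded bounded_iff by metis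
  have M0: "M \<ge> 0" using M assms by (force intro: order_trans[OF norm_ge_zero])
  let ?D = "\<kappa> * (M * h R ^ (n - 1))"
  have hR: "h R > 0" using h_pos assms by auto
  show ?thesis
  proof (intro exI[of _ ?D] conjI allI impI)
    show "?D \<ge> 0" using M0 hR \<kappa>_pos by (intro mult_nonneg_nonneg) auto
    fix r s :: real assume rs': "0 \<le> r \<and> r \<le> s \<and> s \<le> R"
    then have rs: "0 \<le> r" "r \<le> s" "s \<le> R" by auto
    have "emeasure W {x. r < norm x \<and> norm x \<le> s} = (\<integral>\<^sup>+x. indicator {x. r < norm x \<and> norm x \<le> s} x \<partial>W)"
      by (rule nn_integral_indicator[symmetric]) measurable
    also have "\<dots> = (\<integral>\<^sup>+x. indicator {r<..s} (norm x) \<partial>W)"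
      by (rule nn_integral_cong) (simp add: indicator_def)
    also have "\<dots> = (\<integral>\<^sup>+t. indicator {r<..s} t * ennreal (\<kappa> * (indicator {0<..} t * H t)) \<partial>lborel)"
      by (rule W_radial) measurable
    also have "\<dots> \<le> (\<integral>\<^sup>+t. ennreal ?D * indicator {r<..s} t \<partial>lborel)"
    proof (rule nn_integral_mono)
      fix t
      show "indicator {r<..s} t * ennreal (\<kappa> * (indicator {0<..} t * H t)) \<le> ennreal ?D * indicator {r<..s} t"
      proof (cases "t \<in> {r<..s}")
        case True
        then have t: "0 < t" "t \<le> R" using rs by auto
        have "norm (f t) \<le> M" by (rule bspec[OF M]) (use t in auto)
        then have "f t \<le> M" by simp
        moreover have "h t ^ (n - 1) \<le> h R ^ (n - 1)"
          using h_le[OF t] h_pos t by (intro power_mono) (auto intro: less_imp_le)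
        moreover have "0 \<le> h t" using h_pos t by (simp add: less_imp_le)
        ultimately have "H t \<le> M * h R ^ (n - 1)" unfolding H_def
          by (intro mult_mono M0 zero_le_power)
        then have "\<kappa> * H t \<le> ?D" by (intro mult_left_mono) auto
        then show ?thesis using True t by (simp add: ennreal_leI)
      qed simp
    qed
    also have "\<dots> = ennreal ?D * ennreal (s - r)" using rs by (simp add: nn_integral_cmult_indicator)
    also have "\<dots> = ennreal (?D * (s - r))"
      by (rule ennreal_mult[symmetric]) (use rs M0 hR \<kappa>_pos in \<open>auto intro!: mult_nonneg_nonneg\<close>)
    finally show "emeasure W {x. r < norm x \<and> norm x \<le> s} \<le> ennreal (?D * (s - r))" .
  qed
qed

lemma W_singleton_0: "emeasure W {0} = 0"
  unfolding W_def by (subst emeasure_density) (auto simp: nn_integral_indicator_singleton' rvol_0 nn_integral_0_iff_AE indicator_def)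

lemma emeasure_W_cball:
  assumes "0 \<le> R"
  shows "emeasure W (cball 0 R) = emeasure W {x. 0 < norm x \<and> norm x \<le> R}"
proof -
  have e: "cball 0 R = {0} \<union> {x::'a. 0 < norm x \<and> norm x \<le> R}" using assms by auto
  show ?thesis unfolding e by (rule emeasure_Un_null_set[of _ W "{0}", unfolded Un_commute[of _ "{0}"]])
     (auto simp: null_sets_def W_singleton_0)
qed

lemma W_cball_finite: "emeasure W (cball 0 R) < \<infinity>"
proof -
  have pos: "0 < max 1 R" by simp
  obtain D where "D \<ge> 0" and D: "\<And>r s. 0 \<le> r \<Longrightarrow> r \<le> s \<Longrightarrow> s \<le> max 1 R \<Longrightarrow> emeasure W {x. r < norm x \<and> norm x \<le> s} \<le> ennreal (D * (s - r))"
    using W_cball_increment[OF pos] by blast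
  have "emeasure W (cball 0 (max 1 R)) = emeasure W {x. 0 < norm x \<and> norm x \<le> max 1 R}"
    by (rule emeasure_W_cball) simp
  also have "\<dots> \<le> ennreal (D * (max 1 R - 0))" by (rule D) auto
  also have "\<dots> < \<infinity>" by simp
  finally have "emeasure W (cball 0 (max 1 R)) < \<infinity>" .
  moreover have "emeasure W (cball 0 R) \<le> emeasure W (cball 0 (max 1 R))"
    by (intro emeasure_mono) auto
  ultimately show ?thesis by (blast intro: le_less_trans)
qed

section \<open>Perimeter bounds localised to shells\<close>

definition admissible :: "real \<Rightarrow> real \<Rightarrow> ('a \<Rightarrow> 'a) \<Rightarrow> bool" where
  "admissible a b Y \<longleftrightarrow> C1c_field Y \<and> (\<forall>x. x \<noteq> 0 \<longrightarrow> rnorm h x (Y x) \<le> g (norm x) * \<mu> x)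
     \<and> (\<exists>K. compact K \<and> K \<subseteq> shell a b \<and> (\<forall>x. x \<notin> K \<longrightarrow> Y x = 0))"

definition flux :: "'a set \<Rightarrow> ('a \<Rightarrow> 'a) \<Rightarrow> real" where
  "flux E Y = (\<integral>x. indicator E x * divergence Y x \<partial>lborel)"

text \<open>An upper bound for the perimeter of E inside the open shell. Admissible fields vanish
  near the bounding spheres, so nothing on those spheres is counted and bounds on adjacent shells
  can be combined.\<close>

definition per_le :: "'a set \<Rightarrow> real \<Rightarrow> real \<Rightarrow> real \<Rightarrow> bool" where
  "per_le E a b B \<longleftrightarrow> (\<forall>Y. admissible a b Y \<longrightarrow> flux E Y \<le> B)"

lemma rnorm_scaleR: "rnorm h x (t *\<^sub>R v) = \<bar>t\<bar> * rnorm h (x::'a) v"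
proof -
  have "((t *\<^sub>R v) \<bullet> sgn x)\<^sup>2 + (h (norm x) / norm x)\<^sup>2 * ((norm (t *\<^sub>R v))\<^sup>2 - ((t *\<^sub>R v) \<bullet> sgn x)\<^sup>2)
    = t\<^sup>2 * ((v \<bullet> sgn x)\<^sup>2 + (h (norm x) / norm x)\<^sup>2 * ((norm v)\<^sup>2 - (v \<bullet> sgn x)\<^sup>2))"
    by (simp add: power_mult_distrib algebra_simps)
  then show ?thesis unfolding rnorm_def by (simp add: real_sqrt_mult)
qed

lemma rnorm_0: "rnorm h (x::'a) 0 = 0"
  using rnorm_scaleR[of x 0 0] by simp

lemma rnorm_tangential:
  assumes "(v::'a) \<bullet> x = 0" "x \<noteq> 0"
  shows "rnorm h x v = h (norm x) / norm x * norm v"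
proof -
  have "v \<bullet> sgn x = 0" using assms by (simp add: sgn_div_norm)
  moreover have "h (norm x) > 0" using h_pos assms by simp
  ultimately show ?thesis unfolding rnorm_def by (simp add: real_sqrt_mult)
qed

lemma rnorm_radial: "x \<noteq> 0 \<Longrightarrow> rnorm h x (t *\<^sub>R (x::'a)) = \<bar>t\<bar> * norm x"
proof -
  assume x: "x \<noteq> 0"
  have "x \<bullet> sgn x = norm x" using x by (simp add: sgn_div_norm power2_norm_eq_inner[symmetric] power2_eq_square)
  then show ?thesis by (simp add: rnorm_scaleR) (simp add: rnorm_def)
qed

text \<open>Flux is linear in the field and the constraint is homogeneous. Each use consists of
  building a field and finding the factor M by which it exceeds the constraint.\<close>

lemma per_le_scaled:
  assumes per: "per_le E a b B" and Y: "C1c_field Y" "compact K" "K \<subseteq> shell a b" "\<And>x. x \<notin> K \<Longrightarrow> Y x = 0"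
    and M: "M > 0" and bd: "\<And>x. x \<in> K \<Longrightarrow> x \<noteq> 0 \<Longrightarrow> rnorm h x (Y x) \<le> M * (g (norm x) * \<mu> x)"
  shows "flux E Y \<le> M * B"
proof -
  let ?Z = "\<lambda>x. (1 / M) *\<^sub>R Y x"
  have "admissible a b ?Z" unfolding admissible_def
  proof (intro conjI allI impI)
    show "C1c_field ?Z" by (rule C1c_field_scaleR(1)[OF Y(1)])
    show "\<exists>K. compact K \<and> K \<subseteq> shell a b \<and> (\<forall>x. x \<notin> K \<longrightarrow> ?Z x = 0)" using Y by (intro exI[of _ K]) auto
    fix x :: 'a assume x: "x \<noteq> 0"
    show "rnorm h x (?Z x) \<le> g (norm x) * \<mu> x"
    proof (cases "x \<in> K")
      case True
      then show ?thesis using bd[OF True x] M unfolding rnorm_scaleR by (simp add: field_simps)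
    next
      case False
      then show ?thesis using Y(4) rvol_nonneg[of x] g_pos by (simp add: rnorm_0 less_imp_le)
    qed
  qed
  then have "flux E ?Z \<le> B" using per by (simp add: per_le_def)
  moreover have "flux E ?Z = (1 / M) * flux E Y"
    unfolding flux_def C1c_field_scaleR(2)[OF Y(1)]
    by (subst integral_mult_right_zero[symmetric]) (simp add: mult_ac)
  ultimately show ?thesis using M by (simp add: field_simps)
qed

lemma per_le_subset:
  assumes "per_le E a b B" "a \<le> a'" "b' \<le> b" shows "per_le E a' b' B"
proof -
  have "shell a' b' \<subseteq> (shell a b :: 'a set)" using assms by (auto simp: shell_def)
  then show ?thesis using assms(1) unfolding per_le_def admissible_def by (meson order_trans)
qed

lemma admissible_zero: "admissible a b (\<lambda>x. 0)"
  unfolding admissible_def using C1c_field_zero rvol_nonneg g_pos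
  by (auto simp: rnorm_0 less_imp_le intro!: exI[of _ "{}"] mult_nonneg_nonneg)

lemma flux_zero: "flux E (\<lambda>x. 0) = 0" by (simp add: flux_def divergence_zero)

lemma per_le_nonneg: "per_le E a b B \<Longrightarrow> B \<ge> 0"
  using admissible_zero flux_zero unfolding per_le_def by metis

end

text \<open>Radial test fields are prescribed through the slope of their profile. Antiderivatives
  that are constant on both sides of the support of the slope allow a rise and a fall to cancel
  outside a bounded interval.\<close>

lemma compact_support_antiderivative:
  fixes k :: "real \<Rightarrow> real"
  assumes k: "continuous_on UNIV k" "\<And>r. 0 \<le> k r" "\<And>r. r \<notin> {p..q} \<Longrightarrow> k r = 0" and pq: "p \<le> q"
  obtains \<Phi> I where "\<And>r. (\<Phi> has_real_derivative k r) (at r)" "\<And>r. r \<le> p \<Longrightarrow> \<Phi> r = 0" "\<And>r. q \<le> r \<Longrightarrow> \<Phi> r = I"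
    "\<And>r. 0 \<le> \<Phi> r" "\<And>r. \<Phi> r \<le> I" "(\<integral>\<^sup>+r. ennreal (k r) \<partial>lborel) = ennreal I"
proof -
  \<comment> \<open>Starting one unit before p makes p an interior point of the range, so the
    derivative there is two-sided.\<close>
  define \<Phi> where "\<Phi> r = integral {p-1..r} k" for r
  have kint: "k integrable_on {a..b}" for a b
    by (rule integrable_continuous_real[OF continuous_on_subset[OF k(1)]]) simp
  have zero: "\<Phi> r = 0" if "r < p" for r
    unfolding \<Phi>_def using k(3) that by (subst integral_cong[of _ _ "\<lambda>_. 0"]) auto
  have D: "(\<Phi> has_real_derivative k r) (at r)" for r
  proof (cases "r < p")
    case True
    have "((\<lambda>_. 0) has_real_derivative k r) (at r)" using k(3)[of r] True by simp
    then show ?thesis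
      by (rule has_field_derivative_transform_within_open[where S = "{..<p}"]) (use True zero in auto)
  next
    case False
    have "(\<Phi> has_real_derivative k r) (at r within {p-1..r+1})" unfolding \<Phi>_def
      by (rule integral_has_real_derivative[OF continuous_on_subset[OF k(1)]]) (use False in auto)
    then show ?thesis using at_within_Icc_at[of "p-1" r "r+1"] False by simp
  qed
  have mono: "\<Phi> r \<le> \<Phi> s" if "r \<le> s" for r s
    by (rule DERIV_nonneg_imp_nondecreasing[OF that]) (use D k(2) in blast)
  have zz: "\<Phi> r = 0" if "r \<le> p" for r
  proof -
    have "\<Phi> p \<le> \<Phi> (p - 1)"
    proof (rule DERIV_nonpos_imp_nonincreasing[of "p-1" p])
      fix x assume x: "p - 1 \<le> x" "x \<le> p"
      have "k p \<le> 0"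
      proof (rule tendsto_upperbound[of k _ "at_left p"])
        show "(k \<longlongrightarrow> k p) (at_left p)" using k(1)
          by (meson UNIV_I continuous_on_def filterlim_at_split tendsto_within_subset top_greatest continuous_within continuous_on_eq_continuous_within)
        show "\<forall>\<^sub>F x in at_left p. k x \<le> 0"
          using k(3) by (auto simp: eventually_at_left_field intro!: exI[of _ "p - 1"])
      qed simp
      then have "k x \<le> 0" using k(3)[of x] x by (cases "x = p") auto
      then show "\<exists>y. DERIV \<Phi> x :> y \<and> y \<le> 0" using D by blast
    qed simp
    then have "\<Phi> p = 0" using zero[of "p-1"] mono[of "p-1" p] by simp
    then show ?thesis using zero[of r] that by (cases "r = p") auto
  qed
  have nn: "0 \<le> \<Phi> r" for r
    using mono[of "min r p" r] zz[of "min r p"] by simp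
  have hi: "\<Phi> r = \<Phi> q" if "q \<le> r" for r
  proof (cases "r = q")
    case False
    have "\<Phi> r \<le> \<Phi> q"
    proof -
      have ev: "\<Phi> r \<le> \<Phi> s" if s: "q < s" "s \<le> r" for s
        by (rule DERIV_nonpos_imp_nonincreasing[OF s(2)]) (use D k(3) s in force)
      have cont: "isCont \<Phi> q" using D by (rule DERIV_isCont)
      show ?thesis
      proof (rule tendsto_lowerbound[of \<Phi> _ "at_right q"])
        show "(\<Phi> \<longlongrightarrow> \<Phi> q) (at_right q)" using cont by (simp add: isCont_def filterlim_at_split)
        show "\<forall>\<^sub>F x in at_right q. \<Phi> r \<le> \<Phi> x"
          using ev False that by (auto simp: eventually_at_right_field intro!: exI[of _ r])
      qed simp
    qed
    then show ?thesis using mono[OF that] by simp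
  qed simp
  have le: "\<Phi> r \<le> \<Phi> q" for r
    using mono[of r "max r q"] hi[of "max r q"] by simp
  have "(\<integral>\<^sup>+r. ennreal (k r) \<partial>lborel) = (\<integral>\<^sup>+r. ennreal (k r) * indicator {p-1..q} r \<partial>lborel)"
    by (rule nn_integral_cong) (use k(3) in \<open>auto simp: indicator_def\<close>)
  also have "\<dots> = ennreal (\<Phi> q)"
    unfolding \<Phi>_def by (rule nn_integral_has_integral_lebesgue'[OF k(2) integrable_integral[OF kint]])
  finally show ?thesis using that[of \<Phi> "\<Phi> q"] D zz hi nn le by blast
qed

context radial_weights
begin

subsection \<open>Smallness of the slices\<close>

text \<open>x / |x|^n is divergence-free off the origin, so only the slope of X contributes to the
  divergence. The length |X| r^(1-n) is to be compared with g h^(n-1) r^(1-n): the constraint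
  becomes |X| <= g h^(n-1).\<close>

lemma radial_field:
  assumes X: "\<And>r. (X has_real_derivative X' r) (at r)" "continuous_on UNIV X'"
    and supp: "\<forall>r. r \<notin> {p..q} \<longrightarrow> X r = 0" and p: "0 < p"
  defines "Y \<equiv> \<lambda>x::'a. (X (norm x) * inverse (norm x) ^ n) *\<^sub>R x"
  shows "C1c_field Y" "compact {x::'a. p \<le> norm x \<and> norm x \<le> q}" "\<And>x. \<not> (p \<le> norm x \<and> norm x \<le> q) \<Longrightarrow> Y x = 0"
    "\<And>x. x \<noteq> 0 \<Longrightarrow> divergence Y x = X' (norm x) * inverse (norm x) ^ (n - 1)"
    "\<And>x. x \<noteq> 0 \<Longrightarrow> rnorm h x (Y x) = \<bar>X (norm x)\<bar> * inverse (norm x) ^ (n - 1)"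
proof -
  define P where "P r = X r * inverse r ^ n" for r
  define P' where "P' r = X' r * inverse r ^ n + (real n * (- (inverse r ^ Suc (Suc 0)) * inverse r ^ (n - Suc 0))) * X r" for r
  have PD: "(P has_real_derivative P' r) (at r)" if "r \<noteq> 0" for r
    unfolding P_def P'_def
    by (rule DERIV_mult[OF X(1) DERIV_power[OF DERIV_inverse[OF that]]])
  have cX: "continuous_on UNIV X"
    using X(1) DERIV_isCont continuous_at_imp_continuous_on by blast
  have PC: "C1_on {0<..} P"
  proof (rule C1_on_real[where f' = P'])
    show "continuous_on {0<..} P'" unfolding P'_def
      by (intro continuous_intros continuous_on_subset[OF X(2)] continuous_on_subset[OF cX]) auto
  qed (use PD in auto)
  have YP: "Y = (\<lambda>x. P (norm x) *\<^sub>R x)" by (simp add: Y_def P_def)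
  have CY: "C1_on (- {0}) Y" unfolding YP
    by (rule C1_on_scaleR[OF C1_on_compose[OF PC C1_on_norm] C1_on_ident]) auto
  let ?K = "{x::'a. p \<le> norm x \<and> norm x \<le> q}"
  have "?K = cball 0 q - ball 0 p" by auto
  then show K: "compact ?K" by (simp add: compact_diff)
  show Y0: "Y x = 0" if "\<not> (p \<le> norm x \<and> norm x \<le> q)" for x
    using supp that by (auto simp: Y_def)
  show "C1c_field Y"
    by (rule C1_on_imp_C1c_field[OF CY K]) (use p Y0 in auto)
  fix x :: 'a assume x: "x \<noteq> 0"
  have n: "n = Suc (n - 1)" using dim by simp
  have sx: "x \<bullet> sgn x = norm x" using x by (simp add: sgn_div_norm power2_norm_eq_inner[symmetric] power2_eq_square)
  show "rnorm h x (Y x) = \<bar>X (norm x)\<bar> * inverse (norm x) ^ (n - 1)"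
  proof -
    have "inverse (norm x) ^ n * norm x = inverse (norm x) ^ (n - 1) * (inverse (norm x) * norm x)"
      by (subst n) (simp only: power_Suc mult_ac)
    then have "inverse (norm x) ^ n * norm x = inverse (norm x) ^ (n - 1)" using x by simp
    then show ?thesis unfolding Y_def rnorm_radial[OF x] by (simp add: abs_mult mult.assoc)
  qed
  have "((\<lambda>x. P (norm x)) has_derivative (\<lambda>v. P' (norm x) * (v \<bullet> sgn x))) (at x)"
    by (rule has_derivative_compose[OF has_derivative_norm'[OF x] PD[unfolded has_field_derivative_def]]) (use x in auto)
  then have "divergence Y x = P' (norm x) * (x \<bullet> sgn x) + P (norm x) * real n"
    unfolding YP using divergence_scaleR[OF _ has_derivative_ident] divergence_ident[where 'a = 'a] by fastforce
  also have "\<dots> = X' (norm x) * inverse (norm x) ^ (n - 1)"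
  proof -
    let ?r = "norm x" and ?i = "inverse (norm x)"
    have ri: "?i * ?r = 1" using x by simp
    have 1: "?i ^ n = ?i ^ (n - 1) * ?i" by (subst n) (simp only: power_Suc mult.commute)
    have "P' ?r * ?r + P ?r * real n
      = X' ?r * ?i ^ (n - 1) * (?i * ?r) + real n * X ?r * ?i ^ (n - 1) * (?i - ?i * (?i * ?r))"
      unfolding P'_def P_def 1 by (simp add: algebra_simps)
    then show ?thesis unfolding ri sx by simp
  qed
  finally show "divergence Y x = X' (norm x) * inverse (norm x) ^ (n - 1)" .
qed

text \<open>Balls have finite volume, so infinite total volume persists outside each of them. The
  margins of length 1 at both ends leave room for the ramps of the cutoff in
  \<open>radial_estimate\<close>.\<close>

lemma H_far:
  assumes inf: "emeasure W UNIV = \<infinity>" and b: "0 < b"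
  shows "\<exists>L>b+2. ennreal N \<le> (\<integral>\<^sup>+r. ennreal (H r) * indicator {b+1..L-1} r \<partial>lborel)"
proof -
  define A where "A i = {x::'a. b + 1 < norm x \<and> norm x \<le> b + 2 + real i}" for i
  have A: "A i \<in> sets W" for i unfolding A_def by measurable
  have un: "(\<Union>i. A i) = {x. b + 1 < norm x}"
  proof -
    have "\<exists>i. norm x \<le> b + 2 + real i" for x :: 'a
      using real_arch_simple[of "norm x"] b by (metis add_increasing add_nonneg_nonneg less_imp_le zero_le_numeral)
    then show ?thesis by (auto simp: A_def)
  qed
  have "emeasure W UNIV \<le> emeasure W (cball 0 (b + 1)) + emeasure W (\<Union>i. A i)"
    unfolding un by (rule order_trans[OF _ emeasure_subadditive]) (auto intro!: emeasure_mono)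
  then have "emeasure W (\<Union>i. A i) = \<infinity>" using inf W_cball_finite[of "b + 1"]
    by (auto simp: top_unique ennreal_add_eq_top less_top[symmetric])
  moreover have "(SUP i. emeasure W (A i)) = emeasure W (\<Union>i. A i)"
    by (rule SUP_emeasure_incseq) (use A in \<open>auto simp: A_def incseq_def\<close>)
  ultimately have sup: "(SUP i. emeasure W (A i)) = \<infinity>" by (simp only:)
  have "ennreal (\<kappa> * N) < (SUP i. emeasure W (A i))" unfolding sup by simp
  then obtain i where i: "ennreal (\<kappa> * N) < emeasure W (A i)" by (auto simp: less_SUP_iff)
  let ?L = "b + 3 + real i"
  have [measurable]: "(\<lambda>r. indicator {0<..} r * H r :: real) \<in> borel_measurable borel"
    by (rule radial_measurable[OF H_cont])
  have "emeasure W (A i) = (\<integral>\<^sup>+x. indicator (A i) x \<partial>W)" by (rule nn_integral_indicator[OF A, symmetric])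
  also have "\<dots> = (\<integral>\<^sup>+x. indicator {b+1<..b+2+real i} (norm x) \<partial>W)"
    by (rule nn_integral_cong) (simp add: indicator_def A_def)
  also have "\<dots> = (\<integral>\<^sup>+r. indicator {b+1<..b+2+real i} r * ennreal (\<kappa> * (indicator {0<..} r * H r)) \<partial>lborel)"
    by (rule W_radial) measurable
  also have "\<dots> \<le> (\<integral>\<^sup>+r. ennreal \<kappa> * (ennreal (indicator {0<..} r * H r) * indicator {b+1..?L-1} r) \<partial>lborel)"
    by (rule nn_integral_mono) (use b in \<open>auto simp: indicator_def ennreal_mult' \<kappa>_pos\<close>)
  also have "\<dots> = ennreal \<kappa> * (\<integral>\<^sup>+r. ennreal (indicator {0<..} r * H r) * indicator {b+1..?L-1} r \<partial>lborel)"
    by (rule nn_integral_cmult) measurable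
  also have "(\<integral>\<^sup>+r. ennreal (indicator {0<..} r * H r) * indicator {b+1..?L-1} r \<partial>lborel)
     = (\<integral>\<^sup>+r. ennreal (H r) * indicator {b+1..?L-1} r \<partial>lborel)"
    by (rule nn_integral_cong) (use b in \<open>auto simp: indicator_def\<close>)
  finally have "ennreal (\<kappa> * N) \<le> ennreal \<kappa> * (\<integral>\<^sup>+r. ennreal (H r) * indicator {b+1..?L-1} r \<partial>lborel)"
    using i by simp
  then have *: "ennreal \<kappa> * ennreal N \<le> ennreal \<kappa> * (\<integral>\<^sup>+r. ennreal (H r) * indicator {b+1..?L-1} r \<partial>lborel)"
    by (simp add: ennreal_mult' \<kappa>_pos less_imp_le)
  then have "ennreal N \<le> (\<integral>\<^sup>+r. ennreal (H r) * indicator {b+1..?L-1} r \<partial>lborel)"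
  proof -
    have "ennreal \<kappa> \<noteq> 0" using \<kappa>_pos by (metis ennreal_eq_0_iff not_le)
    with * show ?thesis by (metis ennreal_mult_le_mult_iff ennreal_neq_top)
  qed
  then show ?thesis by (intro exI[of _ ?L]) auto
qed

lemma radial_function_integrable:
  assumes E: "E \<in> sets borel" and k: "continuous_on UNIV k" "\<And>r. r \<notin> {p..q} \<Longrightarrow> k r = 0" and p: "0 < p"
  shows "integrable lborel (\<lambda>x::'a. indicator E x * (k (norm x) * inverse (norm x) ^ (n - 1)))"
proof (rule integrable_indicator_compact_support[OF E])
  have "{x::'a. p \<le> norm x \<and> norm x \<le> q} = cball 0 q - ball 0 p" by auto
  then show "compact {x::'a. p \<le> norm x \<and> norm x \<le> q}" by (simp add: compact_diff)
  show "continuous_on {x::'a. p \<le> norm x \<and> norm x \<le> q} (\<lambda>x. k (norm x) * inverse (norm x) ^ (n - 1))"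
    by (intro continuous_intros continuous_on_compose2[OF k(1)]) (use p in auto)
qed (use k(2) in auto)

text \<open>The test field is X(r) times the divergence-free field x / |x|^n. Its profile X rises with
  slope k and comes back to zero with slope at most e H far away; because the total volume is infinite,
  e can be made arbitrarily small, and then the descent costs at most e V. Monotonicity of h makes the
  field admissible.\<close>

lemma radial_estimate:
  assumes E[measurable]: "E \<in> sets borel" and V: "emeasure W E \<le> ennreal V" "0 \<le> V" and inf: "emeasure W UNIV = \<infinity>"
    and per: "\<And>b. per_le E 0 b C" and a: "0 < a" and m: "0 < m" "\<And>r. a \<le> r \<Longrightarrow> m \<le> g r"
    and k: "continuous_on UNIV k" "\<And>r. 0 \<le> k r" "\<And>r. r \<notin> {p..q} \<Longrightarrow> k r = 0" and pq: "a < p" "p \<le> q"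
  shows "ennreal (m * h a ^ (n - 1)) * (\<integral>\<^sup>+x. indicator E x * ennreal (k (norm x) * inverse (norm x) ^ (n - 1)) \<partial>lborel)
    \<le> ennreal C * (\<integral>\<^sup>+r. ennreal (k r) \<partial>lborel)"
proof -
  obtain \<Phi> I where \<Phi>: "\<And>r. (\<Phi> has_real_derivative k r) (at r)" "\<And>r. r \<le> p \<Longrightarrow> \<Phi> r = 0" "\<And>r. q \<le> r \<Longrightarrow> \<Phi> r = I"
    "\<And>r. 0 \<le> \<Phi> r" "\<And>r. \<Phi> r \<le> I" "(\<integral>\<^sup>+r. ennreal (k r) \<partial>lborel) = ennreal I"
    using compact_support_antiderivative[OF k pq(2)] by blast
  have I0: "0 \<le> I" using \<Phi>(4)[of q] \<Phi>(3)[of q] by simp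
  have C0: "0 \<le> C" using per_le_nonneg[OF per] .
  have ha: "h a > 0" using h_pos a by auto
  \<comment> \<open>The descent of the profile begins only after its ascent has ended, where \<Phi>
    already has the constant value I.\<close>
  define b where "b = q + 1"
  have b: "q < b" "0 < b" "a < b" using pq a by (auto simp: b_def)
  define hm where "hm = m * h a ^ (n - 1)"
  have hm: "hm > 0" using m ha by (simp add: hm_def)
  define J where "J = (\<integral>x. indicator E x * (k (norm x) * inverse (norm x) ^ (n - 1)) \<partial>lborel)"
  have p0: "0 < p" using pq a by simp
  have Jint: "integrable lborel (\<lambda>x. indicator E x * (k (norm x) * inverse (norm x) ^ (n - 1)))"
    by (rule radial_function_integrable[OF E k(1,3) p0])
  have key: "J \<le> (I + e) / hm * C + e * V" if e: "e > 0" for e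
  proof -
    \<comment> \<open>With a total slope above I / e available, a multiple t <= e of d0 brings the
      profile down from I to 0. The additional 1 keeps I' positive when I = 0.\<close>
    obtain L where L: "L > b + 2" "ennreal (I / e + 1) \<le> (\<integral>\<^sup>+r. ennreal (H r) * indicator {b+1..L-1} r \<partial>lborel)"
      using H_far[OF inf b(2)] by blast
    \<comment> \<open>H times a trapezoidal cutoff that is 1 on [b + 1, L - 1];
      \<open>max r b\<close> makes the factor H continuous on the whole line.\<close>
    define d0 where "d0 r = H (max r b) * max 0 (min 1 (min (r - b) (L - r)))" for r
    have Hm: "H (max r b) > 0" for r using H_pos b by simp
    have d0: "continuous_on UNIV d0" unfolding d0_def
      by (intro continuous_intros continuous_on_compose2[OF H_cont]) (use b in auto)
    have d0n: "0 \<le> d0 r" for r unfolding d0_def using Hm[of r] by (intro mult_nonneg_nonneg) auto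
    have d0z: "d0 r = 0" if "r \<notin> {b..L}" for r using that by (auto simp: d0_def)
    have d0H: "d0 r \<le> H r" if "b \<le> r" for r
    proof -
      have "d0 r \<le> H r * 1" unfolding d0_def using that Hm[of r] by (intro mult_mono) auto
      then show ?thesis by simp
    qed
    have bL: "b \<le> L" using L by simp
    obtain \<Psi> I' where \<Psi>: "\<And>r. (\<Psi> has_real_derivative d0 r) (at r)" "\<And>r. r \<le> b \<Longrightarrow> \<Psi> r = 0" "\<And>r. L \<le> r \<Longrightarrow> \<Psi> r = I'"
      "\<And>r. 0 \<le> \<Psi> r" "\<And>r. \<Psi> r \<le> I'" "(\<integral>\<^sup>+r. ennreal (d0 r) \<partial>lborel) = ennreal I'"
      using compact_support_antiderivative[OF d0 d0n d0z bL] by blast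
    have I'0: "0 \<le> I'" using \<Psi>(4)[of L] \<Psi>(3)[of L] by simp
    have "ennreal (I / e + 1) \<le> ennreal I'"
    proof -
      have "(\<integral>\<^sup>+r. ennreal (H r) * indicator {b+1..L-1} r \<partial>lborel) \<le> (\<integral>\<^sup>+r. ennreal (d0 r) \<partial>lborel)"
        by (rule nn_integral_mono) (use b in \<open>auto simp: indicator_def d0_def max_def\<close>)
      then show ?thesis using L(2) unfolding \<Psi>(6) by (rule order_trans[rotated])
    qed
    then have I': "I / e + 1 \<le> I'" using I'0 by simp
    have I'pos: "I' > 0"
    proof -
      have "0 \<le> I / e" using I0 e by simp
      then show ?thesis using I' by linarith
    qed
    define t where "t = I / I'"
    have t0: "0 \<le> t" using I0 I'pos by (simp add: t_def)
    have te: "t \<le> e"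
    proof -
      have "I / e \<le> I'" using I' by simp
      then show ?thesis using e I'pos by (simp add: t_def field_simps)
    qed
    have tI: "t * I' = I" using I'pos by (simp add: t_def)
    define X where "X r = \<Phi> r - t * \<Psi> r" for r
    have XD: "(X has_real_derivative (k r - t * d0 r)) (at r)" for r
      unfolding X_def by (intro DERIV_diff \<Phi>(1) DERIV_cmult \<Psi>(1))
    have tp: "0 \<le> t * \<Psi> r" "t * \<Psi> r \<le> I" for r
      using t0 \<Psi>(4)[of r] mult_left_mono[OF \<Psi>(5)[of r] t0] tI by auto
    have X0: "0 \<le> X r" for r
    proof (cases "r \<le> b")
      case True then show ?thesis using \<Psi>(2) \<Phi>(4) by (simp add: X_def)
    next
      case False then show ?thesis using \<Phi>(3)[of r] tp(2)[of r] b by (simp add: X_def)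
    qed
    have XI: "X r \<le> I" for r using \<Phi>(5)[of r] tp(1)[of r] by (simp add: X_def)
    have Xz: "X r = 0" if "r \<notin> {p..L}" for r
    proof (cases "r < p")
      case True then show ?thesis using \<Phi>(2)[of r] \<Psi>(2)[of r] b pq by (simp add: X_def)
    next
      case False
      then have "r > L" using that by auto
      then show ?thesis using \<Phi>(3)[of r] \<Psi>(3)[of r] bL b tI by (simp add: X_def)
    qed
    have Xz': "\<forall>r. r \<notin> {p..L} \<longrightarrow> X r = 0" using Xz by blast
    have cX': "continuous_on UNIV (\<lambda>r. k r - t * d0 r)" by (intro continuous_intros k d0)
    define Y where "Y x = (X (norm x) * inverse (norm x) ^ n) *\<^sub>R x" for x :: 'a
    note Y = radial_field[where p = p and q = L, OF XD cX' Xz' p0, folded Y_def]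
    let ?K = "{x::'a. p \<le> norm x \<and> norm x \<le> L}"
    have KS: "?K \<subseteq> shell 0 (L + 1)" using p0 by (auto simp: shell_def)
    \<comment> \<open>The summand e makes the scaling factor positive even if I = 0.\<close>
    have M: "(I + e) / hm > 0" using I0 e hm by simp
    have "flux E Y \<le> (I + e) / hm * C"
    proof (rule per_le_scaled[OF per Y(1,2) KS _ M])
      show "Y x = 0" if "x \<notin> ?K" for x using Y(3) that by auto
      fix x :: 'a assume x: "x \<in> ?K" "x \<noteq> 0"
      let ?r = "norm x"
      have r: "a \<le> ?r" using x pq by auto
      \<comment> \<open>Monotonicity of h enters here: the field lives beyond a, where g h^(n-1) is
        at least m h(a)^(n-1).\<close>
      have "hm \<le> g ?r * h ?r ^ (n - 1)" unfolding hm_def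
        using m(2)[OF r] m(1) h_le[OF a r] ha by (intro mult_mono power_mono) auto
      then have "(I + e) / hm * hm \<le> (I + e) / hm * (g ?r * h ?r ^ (n - 1))" using M by (intro mult_left_mono) auto
      then have "I + e \<le> (I + e) / hm * (g ?r * h ?r ^ (n - 1))" using hm by simp
      moreover have "\<bar>X ?r\<bar> \<le> I + e" using X0[of ?r] XI[of ?r] e by simp
      ultimately have "\<bar>X ?r\<bar> * inverse ?r ^ (n - 1) \<le> (I + e) / hm * (g ?r * h ?r ^ (n - 1)) * inverse ?r ^ (n - 1)"
        by (intro mult_right_mono) auto
      also have "\<dots> = (I + e) / hm * (g ?r * \<mu> x)"
        by (simp add: rvol_density_def divide_inverse power_mult_distrib mult_ac)
      finally show "rnorm h x (Y x) \<le> (I + e) / hm * (g ?r * \<mu> x)" unfolding Y(5)[OF x(2)] .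
    qed
    moreover have "flux E Y = J - t * (\<integral>x. indicator E x * (d0 (norm x) * inverse (norm x) ^ (n - 1)) \<partial>lborel)" (is "_ = J - t * ?D")
    proof -
      have Dint: "integrable lborel (\<lambda>x. indicator E x * (d0 (norm x) * inverse (norm x) ^ (n - 1)))"
        by (rule radial_function_integrable[OF E d0 d0z b(2)])
      have dv: "divergence Y x = (k (norm x) - t * d0 (norm x)) * inverse (norm x) ^ (n - 1)" for x
      proof (cases "x = 0")
        case True
        have "divergence Y 0 = 0"
          by (rule C1c_field_divergence(2)[OF Y(1) _ compact_imp_closed[OF Y(2)]]) (use Y(3) p0 in auto)
        then show ?thesis using True dim by simp
      qed (rule Y(4))
      have "flux E Y = (\<integral>x. indicator E x * (k (norm x) * inverse (norm x) ^ (n - 1))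
          - t * (indicator E x * (d0 (norm x) * inverse (norm x) ^ (n - 1))) \<partial>lborel)"
        unfolding flux_def dv by (intro Bochner_Integration.integral_cong) (auto simp: algebra_simps)
      also have "\<dots> = J - t * ?D" unfolding J_def
        by (subst Bochner_Integration.integral_diff[OF Jint integrable_mult_right[OF Dint]]) simp
      finally show ?thesis .
    qed
    \<comment> \<open>Since d0 is at most H beyond b, the integral \<open>?D\<close> is at most the
      weighted volume of E.\<close>
    moreover have "t * ?D \<le> e * V"
    proof -
      have "ennreal ?D \<le> (\<integral>\<^sup>+x. ennreal (indicator E x * (d0 (norm x) * inverse (norm x) ^ (n - 1))) \<partial>lborel)"
        by (subst nn_integral_eq_integral[OF radial_function_integrable[OF E d0 d0z b(2)]])
           (auto intro!: AE_I2 mult_nonneg_nonneg d0n)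
      also have "\<dots> \<le> (\<integral>\<^sup>+x. ennreal (f (norm x) * \<mu> x) * indicator E x \<partial>lborel)"
      proof (rule nn_integral_mono)
        fix x :: 'a
        have "d0 (norm x) * inverse (norm x) ^ (n - 1) \<le> f (norm x) * \<mu> x"
        proof (cases "norm x \<ge> b")
          case True
          then have "norm x > 0" using b by linarith
          then show ?thesis unfolding weight_eq using d0H[OF True] by (simp add: mult_right_mono)
        next
          case False
          then show ?thesis using d0z[of "norm x"] f_pos rvol_nonneg[of x] by (simp add: less_imp_le)
        qed
        then show "ennreal (indicator E x * (d0 (norm x) * inverse (norm x) ^ (n - 1))) \<le> ennreal (f (norm x) * \<mu> x) * indicator E x"
          by (auto simp: indicator_def ennreal_leI)
      qed
      also have "\<dots> = emeasure W E" unfolding W_def by (simp add: emeasure_density)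
      also have "\<dots> \<le> ennreal V" by (rule V)
      finally have "?D \<le> V" using V(2) by simp
      moreover have "0 \<le> ?D" by (intro Bochner_Integration.integral_nonneg) (auto intro!: mult_nonneg_nonneg d0n)
      ultimately show ?thesis using te t0 e by (intro mult_mono) auto
    qed
    ultimately show ?thesis by linarith
  qed
  have "J \<le> I / hm * C"
  proof (rule field_le_epsilon)
    fix e :: real assume e: "0 < e"
    define e' where "e' = e / (C / hm + V + 1)"
    have pos: "C / hm + V + 1 > 0" using C0 hm V by (intro add_nonneg_pos add_nonneg_nonneg) auto
    then have e': "e' > 0" using e by (simp add: e'_def)
    have "J \<le> (I + e') / hm * C + e' * V" by (rule key[OF e'])
    also have "\<dots> = I / hm * C + e' * (C / hm + V)" using hm by (simp add: field_simps)
    also have "\<dots> \<le> I / hm * C + e' * (C / hm + V + 1)" using e' by (intro add_left_mono mult_left_mono) auto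
    also have "\<dots> = I / hm * C + e" using pos by (simp add: e'_def)
    finally show "J \<le> I / hm * C + e" .
  qed
  then have "hm * J \<le> C * I" using hm by (simp add: field_simps)
  moreover have "(\<integral>\<^sup>+x. indicator E x * ennreal (k (norm x) * inverse (norm x) ^ (n - 1)) \<partial>lborel) = ennreal J"
    unfolding J_def by (subst nn_integral_eq_integral[OF Jint, symmetric])
      (auto intro!: AE_I2 mult_nonneg_nonneg k nn_integral_cong simp: indicator_def)
  moreover have "0 \<le> J" unfolding J_def by (intro Bochner_Integration.integral_nonneg) (auto intro!: mult_nonneg_nonneg k)
  ultimately show ?thesis unfolding \<Phi>(6) hm_def[symmetric]
    using hm C0 I0 by (simp add: ennreal_mult[symmetric] ennreal_leI)
qed

end

lemma compact_subset_open_interval: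
  fixes L :: "real set"
  assumes "compact L" "L \<subseteq> {a<..<b}" "a < b"
  obtains p q where "a < p" "p \<le> q" "q < b" "L \<subseteq> {p..q}"
proof (cases "L = {}")
  case True
  show ?thesis by (rule that[of "(a + b) / 2" "(a + b) / 2"]) (use True assms in auto)
next
  case False
  obtain p where p: "p \<in> L" "\<And>x. x \<in> L \<Longrightarrow> p \<le> x" using compact_attains_inf[OF assms(1) False] by blast
  obtain q where q: "q \<in> L" "\<And>x. x \<in> L \<Longrightarrow> x \<le> q" using compact_attains_sup[OF assms(1) False] by blast
  show ?thesis by (rule that[of p q]) (use p q assms in \<open>auto intro!: p(2)\<close>)
qed

context radial_weights
begin

text \<open>The weight r^(1-n) cancels the growth of spheres, so integrals over space turn into
  plain integrals over radii.\<close>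

lemma nn_integral_norm_power:
  assumes [measurable]: "F \<in> borel_measurable borel" and z: "\<And>r. r \<le> 0 \<Longrightarrow> F r = 0"
  shows "(\<integral>\<^sup>+x. F (norm x) * ennreal (inverse (norm x) ^ (n - 1)) \<partial>(lborel :: 'a measure)) = ennreal \<kappa> * (\<integral>\<^sup>+r. F r \<partial>lborel)"
proof -
  have "(\<integral>\<^sup>+x. F (norm x) * ennreal (inverse (norm x) ^ (n - 1)) \<partial>(lborel :: 'a measure))
    = (\<integral>\<^sup>+r. (F r * ennreal (inverse r ^ (n - 1))) * ennreal (\<kappa> * r ^ (n - 1)) * indicator {0..} r \<partial>lborel)"
    by (rule nn_integral_norm[where 'a = 'a, unfolded dim_n]) measurable
  also have "\<dots> = (\<integral>\<^sup>+r. ennreal \<kappa> * F r \<partial>lborel)"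
  proof (rule nn_integral_cong)
    fix r :: real
    show "(F r * ennreal (inverse r ^ (n - 1))) * ennreal (\<kappa> * r ^ (n - 1)) * indicator {0..} r = ennreal \<kappa> * F r"
    proof (cases "r > 0")
      case True
      have "ennreal (inverse r ^ (n - 1)) * ennreal (\<kappa> * r ^ (n - 1)) = ennreal (inverse r ^ (n - 1) * (\<kappa> * r ^ (n - 1)))"
        by (rule ennreal_mult[symmetric]) (use True in auto)
      also have "inverse r ^ (n - 1) * (\<kappa> * r ^ (n - 1)) = \<kappa> * (inverse r * r) ^ (n - 1)"
        by (simp only: power_mult_distrib mult_ac)
      also have "\<dots> = \<kappa>" using True by simp
      finally show ?thesis using True by (simp add: mult_ac)
    qed (use z in auto)
  qed
  also have "\<dots> = ennreal \<kappa> * (\<integral>\<^sup>+r. F r \<partial>lborel)" by (rule nn_integral_cmult) measurable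
  finally show ?thesis .
qed

text \<open>Continuous slopes are replaced by the indicator of a Borel set of radii, by
  approximation in mean. General Borel sets are wanted because B will be a set of exceptional radii
  known only to be measurable.\<close>

lemma radial_set_estimate:
  assumes E[measurable]: "E \<in> sets borel" and V: "emeasure W E \<le> ennreal V" "0 \<le> V" and inf: "emeasure W UNIV = \<infinity>"
    and per: "\<And>b. per_le E 0 b C" and a: "0 < a" "a < b" and m: "0 < m" "\<And>r. a \<le> r \<Longrightarrow> m \<le> g r"
    and B[measurable]: "B \<in> sets borel" and Bab: "B \<subseteq> {a<..<b}"
  shows "(\<integral>\<^sup>+x. indicator E x * indicator B (norm x) * ennreal (inverse (norm x) ^ (n - 1)) \<partial>lborel)
    \<le> ennreal (C / (m * h a ^ (n - 1))) * emeasure lborel B"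
proof -
  define hm where "hm = m * h a ^ (n - 1)"
  have ha: "h a > 0" using h_pos a by auto
  have hm: "hm > 0" using m ha by (simp add: hm_def)
  have C0: "0 \<le> C" using per_le_nonneg[OF per] .
  let ?X = "(\<integral>\<^sup>+x. indicator E x * indicator B (norm x) * ennreal (inverse (norm x) ^ (n - 1)) \<partial>(lborel :: 'a measure))"
  have key: "?X \<le> ennreal (C / hm) * emeasure lborel B + ennreal e" if e: "e > 0" for e
  proof -
    define e' where "e' = e / (C / hm + \<kappa>)"
    have pos: "C / hm + \<kappa> > 0" using C0 hm \<kappa>_pos by (intro add_nonneg_pos) auto
    have e': "e' > 0" using e pos by (simp add: e'_def)
    have fin: "emeasure lborel {a<..<b} < \<infinity>" using a by simp
    obtain p :: "real \<Rightarrow> real" and L where p: "C1_on UNIV p" "\<And>x. 0 \<le> p x" "\<And>x. p x \<le> 1"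
      and L: "compact L" "L \<subseteq> {a<..<b}" "\<And>x. x \<notin> L \<Longrightarrow> p x = 0"
      and pi: "integrable lborel (\<lambda>x. \<bar>p x - indicator B x\<bar>)"
      and pe: "(\<integral>x. \<bar>p x - indicator B x\<bar> \<partial>lborel) < e'"
      using C1_approx_indicator_lborel[OF open_greaterThanLessThan fin B Bab e'] by blast
    obtain p0 q0 where pq: "a < p0" "p0 \<le> q0" "q0 < b" "L \<subseteq> {p0..q0}"
      using compact_subset_open_interval[OF L(1,2) a(2)] by blast
    have pc: "continuous_on UNIV p" by (rule C1_on_imp_continuous_on[OF p(1)])
    have [measurable]: "p \<in> borel_measurable borel" by (rule borel_measurable_continuous_onI[OF pc])
    have pz: "p r = 0" if "r \<notin> {p0..q0}" for r using L(3) pq(4) that by blast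
    define F where "F r = ennreal \<bar>p r - indicator B r\<bar>" for r
    have Fm[measurable]: "F \<in> borel_measurable borel" unfolding F_def by measurable
    have Fz: "F r = 0" if "r \<notin> {a<..<b}" for r
    proof -
      have "r \<notin> L" "r \<notin> B" using L(2) Bab that by blast+
      then show ?thesis by (simp add: F_def L(3))
    qed
    have nF: "(\<integral>\<^sup>+r. F r \<partial>lborel) \<le> ennreal e'"
      unfolding F_def using pe by (subst nn_integral_eq_integral[OF pi]) (auto intro!: ennreal_leI)
    have 1: "(\<integral>\<^sup>+x. indicator E x * ennreal (p (norm x) * inverse (norm x) ^ (n - 1)) \<partial>lborel)
      \<le> ennreal (C / hm) * (\<integral>\<^sup>+r. ennreal (p r) \<partial>lborel)" (is "?Z \<le> _")
    proof -
      have "ennreal hm * ?Z \<le> ennreal C * (\<integral>\<^sup>+r. ennreal (p r) \<partial>lborel)"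
        unfolding hm_def by (rule radial_estimate[OF E V inf per a(1) m pc p(2) pz pq(1,2)])
      then have "ennreal (1 / hm) * (ennreal hm * ?Z) \<le> ennreal (1 / hm) * (ennreal C * (\<integral>\<^sup>+r. ennreal (p r) \<partial>lborel))"
        by (rule mult_left_mono) simp
      moreover have "ennreal (1 / hm) * ennreal hm = 1"
        using hm by (subst ennreal_mult[symmetric]) auto
      moreover have "ennreal (1 / hm) * ennreal C = ennreal (C / hm)"
        using hm C0 by (subst ennreal_mult[symmetric]) auto
      ultimately show ?thesis by (simp add: mult.assoc[symmetric])
    qed
    have "(\<integral>\<^sup>+r. ennreal (p r) \<partial>lborel) \<le> (\<integral>\<^sup>+r. indicator B r + F r \<partial>lborel)"
    proof (rule nn_integral_mono)
      fix r
      have "ennreal (p r) \<le> ennreal (indicator B r + \<bar>p r - indicator B r\<bar>)" by (rule ennreal_leI) linarith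
      also have "\<dots> = indicator B r + F r" unfolding F_def by (subst ennreal_plus) (auto simp: ennreal_indicator)
      finally show "ennreal (p r) \<le> indicator B r + F r" .
    qed
    also have "\<dots> = emeasure lborel B + (\<integral>\<^sup>+r. F r \<partial>lborel)" by (subst nn_integral_add) auto
    finally have 2: "(\<integral>\<^sup>+r. ennreal (p r) \<partial>lborel) \<le> emeasure lborel B + ennreal e'"
      using nF by (meson add_left_mono order_trans)
    have "?X \<le> (\<integral>\<^sup>+x. indicator E x * ennreal (p (norm x) * inverse (norm x) ^ (n - 1))
        + F (norm x) * ennreal (inverse (norm x) ^ (n - 1)) \<partial>lborel)"
    proof (rule nn_integral_mono)
      fix x :: 'a
      let ?i = "inverse (norm x) ^ (n - 1)"
      have "indicator B (norm x) = ennreal (indicator B (norm x))" by (simp add: ennreal_indicator)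
      also have "\<dots> \<le> ennreal (p (norm x) + \<bar>p (norm x) - indicator B (norm x)\<bar>)" by (rule ennreal_leI) linarith
      also have "\<dots> = ennreal (p (norm x)) + F (norm x)" unfolding F_def by (rule ennreal_plus) (use p(2) in auto)
      finally have "indicator B (norm x) * ennreal ?i \<le> (ennreal (p (norm x)) + F (norm x)) * ennreal ?i"
        by (rule mult_right_mono) simp
      also have "\<dots> = ennreal (p (norm x) * ?i) + F (norm x) * ennreal ?i"
        by (simp add: distrib_right ennreal_mult p(2))
      finally show "indicator E x * indicator B (norm x) * ennreal ?i \<le> indicator E x * ennreal (p (norm x) * ?i) + F (norm x) * ennreal ?i"
        by (auto simp: indicator_def)
    qed
    also have "\<dots> = ?Z + (\<integral>\<^sup>+x. F (norm x) * ennreal (inverse (norm x) ^ (n - 1)) \<partial>(lborel :: 'a measure))"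
      by (rule nn_integral_add) measurable
    also have "(\<integral>\<^sup>+x. F (norm x) * ennreal (inverse (norm x) ^ (n - 1)) \<partial>(lborel :: 'a measure)) = ennreal \<kappa> * (\<integral>\<^sup>+r. F r \<partial>lborel)"
      by (rule nn_integral_norm_power) (use Fz a in auto)
    also have "?Z + ennreal \<kappa> * (\<integral>\<^sup>+r. F r \<partial>lborel) \<le> ennreal (C / hm) * (emeasure lborel B + ennreal e') + ennreal \<kappa> * ennreal e'"
      by (intro add_mono order_trans[OF 1] mult_left_mono 2 nF) auto
    also have "\<dots> = ennreal (C / hm) * emeasure lborel B + (ennreal (C / hm) * ennreal e' + ennreal \<kappa> * ennreal e')"
      by (simp add: distrib_left add.assoc)
    also have "ennreal (C / hm) * ennreal e' + ennreal \<kappa> * ennreal e' = ennreal (C / hm * e' + \<kappa> * e')"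
    proof -
      have e1: "ennreal (C / hm) * ennreal e' = ennreal (C / hm * e')" by (rule ennreal_mult[symmetric]) (use C0 hm e' in auto)
      have e2: "ennreal \<kappa> * ennreal e' = ennreal (\<kappa> * e')" by (rule ennreal_mult[symmetric]) (use e' in auto)
      show ?thesis unfolding e1 e2 by (rule ennreal_plus[symmetric]) (use C0 hm e' in auto)
    qed
    also have "C / hm * e' + \<kappa> * e' = e"
    proof -
      have "C / hm * e' + \<kappa> * e' = (C / hm + \<kappa>) * e'" by (rule distrib_right[symmetric])
      then show ?thesis using pos unfolding e'_def by simp
    qed
    finally show ?thesis .
  qed
  show ?thesis unfolding hm_def[symmetric]
    by (rule ennreal_le_epsilon) (use key in blast)
qed

text \<open>Let Q be the set of radii with too large a slice. Averaging over the thickened sphere,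
  the part of E over Q contributes at least c1 \<kappa> |Q|, while
  \<open>radial_set_estimate\<close> allows at most cs \<delta> |Q|. By \<open>small\<close> this
  forces |Q| = 0.\<close>

lemma slices_small:
  assumes E[measurable]: "E \<in> sets borel" and V: "emeasure W E \<le> ennreal V" "0 \<le> V" and inf: "emeasure W UNIV = \<infinity>"
    and per: "\<And>b. per_le E 0 b C" and a: "0 < a" "a < b" and m: "0 < m" "\<And>r. a \<le> r \<Longrightarrow> m \<le> g r"
    and s: "0 < s" "s \<le> 1/2"
    and cs: "(\<integral>\<^sup>+v. indicator {1-s..1+s} (1 / norm v) * ennreal (inverse (norm v) ^ (2 * n)) \<partial>(lborel :: 'a measure)) \<le> ennreal cs" "0 \<le> cs"
    and c1: "0 \<le> c1" and small: "cs * (C / (m * h a ^ (n - 1))) < c1 * \<kappa>"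
  shows "AE x in (lborel :: 'a measure). x \<in> shell a b \<longrightarrow>
      (\<integral>\<^sup>+z. indicator {1-s..1+s} (norm z) * indicator (E \<inter> shell a b) (norm x *\<^sub>R sgn z) \<partial>lborel) \<le> ennreal c1"
proof -
  let ?A = "{1-s..1+s}" and ?S = "shell a b :: 'a set"
  define \<delta> where "\<delta> = C / (m * h a ^ (n - 1))"
  have ha: "h a > 0" using h_pos a by auto
  have \<delta>0: "0 \<le> \<delta>" using per_le_nonneg[OF per] m ha by (simp add: \<delta>_def)
  define q where "q r = (\<integral>\<^sup>+z. indicator ?A (norm z) * indicator (E \<inter> ?S) (r *\<^sub>R sgn z) \<partial>lborel)" for r
  have [measurable]: "q \<in> borel_measurable borel" unfolding q_def by measurable
  define Q where "Q = {r \<in> {a<..<b}. q r > ennreal c1}"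
  have Qm[measurable]: "Q \<in> sets borel" unfolding Q_def by measurable
  have Qab: "Q \<subseteq> {a<..<b}" by (auto simp: Q_def)
  have "emeasure lborel Q \<le> emeasure lborel {a<..<b}" by (rule emeasure_mono[OF Qab]) simp
  then have Qfin: "emeasure lborel Q < \<infinity>" using a by (auto intro: le_less_trans)
  define mQ where "mQ = measure lborel Q"
  have mQ: "emeasure lborel Q = ennreal mQ" "0 \<le> mQ"
    using Qfin by (auto simp: mQ_def emeasure_eq_ennreal_measure less_top)
  define F where "F x = indicator E x * indicator Q (norm x) * ennreal (inverse (norm x) ^ (n - 1))" for x :: 'a
  have [measurable]: "F \<in> borel_measurable borel" unfolding F_def by measurable
  have "ennreal c1 * (ennreal \<kappa> * emeasure lborel Q) = (\<integral>\<^sup>+x. ennreal c1 * (indicator Q (norm x) * ennreal (inverse (norm x) ^ (n - 1))) \<partial>(lborel :: 'a measure))"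
  proof -
    have "(\<integral>\<^sup>+x. indicator Q (norm x) * ennreal (inverse (norm x) ^ (n - 1)) \<partial>(lborel :: 'a measure)) = ennreal \<kappa> * (\<integral>\<^sup>+r. indicator Q r \<partial>lborel)"
      by (rule nn_integral_norm_power) (use Qab a in \<open>auto simp: indicator_def\<close>)
    then show ?thesis by (subst nn_integral_cmult) auto
  qed
  also have "\<dots> \<le> (\<integral>\<^sup>+x. (\<integral>\<^sup>+z. indicator ?A (norm z) * F (norm x *\<^sub>R sgn z) \<partial>lborel) \<partial>(lborel :: 'a measure))"
  proof (rule nn_integral_mono)
    fix x :: 'a
    show "ennreal c1 * (indicator Q (norm x) * ennreal (inverse (norm x) ^ (n - 1)))
      \<le> (\<integral>\<^sup>+z. indicator ?A (norm z) * F (norm x *\<^sub>R sgn z) \<partial>lborel)"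
    proof (cases "norm x \<in> Q")
      case True
      have "ennreal c1 * ennreal (inverse (norm x) ^ (n - 1)) \<le> q (norm x) * ennreal (inverse (norm x) ^ (n - 1))"
        by (rule mult_right_mono) (use True in \<open>auto simp: Q_def\<close>)
      also have "\<dots> = (\<integral>\<^sup>+z. indicator ?A (norm z) * indicator (E \<inter> ?S) (norm x *\<^sub>R sgn z) * ennreal (inverse (norm x) ^ (n - 1)) \<partial>lborel)"
        unfolding q_def by (rule nn_integral_multc[symmetric]) measurable
      also have "\<dots> \<le> (\<integral>\<^sup>+z. indicator ?A (norm z) * F (norm x *\<^sub>R sgn z) \<partial>lborel)"
      proof (rule nn_integral_mono)
        fix z :: 'a
        show "indicator ?A (norm z) * indicator (E \<inter> ?S) (norm x *\<^sub>R sgn z) * ennreal (inverse (norm x) ^ (n - 1))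
          \<le> indicator ?A (norm z) * F (norm x *\<^sub>R sgn z)"
        proof (cases "norm z \<in> ?A")
          case zA: True
          then have "z \<noteq> 0" using s by auto
          then have ny: "norm (norm x *\<^sub>R sgn z) = norm x" by (simp add: norm_sgn)
          show ?thesis using True zA unfolding F_def ny by (simp add: indicator_def)
        qed simp
      qed
      finally show ?thesis using True by simp
    qed simp
  qed
  also have "\<dots> = (\<integral>\<^sup>+v. indicator ?A (1 / norm v) * ennreal (inverse (norm v) ^ (2 * n)) \<partial>(lborel :: 'a measure)) * (\<integral>\<^sup>+x. F x \<partial>lborel)"
    by (rule nn_integral_spherical_average[where 'a = 'a, unfolded dim_n]) (use s in auto)
  also have "\<dots> \<le> ennreal cs * (ennreal \<delta> * emeasure lborel Q)"
    unfolding F_def \<delta>_def by (intro mult_mono cs radial_set_estimate[OF E V inf per a m Qm Qab]) auto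
  finally have "ennreal (c1 * (\<kappa> * mQ)) \<le> ennreal (cs * (\<delta> * mQ))"
    unfolding mQ(1) using c1 cs(2) \<delta>0 mQ(2) \<kappa>_pos
    by (simp add: ennreal_mult'' ennreal_mult del: of_nat_mult)
  then have "c1 * (\<kappa> * mQ) \<le> cs * (\<delta> * mQ)"
    using cs(2) \<delta>0 mQ(2) by (subst (asm) ennreal_le_iff) auto
  then have "(c1 * \<kappa> - cs * \<delta>) * mQ \<le> 0" by (simp add: algebra_simps)
  then have "mQ = 0" using small mQ(2) unfolding \<delta>_def[symmetric] by (simp add: mult_le_0_iff)
  then have Q0: "emeasure lborel Q = 0" using mQ by simp
  \<comment> \<open>A null set of radii lifts to a null set of points.\<close>
  have "(\<integral>\<^sup>+x. indicator Q (norm x) \<partial>(lborel :: 'a measure)) = (\<integral>\<^sup>+r. indicator Q r * ennreal (\<kappa> * r ^ (n - 1)) * indicator {0..} r \<partial>lborel)"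
    by (rule nn_integral_norm[where 'a = 'a, unfolded dim_n]) measurable
  also have "\<dots> = (\<integral>\<^sup>+r. 0 \<partial>(lborel :: real measure))"
  proof (rule nn_integral_cong_AE)
    have "AE r in lborel. r \<notin> Q" by (rule AE_not_in) (simp add: null_sets_def Q0)
    then show "AE r in lborel. indicator Q r * ennreal (\<kappa> * r ^ (n - 1)) * indicator {0..} r = 0"
      by eventually_elim simp
  qed
  finally have "(\<integral>\<^sup>+x. indicator Q (norm x) \<partial>(lborel :: 'a measure)) = 0" by simp
  then have "AE x in (lborel :: 'a measure). indicator Q (norm x) = (0::ennreal)"
    by (subst (asm) nn_integral_0_iff_AE) auto
  then show ?thesis
  proof eventually_elim
    case (elim x)
    then have "norm x \<notin> Q" by (simp add: indicator_def split: if_splits)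
    then show ?case by (auto simp: Q_def shell_def q_def not_less)
  qed
qed

subsection \<open>No volume escapes to infinity\<close>

text \<open>The bound on the length of a test field in the Euclidean chart, as a function of the
  radius.\<close>

definition G :: "real \<Rightarrow> real" where
  "G r = g r * (h r / r) ^ (n - 1)"

lemma G_eq: "g (norm x) * \<mu> x = G (norm x)"
  by (simp add: G_def rvol_density_def)

lemma G_pos: "r > 0 \<Longrightarrow> G r > 0"
  using g_pos h_pos by (simp add: G_def)

lemma G_cont: "continuous_on {0<..} G"
  unfolding G_def by (intro continuous_intros h_cont continuous_on_subset[OF g_cont]) auto

text \<open>A tangential field of size 2 s |x| has Riemannian length at most 2 s h(r) <= 4
  \<epsilon>, so it exceeds the constraint at most by M = 8 \<epsilon> / G(a). The tangential
  estimate bounds Lebesgue measure by 4 M B, the volume density is at most c G <= 2 c G(a), and G(a)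
  cancels: 2 * 4 * 8 = 64.\<close>

lemma shell_estimate:
  assumes E[measurable]: "E \<in> sets borel" and a: "0 < a" "a < b" and \<epsilon>: "\<epsilon> > 0" and s8: "\<epsilon> / h a \<le> 1 / (8 * real n)"
    and slices: "AE x in (lborel :: 'a measure). x \<in> shell a b \<longrightarrow>
      (\<integral>\<^sup>+z. indicator {1-\<epsilon> / h a..1+\<epsilon> / h a} (norm z) * indicator (E \<inter> shell a b) (norm x *\<^sub>R sgn z) \<partial>lborel)
        \<le> ennreal (measure lborel (ball (0::'a) (\<epsilon> / h a)) / 2)"
    and osc: "\<And>r. a \<le> r \<Longrightarrow> r \<le> b \<Longrightarrow> G a / 2 \<le> G r \<and> G r \<le> 2 * G a \<and> h r \<le> 2 * h a"
    and per: "per_le E a b B"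
  shows "emeasure W (E \<inter> shell a b) \<le> ennreal (64 * c * \<epsilon> * B)"
proof -
  let ?S = "shell a b :: 'a set"
  define s where "s = \<epsilon> / h a"
  have ha: "h a > 0" using h_pos a by auto
  have Ga: "G a > 0" using G_pos a by auto
  have s: "s > 0" using ha \<epsilon> by (simp add: s_def)
  have sh: "s * h a = \<epsilon>" using ha by (simp add: s_def)
  define M where "M = 8 * \<epsilon> / G a"
  have M: "M > 0" using \<epsilon> Ga by (simp add: M_def)
  have meas: "measure lborel (E \<inter> ?S) \<le> 4 * (M * B)"
  proof (rule tangential_shell_estimate[OF E a(1) s _ slices[folded s_def]])
    show "s \<le> 1 / (8 * real DIM('a))" using s8 by (simp add: s_def)
    fix Y :: "'a \<Rightarrow> 'a" and K
    assume Y: "C1c_field Y" "compact K" "K \<subseteq> ?S" "\<And>x. x \<notin> K \<Longrightarrow> Y x = 0" "\<And>x. Y x \<bullet> x = 0"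
      "\<And>x. norm (Y x) \<le> 2 * s * norm x"
    have "flux E Y \<le> M * B"
    proof (rule per_le_scaled[OF per Y(1-3) _ M])
      show "x \<notin> K \<Longrightarrow> Y x = 0" for x by (rule Y(4))
      fix x assume x: "x \<in> K" "x \<noteq> 0"
      let ?r = "norm x"
      have r: "a \<le> ?r" "?r \<le> b" "?r > 0" using x Y(3) a by (auto simp: shell_def)
      have "rnorm h x (Y x) = h ?r / ?r * norm (Y x)" by (rule rnorm_tangential[OF Y(5) x(2)])
      also have "\<dots> \<le> h ?r / ?r * (2 * s * ?r)"
        using h_pos r(3) by (intro mult_left_mono Y(6)) (auto intro: less_imp_le)
      also have "\<dots> = 2 * s * h ?r" using r(3) by simp
      also have "\<dots> \<le> 2 * s * (2 * h a)" using osc[OF r(1,2)] s by (intro mult_left_mono) auto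
      also have "\<dots> = 4 * \<epsilon>" using sh by simp
      also have "\<dots> = M * (G a / 2)" using Ga by (simp add: M_def)
      also have "\<dots> \<le> M * G ?r" using osc[OF r(1,2)] M by (intro mult_left_mono) auto
      finally show "rnorm h x (Y x) \<le> M * (g ?r * \<mu> x)" unfolding G_eq .
    qed
    then show "(\<integral>x. indicator E x * divergence Y x \<partial>lborel) \<le> M * B" by (simp add: flux_def)
  qed
  have fin: "emeasure lborel (E \<inter> ?S) < \<infinity>"
    using emeasure_mono[of "E \<inter> ?S" ?S lborel] emeasure_shell_finite[of a b] by (auto intro: le_less_trans)
  have "emeasure W (E \<inter> ?S) = (\<integral>\<^sup>+x. ennreal (f (norm x) * \<mu> x) * indicator (E \<inter> ?S) x \<partial>lborel)"
    unfolding W_def by (rule emeasure_density) measurable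
  also have "\<dots> \<le> (\<integral>\<^sup>+x. ennreal (2 * c * G a) * indicator (E \<inter> ?S) x \<partial>lborel)"
  proof (rule nn_integral_mono)
    fix x :: 'a
    show "ennreal (f (norm x) * \<mu> x) * indicator (E \<inter> ?S) x \<le> ennreal (2 * c * G a) * indicator (E \<inter> ?S) x"
    proof (cases "x \<in> E \<inter> ?S")
      case True
      then have r: "a \<le> norm x" "norm x \<le> b" by (auto simp: shell_def)
      have "f (norm x) * \<mu> x \<le> (c * g (norm x)) * \<mu> x" using fg rvol_nonneg by (intro mult_right_mono) auto
      also have "\<dots> = c * G (norm x)" by (simp add: G_eq[symmetric])
      also have "\<dots> \<le> c * (2 * G a)" using osc[OF r] c_pos by (intro mult_left_mono) auto
      finally show ?thesis using True by (simp add: ennreal_leI mult_ac)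
    qed simp
  qed
  also have "\<dots> = ennreal (2 * c * G a) * ennreal (measure lborel (E \<inter> ?S))"
    using fin by (subst nn_integral_cmult_indicator) (auto simp: emeasure_eq_ennreal_measure less_top)
  also have "\<dots> = ennreal (2 * c * G a * measure lborel (E \<inter> ?S))"
    by (rule ennreal_mult[symmetric]) (use c_pos Ga in auto)
  also have "\<dots> \<le> ennreal (2 * c * G a * (4 * (M * B)))"
    using meas c_pos Ga by (intro ennreal_leI mult_left_mono) auto
  also have "2 * c * G a * (4 * (M * B)) = 64 * c * \<epsilon> * B" using Ga by (simp add: M_def)
  finally show ?thesis .
qed

lemma flux_add:
  assumes "E \<in> sets borel" "C1c_field Y" "C1c_field Z"
  shows "flux E (\<lambda>x. Y x + Z x) = flux E Y + flux E Z"
  unfolding flux_def C1c_field_add(2)[OF assms(2,3)] distrib_left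
  by (rule Bochner_Integration.integral_add[OF integrable_divergence[OF assms(2,1)] integrable_divergence[OF assms(3,1)]])

text \<open>The supports lie in disjoint open shells, so at each point at most one summand is
  nonzero and the sum inherits the constraint.\<close>

lemma admissible_add:
  assumes "admissible a b Y" "admissible b d Z" "a \<le> b" "b \<le> d"
  shows "admissible a d (\<lambda>x. Y x + Z x)"
proof -
  obtain K where K: "compact K" "K \<subseteq> shell a b" "\<forall>x. x \<notin> K \<longrightarrow> Y x = 0" using assms(1) unfolding admissible_def by blast
  obtain J where J: "compact J" "J \<subseteq> shell b d" "\<forall>x. x \<notin> J \<longrightarrow> Z x = 0" using assms(2) unfolding admissible_def by blast
  have KJ: "x \<notin> K \<or> x \<notin> J" for x using K(2) J(2) by (force simp: shell_def)
  show ?thesis unfolding admissible_def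
  proof (intro conjI allI impI)
    show "C1c_field (\<lambda>x. Y x + Z x)"
      using assms(1,2) unfolding admissible_def by (blast intro: C1c_field_add(1))
    have "K \<union> J \<subseteq> shell a d" using K(2) J(2) assms(3,4) by (fastforce simp: shell_def)
    then show "\<exists>K. compact K \<and> K \<subseteq> shell a d \<and> (\<forall>x. x \<notin> K \<longrightarrow> Y x + Z x = 0)"
      using K J by (intro exI[of _ "K \<union> J"]) (auto intro: compact_Un)
    fix x :: 'a assume "x \<noteq> 0"
    then show "rnorm h x (Y x + Z x) \<le> g (norm x) * \<mu> x"
      using KJ[of x] K(3) J(3) assms(1,2) unfolding admissible_def by fastforce
  qed
qed

text \<open>The bound on fluxes is superadditive over adjacent shells, so a volume bound which is linear
  in it only has to be checked on thin shells.\<close>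

lemma per_le_split:
  assumes E: "E \<in> sets borel" and per: "per_le E a d B" and ab: "a \<le> b" "b \<le> d"
  obtains B1 where "per_le E a b B1" "per_le E b d (B - B1)"
proof -
  let ?F = "flux E ` {Y. admissible a b Y}"
  have ne: "?F \<noteq> {}" using admissible_zero by blast
  have bd: "bdd_above ?F"
    using per_le_subset[OF per order_refl ab(2)] by (auto simp: per_le_def bdd_above_def)
  define B1 where "B1 = Sup ?F"
  show ?thesis
  proof (rule that[of B1])
    show "per_le E a b B1" unfolding per_le_def B1_def using bd by (auto intro: cSup_upper)
    show "per_le E b d (B - B1)" unfolding per_le_def
    proof (intro allI impI)
      fix Z assume Z: "admissible b d Z"
      \<comment> \<open>Every inner field can be added to the one outer field Z, so the flux of Z is
        deducted from B uniformly over the inner fields.\<close>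
      have "B1 \<le> B - flux E Z" unfolding B1_def
      proof (rule cSup_least[OF ne])
        fix y assume "y \<in> ?F"
        then obtain Y where Y: "admissible a b Y" "y = flux E Y" by auto
        have "flux E (\<lambda>x. Y x + Z x) \<le> B" using per admissible_add[OF Y(1) Z ab] by (simp add: per_le_def)
        moreover have "flux E (\<lambda>x. Y x + Z x) = y + flux E Z"
          unfolding Y(2) by (rule flux_add[OF E]) (use Y Z in \<open>auto simp: admissible_def\<close>)
        ultimately show "y \<le> B - flux E Z" by simp
      qed
      then show "flux E Z \<le> B - B1" by simp
    qed
  qed
qed

text \<open>Cutting a shell at an intermediate radius loses no volume.\<close>

lemma W_sphere: "emeasure W {x. norm x = r} = 0"
proof -
  have "sphere (0::'a) r \<in> null_sets lborel"
    using negligible_sphere[of "0::'a" r] by (auto simp: null_sets_completion_iff negligible_iff_null_sets)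
  moreover have "sphere (0::'a) r = {x. norm x = r}" by auto
  ultimately have "{x::'a. norm x = r} \<in> null_sets lborel" by simp
  then have "AE x in lborel. norm (x::'a) \<noteq> r" using AE_not_in by fastforce
  then have "(\<integral>\<^sup>+x. ennreal (f (norm x) * \<mu> x) * indicator {x. norm x = r} x \<partial>lborel) = (\<integral>\<^sup>+x. 0 \<partial>(lborel :: 'a measure))"
    by (intro nn_integral_cong_AE) (auto elim!: eventually_mono)
  then show ?thesis unfolding W_def by (subst emeasure_density) auto
qed

lemma locally_comparable:
  fixes u :: "real \<Rightarrow> real"
  assumes "continuous_on {0<..} u" "\<And>r. r > 0 \<Longrightarrow> u r > (0::real)" "x > 0"
  shows "\<exists>d>0. \<forall>r s. \<bar>r - x\<bar> < d \<and> \<bar>s - x\<bar> < d \<longrightarrow> u r \<le> 2 * u s"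
proof -
  have "isCont u x" using assms(1,3) by (simp add: continuous_on_eq_continuous_at)
  then obtain d where d: "d > 0" "\<And>r. \<bar>r - x\<bar> < d \<Longrightarrow> \<bar>u r - u x\<bar> < u x / 4"
    using assms(2)[OF assms(3)] unfolding continuous_at_eps_delta dist_real_def
    by (metis divide_pos_pos zero_less_numeral)
  have "u r \<le> 2 * u s" if "\<bar>r - x\<bar> < d" "\<bar>s - x\<bar> < d" for r s
    using d(2)[OF that(1)] d(2)[OF that(2)] assms(2)[OF assms(3)] by linarith
  then show ?thesis using d(1) by blast
qed

text \<open>R is found before E, so it serves a whole minimizing sequence. Shells thin enough for G
  and h to be nearly constant satisfy the bound of \<open>shell_estimate\<close>, and bisection
  glues them: \<open>per_le_split\<close> shares B between the pieces, and a bound linear in B adds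
  up however many pieces there are.\<close>

lemma tail_infinite_volume:
  assumes inf: "emeasure W UNIV = \<infinity>" and C: "C > 0" and V: "0 \<le> V" and \<eta>: "\<eta> > 0"
  shows "\<exists>R>0. \<forall>E\<in>sets borel. emeasure W E \<le> ennreal V \<longrightarrow> (\<forall>b. per_le E 0 b C) \<longrightarrow>
    emeasure W (E \<inter> {x. R < norm x}) \<le> ennreal \<eta>"
proof -
  define w where "w = unit_ball_vol (real n)"
  have w: "w > 0" by (simp add: w_def)
  have n0: "real n > 0" using dim by simp
  have h1: "h 1 > 0" using h_pos by auto
  obtain k where k: "k > 0" "\<And>s. 0 < s \<Longrightarrow> s \<le> 1/2 \<Longrightarrow>
    (\<integral>\<^sup>+v. indicator {1-s..1+s} (1 / norm v) * ennreal (inverse (norm v) ^ (2 * n)) \<partial>(lborel :: 'a measure)) \<le> ennreal (k * s)"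
    using spherical_average_constant_le[where 'a = 'a, unfolded dim_n] by blast
  \<comment> \<open>The first bound gives s = \<epsilon> / h(a) <= 1 / (8 n) for every a >= 1, since
    h(a) >= h(1); the second gives 64 c \<epsilon> C <= \<eta>.\<close>
  define \<epsilon> where "\<epsilon> = min (h 1 / (8 * real n)) (\<eta> / (64 * c * C))"
  have \<epsilon>: "\<epsilon> > 0" unfolding \<epsilon>_def using h1 n0 \<eta> c_pos C by simp
  have \<epsilon>\<eta>: "64 * c * \<epsilon> * C \<le> \<eta>"
  proof -
    have "\<epsilon> \<le> \<eta> / (64 * c * C)" by (simp add: \<epsilon>_def)
    then show ?thesis using c_pos C by (simp add: field_simps)
  qed
  \<comment> \<open>Solves k s C / (m h(a)^(n-1)) < w s^n \<kappa> / 2 with a factor 2 to spare.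
    Because s h(a) = \<epsilon>, the value does not depend on a.\<close>
  define m where "m = 4 * k * C / (w * \<kappa> * \<epsilon> ^ (n - 1))"
  have den: "w * \<kappa> * \<epsilon> ^ (n - 1) > 0"
    by (rule mult_pos_pos[OF mult_pos_pos[OF w \<kappa>_pos] zero_less_power[OF \<epsilon>]])
  have m: "m > 0" unfolding m_def by (rule divide_pos_pos[OF _ den]) (use k C in auto)
  have "eventually (\<lambda>r. m \<le> g r) at_top" using g_inf by (simp add: filterlim_at_top)
  then obtain R1 where R1: "\<And>r. R1 \<le> r \<Longrightarrow> m \<le> g r" by (auto simp: eventually_at_top_linorder)
  define R where "R = max 1 R1"
  have R: "R \<ge> 1" "\<And>r. R \<le> r \<Longrightarrow> m \<le> g r" using R1 by (auto simp: R_def)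
  show ?thesis
  proof (intro exI[of _ R] conjI ballI impI)
    show "R > 0" using R by simp
    fix E :: "'a set" assume E[measurable]: "E \<in> sets borel" and EV: "emeasure W E \<le> ennreal V" and per': "\<forall>b. per_le E 0 b C"
    then have per: "\<And>b. per_le E 0 b C" by blast
    \<comment> \<open>B is quantified inside P because gluing applies it on the subshells with the
      two shares of B. The premise on a lets P be stated for arbitrary intervals, as bisection
      demands.\<close>
    define P where "P a b \<longleftrightarrow> (R \<le> a \<longrightarrow> (\<forall>B. per_le E a b B \<longrightarrow> emeasure W (E \<inter> shell a b) \<le> ennreal (64 * c * \<epsilon> * B)))" for a b
    have thin: "emeasure W (E \<inter> shell a b) \<le> ennreal (64 * c * \<epsilon> * B)"
      if ab: "R \<le> a" "a < b" and osc: "\<And>r. a \<le> r \<Longrightarrow> r \<le> b \<Longrightarrow> G a / 2 \<le> G r \<and> G r \<le> 2 * G a \<and> h r \<le> 2 * h a"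
        and perB: "per_le E a b B" for a b B
    proof -
      have a0: "0 < a" using ab R by simp
      have ha: "h a \<ge> h 1" "h a > 0" using h_le[of 1 a] ab R h1 by auto
      define s where "s = \<epsilon> / h a"
      have s0: "s > 0" using \<epsilon> ha by (simp add: s_def)
      have s8: "s \<le> 1 / (8 * real n)"
      proof -
        have "s \<le> \<epsilon> / h 1" unfolding s_def using \<epsilon> ha h1 by (intro divide_left_mono) auto
        also have "\<dots> \<le> (h 1 / (8 * real n)) / h 1" using h1 by (intro divide_right_mono) (auto simp: \<epsilon>_def)
        also have "\<dots> = 1 / (8 * real n)" using h1 by simp
        finally show ?thesis .
      qed
      have s2: "s \<le> 1/2"
      proof -
        have "1 / (8 * real n) \<le> 1 / 2" using dim by (intro divide_left_mono) auto
        then show ?thesis using s8 by linarith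
      qed
      define c1 where "c1 = measure lborel (ball (0::'a) s) / 2"
      have c1: "c1 = w * s ^ n / 2" unfolding c1_def w_def using s0 by (simp add: content_ball)
      have small: "(k * s) * (C / (m * h a ^ (n - 1))) < c1 * \<kappa>"
      proof -
        have sn: "s ^ n = s * s ^ (n - 1)" using dim by (metis Suc_diff_1 less_le_trans pos2 power_Suc)
        have sh: "s ^ (n - 1) * h a ^ (n - 1) = \<epsilon> ^ (n - 1)"
          using ha by (simp add: s_def power_mult_distrib[symmetric])
        have mm: "m * (w * \<kappa> * \<epsilon> ^ (n - 1)) = 4 * k * C"
          unfolding m_def times_divide_eq_left
          by (rule nonzero_mult_div_cancel_right) (use den in linarith)
        have "k * C * 2 < 4 * k * C" using k C by simp
        then have "k * C * 2 < w * \<kappa> * (s ^ (n - 1) * h a ^ (n - 1)) * m" unfolding sh using mm by (simp add: mult_ac)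
        then have "k * C * 2 < w * \<kappa> * s ^ (n - 1) * (m * h a ^ (n - 1))" by (simp only: mult_ac)
        then have "k * C * 2 / (m * h a ^ (n - 1)) < w * \<kappa> * s ^ (n - 1)"
          using m ha by (simp add: divide_less_eq)
        then have "s / 2 * (k * C * 2 / (m * h a ^ (n - 1))) < s / 2 * (w * \<kappa> * s ^ (n - 1))"
          using s0 by (intro mult_strict_left_mono) auto
        then show ?thesis unfolding c1 sn by (simp add: mult_ac)
      qed
      have "AE x in (lborel :: 'a measure). x \<in> shell a b \<longrightarrow>
        (\<integral>\<^sup>+z. indicator {1-s..1+s} (norm z) * indicator (E \<inter> shell a b) (norm x *\<^sub>R sgn z) \<partial>lborel) \<le> ennreal c1"
        by (rule slices_small[OF E EV V inf per a0 ab(2) m _ s0 s2 k(2)[OF s0 s2] _ _ small])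
           (use R ab k s0 w in \<open>auto simp: c1\<close>)
      then show ?thesis unfolding c1_def s_def
        using shell_estimate[OF E a0 ab(2) \<epsilon> s8[unfolded s_def] _ osc perB] by blast
    qed
    \<comment> \<open>The local step of the bisection also admits intervals with a = b.\<close>
    have empty: "emeasure W (E \<inter> shell a b) \<le> ennreal (64 * c * \<epsilon> * B)" if "b \<le> a" for a b B
    proof -
      have "shell a b = ({} :: 'a set)" using that by (auto simp: shell_def)
      then show ?thesis by simp
    qed
    have PR: "P R b" if "R \<le> b" for b
      using that
    proof (induction rule: Bolzano)
      case (trans a b d)
      show ?case unfolding P_def
      proof (intro impI allI)
        fix B assume Ra: "R \<le> a" and perB: "per_le E a d B"
        obtain B1 where B1: "per_le E a b B1" "per_le E b d (B - B1)"
          using per_le_split[OF E perB trans(3,4)] by blast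
        have "E \<inter> shell a d \<subseteq> (E \<inter> shell a b \<union> E \<inter> shell b d) \<union> {x. norm x = b}" by (auto simp: shell_def)
        then have "emeasure W (E \<inter> shell a d) \<le> emeasure W ((E \<inter> shell a b \<union> E \<inter> shell b d) \<union> {x. norm x = b})"
          by (rule emeasure_mono) measurable
        also have "\<dots> \<le> emeasure W (E \<inter> shell a b \<union> E \<inter> shell b d) + emeasure W {x. norm x = b}"
          by (rule emeasure_subadditive) measurable
        also have "\<dots> \<le> emeasure W (E \<inter> shell a b) + emeasure W (E \<inter> shell b d)"
          unfolding W_sphere by (simp, rule emeasure_subadditive) measurable
        also have "\<dots> \<le> ennreal (64 * c * \<epsilon> * B1) + ennreal (64 * c * \<epsilon> * (B - B1))"
          using trans(1,2) Ra trans(3) B1 unfolding P_def by (intro add_mono) auto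
        also have "\<dots> = ennreal (64 * c * \<epsilon> * B1 + 64 * c * \<epsilon> * (B - B1))"
          using per_le_nonneg[OF B1(1)] per_le_nonneg[OF B1(2)] c_pos \<epsilon>
          by (intro ennreal_plus[symmetric] mult_nonneg_nonneg) auto
        also have "64 * c * \<epsilon> * B1 + 64 * c * \<epsilon> * (B - B1) = 64 * c * \<epsilon> * B" by (simp add: algebra_simps)
        finally show "emeasure W (E \<inter> shell a d) \<le> ennreal (64 * c * \<epsilon> * B)" .
      qed
    next
      case (local x)
      then have x: "x > 0" using R by simp
      obtain d1 where d1: "d1 > 0" "\<And>r s. \<bar>r - x\<bar> < d1 \<Longrightarrow> \<bar>s - x\<bar> < d1 \<Longrightarrow> G r \<le> 2 * G s"
        using locally_comparable[OF G_cont G_pos x] by blast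
      obtain d2 where d2: "d2 > 0" "\<And>r s. \<bar>r - x\<bar> < d2 \<Longrightarrow> \<bar>s - x\<bar> < d2 \<Longrightarrow> h r \<le> 2 * h s"
        using locally_comparable[OF h_cont _ x] h_pos by blast
      show ?case
      proof (intro exI[of _ "min d1 d2"] conjI allI impI)
        show "0 < min d1 d2" using d1 d2 by simp
        fix a b assume ab: "a \<le> x \<and> x \<le> b \<and> b - a < min d1 d2"
        show "P a b" unfolding P_def
        proof (intro impI allI)
          fix B assume Ra: "R \<le> a" and perB: "per_le E a b B"
          show "emeasure W (E \<inter> shell a b) \<le> ennreal (64 * c * \<epsilon> * B)"
          proof (cases "a < b")
            case True
            show ?thesis
            proof (rule thin[OF Ra True _ perB])
              fix r assume r: "a \<le> r" "r \<le> b"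
              have near: "\<bar>r - x\<bar> < d" "\<bar>a - x\<bar> < d" if "b - a < d" for d
                using that ab r by (auto simp: abs_less_iff)
              have "b - a < d1" "b - a < d2" using ab by auto
              note near[OF this(1)] near[OF this(2)]
              then show "G a / 2 \<le> G r \<and> G r \<le> 2 * G a \<and> h r \<le> 2 * h a"
                using d1(2)[of a r] d1(2)[of r a] d2(2)[of r a] by auto
            qed
          qed (use empty in auto)
        qed
      qed
    qed
    have bound: "emeasure W (E \<inter> shell R b) \<le> ennreal \<eta>" for b
    proof (cases "R \<le> b")
      case True
      have "per_le E R b C" using per_le_subset[OF per, of R b b] R by auto
      then have "emeasure W (E \<inter> shell R b) \<le> ennreal (64 * c * \<epsilon> * C)" using PR[OF True] by (simp add: P_def)
      also have "\<dots> \<le> ennreal \<eta>" using \<epsilon>\<eta> by (rule ennreal_leI)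
      finally show ?thesis .
    next
      case False
      then have "shell R b = ({} :: 'a set)" by (auto simp: shell_def)
      then show ?thesis by simp
    qed
    have "(SUP i. emeasure W (E \<inter> shell R (real i))) = emeasure W (\<Union>i. E \<inter> shell R (real i))"
    proof (rule SUP_emeasure_incseq)
      have "E \<inter> shell R (real i) \<in> sets W" for i by measurable
      then show "range (\<lambda>i. E \<inter> shell R (real i)) \<subseteq> sets W" by blast
      show "incseq (\<lambda>i. E \<inter> shell R (real i))" by (auto simp: incseq_def shell_def)
    qed
    moreover have "(\<Union>i. E \<inter> shell R (real i)) = E \<inter> {x. R < norm x}"
      using reals_Archimedean2 by (auto simp: shell_def)
    ultimately show "emeasure W (E \<inter> {x. R < norm x}) \<le> ennreal \<eta>"
      using SUP_least[of UNIV "\<lambda>i. emeasure W (E \<inter> shell R (real i))" "ennreal \<eta>"] bound by simp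
  qed
qed

end

subsection \<open>Compactness\<close>

text \<open>The symmetric difference of E and its translate by - v; its measure is the L1 distance
  of their indicators.\<close>

definition osc_set :: "'a::euclidean_space set \<Rightarrow> 'a \<Rightarrow> 'a set" where
  "osc_set E v = {x. (x \<in> E) \<noteq> (x + v \<in> E)}"

lemma osc_set_measurable [measurable]:
  assumes [measurable]: "E \<in> sets (borel :: 'a::euclidean_space measure)"
  shows "osc_set E v \<in> sets borel"
  unfolding osc_set_def by measurable

definition ball_avg :: "'a::euclidean_space set \<Rightarrow> real \<Rightarrow> 'a \<Rightarrow> real" where
  "ball_avg E \<delta> x = measure lborel (E \<inter> ball x \<delta>) / measure lborel (ball (0::'a) \<delta>)"

lemma measure_ball_translate:
  "0 \<le> \<delta> \<Longrightarrow> measure lborel (ball (x::'a::euclidean_space) \<delta>) = measure lborel (ball (0::'a) \<delta>)"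
  by (simp add: content_ball)

lemma emeasure_ball_finite: "emeasure lborel (ball (x::'a::euclidean_space) \<delta>) < \<infinity>"
  by (rule emeasure_bounded_finite) simp

lemma emeasure_Int_ball_translate:
  fixes E :: "'a::euclidean_space set"
  assumes [measurable]: "E \<in> sets borel"
  shows "emeasure lborel {v \<in> ball 0 \<delta>. x + v \<in> E} = emeasure lborel (E \<inter> ball x \<delta>)"
proof -
  have [measurable]: "ball x \<delta> \<in> sets borel" "ball (0::'a) \<delta> \<in> sets borel" by simp_all
  have "emeasure lborel {v \<in> ball 0 \<delta>. x + v \<in> E} = (\<integral>\<^sup>+v. indicator {v \<in> ball 0 \<delta>. x + v \<in> E} v \<partial>lborel)"
    by (rule nn_integral_indicator[symmetric]) measurable
  also have "\<dots> = (\<integral>\<^sup>+v. indicator (E \<inter> ball x \<delta>) (x + v) \<partial>lborel)"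
    by (rule nn_integral_cong) (auto simp: indicator_def dist_norm)
  also have "\<dots> = (\<integral>\<^sup>+v. indicator (E \<inter> ball x \<delta>) v \<partial>lborel)"
    by (rule nn_integral_translate) measurable
  also have "\<dots> = emeasure lborel (E \<inter> ball x \<delta>)" by (rule nn_integral_indicator) measurable
  finally show ?thesis .
qed

text \<open>For fixed x the difference of the indicator at x and at x + v never changes sign as v
  varies, so taking absolute values commutes with averaging over the ball.\<close>

lemma ball_avg_deviation:
  fixes E :: "'a::euclidean_space set"
  assumes E[measurable]: "E \<in> sets borel" and \<delta>: "0 < \<delta>"
  shows "ennreal (measure lborel (ball (0::'a) \<delta>) * \<bar>indicator E x - ball_avg E \<delta> x\<bar>)
    = emeasure lborel {v \<in> ball 0 \<delta>. x \<in> osc_set E v}"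
proof -
  have [measurable]: "ball x \<delta> \<in> sets borel" "ball (0::'a) \<delta> \<in> sets borel" by simp_all
  let ?w = "measure lborel (ball (0::'a) \<delta>)"
  have w: "?w > 0" using \<delta> by (simp add: content_ball)
  have fin: "emeasure lborel (A \<inter> ball x \<delta>) < \<infinity>" if "A \<in> sets borel" for A
    using emeasure_mono[of "A \<inter> ball x \<delta>" "ball x \<delta>" lborel] emeasure_ball_finite[of x \<delta>] by (auto intro: le_less_trans)
  have eq: "emeasure lborel (A \<inter> ball x \<delta>) = ennreal (measure lborel (A \<inter> ball x \<delta>))" if "A \<in> sets borel" for A
    using fin[OF that] by (simp add: emeasure_eq_ennreal_measure less_top)
  have avg: "?w * ball_avg E \<delta> x = measure lborel (E \<inter> ball x \<delta>)" using w by (simp add: ball_avg_def)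
  show ?thesis
  proof (cases "x \<in> E")
    case False
    then have st: "{v \<in> ball 0 \<delta>. x \<in> osc_set E v} = {v \<in> ball 0 \<delta>. x + v \<in> E}" by (auto simp: osc_set_def)
    have v: "?w * \<bar>indicator E x - ball_avg E \<delta> x\<bar> = measure lborel (E \<inter> ball x \<delta>)"
      using False w avg by (simp add: ball_avg_def)
    show ?thesis unfolding st v emeasure_Int_ball_translate[OF E] by (rule eq[OF E, symmetric])
  next
    case True
    then have 1: "{v \<in> ball 0 \<delta>. x \<in> osc_set E v} = {v \<in> ball 0 \<delta>. x + v \<in> - E}" by (auto simp: osc_set_def)
    have "ball x \<delta> = (E \<inter> ball x \<delta>) \<union> (- E \<inter> ball x \<delta>)" by auto
    then have "measure lborel (ball x \<delta>) = measure lborel ((E \<inter> ball x \<delta>) \<union> (- E \<inter> ball x \<delta>))" by simp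
    also have "\<dots> = measure lborel (E \<inter> ball x \<delta>) + measure lborel (- E \<inter> ball x \<delta>)"
      by (rule measure_Union) (use fin[of E] fin[of "- E"] in auto)
    finally have "?w = measure lborel (E \<inter> ball x \<delta>) + measure lborel (- E \<inter> ball x \<delta>)"
      using measure_ball_translate[of \<delta> x] \<delta> by simp
    then have 2: "?w * (1 - ball_avg E \<delta> x) = measure lborel (- E \<inter> ball x \<delta>)"
      using avg by (simp add: right_diff_distrib)
    then have "0 \<le> ?w * (1 - ball_avg E \<delta> x)" by simp
    then have "0 \<le> 1 - ball_avg E \<delta> x" using w by (simp add: zero_le_mult_iff)
    then have v: "?w * \<bar>indicator E x - ball_avg E \<delta> x\<bar> = measure lborel (- E \<inter> ball x \<delta>)"
      using True 2 by simp
    have E': "- E \<in> sets borel" using E by (rule borel_comp)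
    show ?thesis unfolding 1 v emeasure_Int_ball_translate[OF E'] by (rule eq[OF E', symmetric])
  qed
qed

lemma ball_avg_bounds: "0 < \<delta> \<Longrightarrow> E \<in> sets borel \<Longrightarrow> 0 \<le> ball_avg E \<delta> x \<and> ball_avg E \<delta> (x::'a::euclidean_space) \<le> 1"
proof -
  assume a: "0 < \<delta>" "E \<in> sets borel"
  have "measure lborel (E \<inter> ball x \<delta>) \<le> measure lborel (ball x \<delta>)"
    by (rule measure_mono_fmeasurable) (use a emeasure_ball_finite[of x \<delta>] in \<open>auto simp: fmeasurable_def\<close>)
  then show ?thesis using a measure_ball_translate[of \<delta> x] by (simp add: ball_avg_def content_ball divide_le_eq)
qed

lemma ball_avg_measurable [measurable]:
  assumes E[measurable]: "E \<in> sets (borel :: 'a::euclidean_space measure)"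
  shows "ball_avg E \<delta> \<in> borel_measurable borel"
proof -
  have "{z. snd z \<in> E \<inter> ball (fst z) \<delta>} = {z \<in> space (borel \<Otimes>\<^sub>M lborel). snd z \<in> E \<and> dist (fst z) (snd z) < \<delta>}"
    by (auto simp: space_pair_measure)
  also have "\<dots> \<in> sets (borel \<Otimes>\<^sub>M lborel)" by measurable
  finally have "(\<lambda>x. emeasure lborel (Pair x -` {z. snd z \<in> E \<inter> ball (fst z) \<delta>})) \<in> borel_measurable borel"
    by (rule lborel.measurable_emeasure_Pair)
  moreover have P: "Pair x -` {z. snd z \<in> E \<inter> ball (fst z) \<delta>} = E \<inter> ball x \<delta>" for x by auto
  ultimately have "(\<lambda>x. emeasure lborel (E \<inter> ball x \<delta>)) \<in> borel_measurable borel" by (simp only: P)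
  then show ?thesis unfolding ball_avg_def[abs_def] measure_def by measurable
qed

text \<open>What lies in the ball around y but not in the one around x lies in an annulus of width
  \<tau>. The resulting modulus of continuity does not involve E, which is the equicontinuity of the
  averages along a sequence of sets.\<close>

lemma ball_avg_close:
  fixes E :: "'a::euclidean_space set"
  assumes \<delta>: "0 < \<delta>" and E: "E \<in> sets borel" and d: "dist x y < \<tau>"
  shows "ball_avg E \<delta> y \<le> ball_avg E \<delta> x + ((\<delta> + \<tau>) ^ DIM('a) - \<delta> ^ DIM('a)) / \<delta> ^ DIM('a)"
proof -
  let ?n = "DIM('a)" and ?u = "unit_ball_vol (real DIM('a))"
  have \<tau>: "\<tau> > 0" using d zero_le_dist[of x y] by linarith
  have fm: "A \<in> sets borel \<Longrightarrow> A \<inter> ball z s \<in> fmeasurable lborel" for A z and s :: real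
    using emeasure_mono[of "A \<inter> ball z s" "ball z s" lborel] emeasure_ball_finite[of z s]
    by (auto simp: fmeasurable_def intro: le_less_trans)
  have sub: "E \<inter> ball y \<delta> \<subseteq> (E \<inter> ball x \<delta>) \<union> (ball x (\<delta> + \<tau>) - ball x \<delta>)"
  proof
    fix z assume z: "z \<in> E \<inter> ball y \<delta>"
    have "dist x z \<le> dist x y + dist y z" by (rule dist_triangle)
    then show "z \<in> (E \<inter> ball x \<delta>) \<union> (ball x (\<delta> + \<tau>) - ball x \<delta>)" using z d by auto
  qed
  have fd: "ball x (\<delta> + \<tau>) - ball x \<delta> \<in> fmeasurable lborel"
    using fm[of UNIV x "\<delta> + \<tau>"] by (intro fmeasurable_Diff) auto
  have "measure lborel (E \<inter> ball y \<delta>) \<le> measure lborel ((E \<inter> ball x \<delta>) \<union> (ball x (\<delta> + \<tau>) - ball x \<delta>))"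
    by (rule measure_mono_fmeasurable[OF sub]) (use fm[OF E] fd E in auto)
  also have "\<dots> \<le> measure lborel (E \<inter> ball x \<delta>) + measure lborel (ball x (\<delta> + \<tau>) - ball x \<delta>)"
    by (rule measure_Un_le) (use E in auto)
  also have "measure lborel (ball x (\<delta> + \<tau>) - ball x \<delta>) = measure lborel (ball x (\<delta> + \<tau>)) - measure lborel (ball x \<delta>)"
    by (rule measurable_measure_Diff) (use fm[of UNIV x "\<delta> + \<tau>"] \<tau> in auto)
  also have "\<dots> = ?u * ((\<delta> + \<tau>) ^ ?n - \<delta> ^ ?n)"
    using \<delta> \<tau> by (simp add: content_ball right_diff_distrib)
  finally have "measure lborel (E \<inter> ball y \<delta>) \<le> measure lborel (E \<inter> ball x \<delta>) + ?u * ((\<delta> + \<tau>) ^ ?n - \<delta> ^ ?n)" .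
  then have "measure lborel (E \<inter> ball y \<delta>) / (?u * \<delta> ^ ?n) \<le> (measure lborel (E \<inter> ball x \<delta>) + ?u * ((\<delta> + \<tau>) ^ ?n - \<delta> ^ ?n)) / (?u * \<delta> ^ ?n)"
    using \<delta> by (intro divide_right_mono) auto
  also have "\<dots> = measure lborel (E \<inter> ball x \<delta>) / (?u * \<delta> ^ ?n) + ((\<delta> + \<tau>) ^ ?n - \<delta> ^ ?n) / \<delta> ^ ?n"
  proof -
    have "?u \<noteq> 0" using unit_ball_vol_pos[of "real ?n"] by linarith
    then show ?thesis by (simp add: add_divide_distrib)
  qed
  finally show ?thesis using \<delta> by (simp add: ball_avg_def content_ball)
qed

lemma ball_avg_convergent:
  fixes E :: "nat \<Rightarrow> 'a::euclidean_space set"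
  assumes E: "\<And>k. E k \<in> sets borel" and \<delta>: "0 < \<delta>"
    and dense: "\<And>x e. 0 < e \<Longrightarrow> \<exists>y\<in>D. dist x y < e"
    and conv: "\<And>y. y \<in> D \<Longrightarrow> convergent (\<lambda>k. ball_avg (E k) \<delta> y)"
  shows "convergent (\<lambda>k. ball_avg (E k) \<delta> x)"
proof (rule Cauchy_convergent, rule CauchyI)
  fix e :: real assume e: "0 < e"
  let ?n = "DIM('a)"
  have "((\<lambda>\<tau>. ((\<delta> + \<tau>) ^ ?n - \<delta> ^ ?n) / \<delta> ^ ?n) \<longlongrightarrow> ((\<delta> + 0) ^ ?n - \<delta> ^ ?n) / \<delta> ^ ?n) (at_right 0)"
    using \<delta> by (intro tendsto_intros) auto
  then have "((\<lambda>\<tau>. ((\<delta> + \<tau>) ^ ?n - \<delta> ^ ?n) / \<delta> ^ ?n) \<longlongrightarrow> 0) (at_right 0)" by simp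
  then have "eventually (\<lambda>\<tau>. ((\<delta> + \<tau>) ^ ?n - \<delta> ^ ?n) / \<delta> ^ ?n < e / 3) (at_right 0)"
    by (rule order_tendstoD) (use e in simp)
  then obtain \<tau>0 where \<tau>0: "\<tau>0 > 0" "\<And>\<tau>. 0 < \<tau> \<Longrightarrow> \<tau> < \<tau>0 \<Longrightarrow> ((\<delta> + \<tau>) ^ ?n - \<delta> ^ ?n) / \<delta> ^ ?n < e / 3"
    by (auto simp: eventually_at_right_field)
  define \<tau> where "\<tau> = \<tau>0 / 2"
  have \<tau>: "\<tau> > 0" "((\<delta> + \<tau>) ^ ?n - \<delta> ^ ?n) / \<delta> ^ ?n < e / 3" using \<tau>0 by (auto simp: \<tau>_def)
  obtain y where y: "y \<in> D" "dist x y < \<tau>" using dense[OF \<tau>(1)] by blast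
  have close: "\<bar>ball_avg (E k) \<delta> x - ball_avg (E k) \<delta> y\<bar> < e / 3" for k
    using ball_avg_close[OF \<delta> E y(2), of k] ball_avg_close[OF \<delta> E y(2)[unfolded dist_commute[of x y]], of k] \<tau>(2)
    by linarith
  have "Cauchy (\<lambda>k. ball_avg (E k) \<delta> y)" using conv[OF y(1)] by (rule convergent_Cauchy)
  then obtain N where N: "\<And>i j. i \<ge> N \<Longrightarrow> j \<ge> N \<Longrightarrow> norm (ball_avg (E i) \<delta> y - ball_avg (E j) \<delta> y) < e / 3"
    using CauchyD[of _ "e / 3"] e by (metis divide_pos_pos zero_less_numeral)
  show "\<exists>M. \<forall>m\<ge>M. \<forall>n\<ge>M. norm (ball_avg (E m) \<delta> x - ball_avg (E n) \<delta> x) < e"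
  proof (intro exI[of _ N] allI impI)
    fix i j assume "N \<le> i" "N \<le> j"
    then show "norm (ball_avg (E i) \<delta> x - ball_avg (E j) \<delta> x) < e"
      using N[of i j] close[of i] close[of j] unfolding real_norm_def by linarith
  qed
qed

text \<open>A Kolmogorov-Riesz argument: the averages over small balls are equicontinuous, so a diagonal
  subsequence of them converges everywhere, and they are close in mean to the indicator functions.\<close>

lemma set_sequence_compactness:
  fixes E :: "nat \<Rightarrow> 'a::euclidean_space set"
  assumes E: "\<And>k. E k \<in> sets borel"
    and osc: "\<And>a b. 0 < a \<Longrightarrow> a < b \<Longrightarrow> \<exists>D\<ge>0. \<forall>k v. norm v \<le> a / 2 \<longrightarrow>
      emeasure lborel (shell a b \<inter> osc_set (E k) v) \<le> ennreal (D * norm v)"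
  obtains r F where "strict_mono r" "F \<in> sets borel"
    "AE x in (lborel :: 'a measure). \<forall>\<^sub>F i in sequentially. x \<in> E (r i) \<longleftrightarrow> x \<in> F"
proof -
  note [measurable] = E
  obtain D :: "'a set" where D: "countable D" "\<And>X. open X \<Longrightarrow> X \<noteq> {} \<Longrightarrow> \<exists>d\<in>D. d \<in> X"
    using countable_dense_setE by blast
  have dense: "\<exists>y\<in>D. dist x y < e" if "0 < e" for x e
    using D(2)[of "ball x e"] that by auto
  define \<delta> where "\<delta> m = 1 / real (Suc m)" for m
  have \<delta>: "\<delta> m > 0" for m by (simp add: \<delta>_def)
  have cnt: "countable (D \<times> (UNIV :: nat set))" using D(1) by auto
  have bd: "norm (case z of (x, m) \<Rightarrow> ball_avg (E k) (\<delta> m) x) \<le> 1" for k z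
    using ball_avg_bounds[OF \<delta> E] by (auto split: prod.split)
  \<comment> \<open>A single diagonal extraction over all pairs of a centre in the dense set and a
    radius 1 / (m + 1).\<close>
  obtain r1 :: "nat \<Rightarrow> nat" where r1: "strict_mono r1"
    "\<And>z. z \<in> D \<times> UNIV \<Longrightarrow> \<exists>l. (\<lambda>k. case z of (x, m) \<Rightarrow> ball_avg (E (r1 k)) (\<delta> m) x) \<longlonglongrightarrow> l"
    using function_convergent_subsequence[OF cnt, of "\<lambda>k z. case z of (x, m) \<Rightarrow> ball_avg (E k) (\<delta> m) x" 1] bd by blast
  have conv: "convergent (\<lambda>k. ball_avg (E (r1 k)) (\<delta> m) x)" for m x
  proof (rule ball_avg_convergent[OF E \<delta> dense])
    show "convergent (\<lambda>k. ball_avg (E (r1 k)) (\<delta> m) y)" if "y \<in> D" for y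
      using r1(2)[of "(y, m)"] that by (auto simp: convergent_def)
  qed
  \<comment> \<open>The estimates hold only locally. A finite measure with the null sets of Lebesgue
    measure collects them in one L1 space, where a Cauchy sequence has an almost everywhere
    convergent subsequence.\<close>
  obtain hh :: "'a \<Rightarrow> real" where hh[measurable]: "hh \<in> borel_measurable lborel" and hp: "\<And>x. 0 < hh x" "\<And>x. hh x \<le> 1" "integrable lborel hh"
    using sigma_finite_measure.obtain_positive_integrable_function[OF lborel.sigma_finite_measure_axioms] by blast
  define M where "M = density lborel (\<lambda>x. ennreal (hh x))"
  have sM[measurable_cong, simp]: "sets M = sets borel" by (simp add: M_def)
  have spM[simp]: "space M = UNIV" by (simp add: M_def)
  have "emeasure M UNIV = ennreal (\<integral>x. hh x \<partial>lborel)"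
    unfolding M_def using hp by (subst emeasure_density) (auto simp: nn_integral_eq_integral less_imp_le)
  then have finM: "finite_measure M" by (intro finite_measureI) simp
  interpret M: finite_measure M by fact
  have Mle: "(\<integral>\<^sup>+x. u x \<partial>M) \<le> (\<integral>\<^sup>+x. u x \<partial>lborel)" if [measurable]: "u \<in> borel_measurable borel" for u
  proof -
    have "(\<integral>\<^sup>+x. u x \<partial>M) = (\<integral>\<^sup>+x. ennreal (hh x) * u x \<partial>lborel)" unfolding M_def by (rule nn_integral_density) measurable
    also have "\<dots> \<le> (\<integral>\<^sup>+x. 1 * u x \<partial>lborel)"
      by (intro nn_integral_mono mult_right_mono) (use hp in auto)
    finally show ?thesis by simp
  qed
  define s where "s i x = (indicator (E (r1 i)) x :: real)" for i x
  have [measurable]: "s i \<in> borel_measurable borel" for i unfolding s_def by measurable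
  have L1: "\<exists>N. \<forall>i\<ge>N. \<forall>j\<ge>N. (\<integral>x. norm (s i x - s j x) \<partial>M) < e" if e: "e > 0" for e
  proof -
    have "(SUP i. emeasure M (shell (1 / real (Suc i)) (real (Suc i)))) = emeasure M (\<Union>i. shell (1 / real (Suc i)) (real (Suc i)))"
    proof (rule SUP_emeasure_incseq)
      show "range (\<lambda>i. shell (1 / real (Suc i)) (real (Suc i))) \<subseteq> sets M" by auto
      show "incseq (\<lambda>i. shell (1 / real (Suc i)) (real (Suc i)) :: 'a set)"
        unfolding incseq_def shell_def
      proof (intro allI impI subsetI, clarify)
        fix i j :: nat and x :: 'a assume ij: "i \<le> j" and x: "1 / real (Suc i) < norm x" "norm x < real (Suc i)"
        have "1 / real (Suc j) \<le> 1 / real (Suc i)" using ij by (intro divide_left_mono) auto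
        then show "1 / real (Suc j) < norm x \<and> norm x < real (Suc j)" using x ij by auto
      qed
    qed
    moreover have un: "(\<Union>i. shell (1 / real (Suc i)) (real (Suc i))) = - {0::'a}"
    proof (intro set_eqI iffI)
      fix x :: 'a assume "x \<in> - {0}"
      then have x: "norm x > 0" by simp
      obtain i1 where i1: "inverse (real (Suc i1)) < norm x" using reals_Archimedean[OF x] by auto
      obtain i2 where i2: "norm x < real i2" using reals_Archimedean2 by auto
      have "1 / real (Suc (max i1 i2)) \<le> inverse (real (Suc i1))" unfolding inverse_eq_divide by (intro divide_left_mono) auto
      then have "x \<in> shell (1 / real (Suc (max i1 i2))) (real (Suc (max i1 i2)))"
        using i1 i2 by (auto simp: shell_def)
      then show "x \<in> (\<Union>i. shell (1 / real (Suc i)) (real (Suc i)))" by blast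
    qed (auto simp: shell_def)
    moreover have "emeasure M (- {0}) = emeasure M UNIV"
    proof -
      have "AE x in M. x \<noteq> 0" unfolding M_def by (subst AE_density) (use AE_lborel_singleton[of "0::'a"] in \<open>auto elim: eventually_mono\<close>)
      then show ?thesis by (intro emeasure_eq_AE) auto
    qed
    ultimately have sup: "(SUP i. emeasure M (shell (1 / real (Suc i)) (real (Suc i)))) = ennreal (measure M UNIV)"
      by (simp add: M.emeasure_eq_measure)
    have "\<exists>i. measure M UNIV - e / 4 < measure M (shell (1 / real (Suc i)) (real (Suc i)))"
    proof (rule ccontr)
      assume "\<not> ?thesis"
      then have le: "measure M (shell (1 / real (Suc i)) (real (Suc i))) \<le> measure M UNIV - e / 4" for i by (simp add: not_less)
      then have "0 \<le> measure M UNIV - e / 4" using measure_nonneg order_trans by blast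
      have "ennreal (measure M UNIV) \<le> ennreal (measure M UNIV - e / 4)" unfolding sup[symmetric]
        unfolding M.emeasure_eq_measure by (rule SUP_least) (rule ennreal_leI[OF le])
      then show False using e \<open>0 \<le> measure M UNIV - e / 4\<close> by (subst (asm) ennreal_le_iff) auto
    qed
    then obtain i0 where i0: "measure M UNIV - e / 4 < measure M (shell (1 / real (Suc i0)) (real (Suc i0)))" by blast
    \<comment> \<open>One index beyond i0: for i0 = 0 the shell of index i0 would have both radii
      equal to 1, against a < b.\<close>
    define a where "a = 1 / real (Suc (Suc i0))"
    define b where "b = real (Suc (Suc i0))"
    let ?S = "shell a b :: 'a set"
    have ab: "0 < a" "a < b"
    proof -
      show "0 < a" by (simp add: a_def)
      have "a < 1" by (simp add: a_def)
      then show "a < b" by (simp add: b_def)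
    qed
    have "measure M (shell (1 / real (Suc i0)) (real (Suc i0))) \<le> measure M ?S"
    proof (rule M.finite_measure_mono)
      have "1 / real (Suc (Suc i0)) \<le> 1 / real (Suc i0)" by (intro divide_left_mono) auto
      then show "shell (1 / real (Suc i0)) (real (Suc i0)) \<subseteq> ?S" by (auto simp: shell_def a_def b_def)
    qed simp
    moreover have "measure M (- ?S) = measure M UNIV - measure M ?S"
      using M.finite_measure_compl[of ?S] by (simp add: Compl_eq_Diff_UNIV)
    ultimately have outside: "measure M (- ?S) < e / 4" using i0 by simp
    obtain d where d: "d \<ge> 0" "\<And>k v. norm v \<le> a / 2 \<Longrightarrow> emeasure lborel (?S \<inter> osc_set (E k) v) \<le> ennreal (d * norm v)"
      using osc[OF ab] by blast
    have "(\<lambda>m. 1 / real (Suc m)) \<longlonglongrightarrow> 0" by (rule LIMSEQ_Suc[OF lim_1_over_n])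
    then have "eventually (\<lambda>m. 1 / real (Suc m) < min (a / 2) (e / 8 / (d + 1))) sequentially"
      by (rule order_tendstoD) (use ab e d in simp)
    then obtain m where m: "\<delta> m < a / 2" "\<delta> m < e / 8 / (d + 1)" by (auto simp: eventually_sequentially \<delta>_def)
    have dm: "d * \<delta> m \<le> e / 8"
    proof -
      have "d * \<delta> m \<le> (d + 1) * (e / 8 / (d + 1))" using m(2) d(1) \<delta>[of m] by (intro mult_mono) auto
      moreover have "d + 1 \<noteq> 0" using d(1) by linarith
      then have "(d + 1) * (e / 8 / (d + 1)) = e / 8" by (simp add: field_simps)
      ultimately show ?thesis by linarith
    qed
    let ?w = "measure lborel (ball (0::'a) (\<delta> m))"
    have w: "?w > 0" using \<delta>[of m] by (simp add: content_ball)
    let ?u = "\<lambda>i. ball_avg (E (r1 i)) (\<delta> m)"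
    \<comment> \<open>By Fubini the mean distance between the indicators and their ball averages is
      an average over small v of the measure of \<open>osc_set\<close>, hence small uniformly in
      i.\<close>
    have dev: "(\<integral>\<^sup>+x. indicator ?S x * ennreal \<bar>s i x - ?u i x\<bar> \<partial>lborel) \<le> ennreal (e / 8)" for i
    proof -
      have [measurable]: "ball (0::'a) (\<delta> m) \<in> sets borel" by simp
      let ?b = "\<lambda>v::'a. indicator (ball 0 (\<delta> m)) v :: ennreal"
      have "ennreal ?w * (\<integral>\<^sup>+x. indicator ?S x * ennreal \<bar>s i x - ?u i x\<bar> \<partial>lborel)
        = (\<integral>\<^sup>+x. ennreal ?w * (indicator ?S x * ennreal \<bar>s i x - ?u i x\<bar>) \<partial>lborel)"
        by (rule nn_integral_cmult[symmetric]) measurable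
      also have "\<dots> = (\<integral>\<^sup>+x. (\<integral>\<^sup>+v. indicator ?S x * (?b v * indicator (osc_set (E (r1 i)) v) x) \<partial>lborel) \<partial>lborel)"
      proof (rule nn_integral_cong)
        fix x :: 'a
        have "ennreal ?w * (indicator ?S x * ennreal \<bar>s i x - ?u i x\<bar>) = indicator ?S x * ennreal (?w * \<bar>s i x - ?u i x\<bar>)"
          using w by (simp add: ennreal_mult mult_ac)
        also have "\<dots> = indicator ?S x * emeasure lborel {v \<in> ball 0 (\<delta> m). x \<in> osc_set (E (r1 i)) v}"
          unfolding s_def ball_avg_deviation[OF E \<delta>] ..
        also have "emeasure lborel {v \<in> ball 0 (\<delta> m). x \<in> osc_set (E (r1 i)) v}
          = (\<integral>\<^sup>+v. indicator {v \<in> ball 0 (\<delta> m). x \<in> osc_set (E (r1 i)) v} v \<partial>lborel)"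
          by (rule nn_integral_indicator[symmetric]) (simp add: osc_set_def)
        also have "\<dots> = (\<integral>\<^sup>+v. ?b v * indicator (osc_set (E (r1 i)) v) x \<partial>lborel)"
          by (rule nn_integral_cong) (simp add: indicator_def)
        also have "indicator ?S x * \<dots> = (\<integral>\<^sup>+v. indicator ?S x * (?b v * indicator (osc_set (E (r1 i)) v) x) \<partial>lborel)"
          by (rule nn_integral_cmult[symmetric]) (simp add: osc_set_def indicator_def)
        finally show "ennreal ?w * (indicator ?S x * ennreal \<bar>s i x - ?u i x\<bar>)
          = (\<integral>\<^sup>+v. indicator ?S x * (?b v * indicator (osc_set (E (r1 i)) v) x) \<partial>lborel)" .
      qed
      also have "\<dots> = (\<integral>\<^sup>+v. (\<integral>\<^sup>+x. indicator ?S x * (?b v * indicator (osc_set (E (r1 i)) v) x) \<partial>lborel) \<partial>lborel)"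
        by (rule lborel_pair.Fubini') (simp add: osc_set_def indicator_def)
      also have "\<dots> = (\<integral>\<^sup>+v. ?b v * emeasure lborel (?S \<inter> osc_set (E (r1 i)) v) \<partial>lborel)"
      proof (rule nn_integral_cong)
        fix v :: 'a
        have "(\<integral>\<^sup>+x. indicator ?S x * (?b v * indicator (osc_set (E (r1 i)) v) x) \<partial>lborel)
          = (\<integral>\<^sup>+x. ?b v * indicator (?S \<inter> osc_set (E (r1 i)) v) x \<partial>lborel)"
          by (rule nn_integral_cong) (simp add: indicator_def)
        also have "\<dots> = ?b v * emeasure lborel (?S \<inter> osc_set (E (r1 i)) v)"
          by (rule nn_integral_cmult_indicator) measurable
        finally show "(\<integral>\<^sup>+x. indicator ?S x * (?b v * indicator (osc_set (E (r1 i)) v) x) \<partial>lborel)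
          = ?b v * emeasure lborel (?S \<inter> osc_set (E (r1 i)) v)" .
      qed
      also have "\<dots> \<le> (\<integral>\<^sup>+v. ennreal (e / 8) * ?b v \<partial>lborel)"
      proof (rule nn_integral_mono)
        fix v :: 'a
        show "?b v * emeasure lborel (?S \<inter> osc_set (E (r1 i)) v) \<le> ennreal (e / 8) * ?b v"
        proof (cases "v \<in> ball 0 (\<delta> m)")
          case True
          then have v: "norm v \<le> \<delta> m" by simp
          have "emeasure lborel (?S \<inter> osc_set (E (r1 i)) v) \<le> ennreal (d * norm v)"
            by (rule d(2)) (use v m(1) in linarith)
          also have "\<dots> \<le> ennreal (e / 8)"
            using mult_left_mono[OF v d(1)] dm by (intro ennreal_leI) linarith
          finally show ?thesis using True by simp
        qed simp
      qed
      also have "\<dots> = ennreal (e / 8) * ennreal ?w"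
        using emeasure_ball_finite[of "0::'a" "\<delta> m"]
        by (subst nn_integral_cmult_indicator) (auto simp: emeasure_eq_ennreal_measure less_top)
      finally have "ennreal ?w * (\<integral>\<^sup>+x. indicator ?S x * ennreal \<bar>s i x - ?u i x\<bar> \<partial>lborel) \<le> ennreal ?w * ennreal (e / 8)"
        by (simp add: mult.commute)
      moreover have "ennreal ?w \<noteq> 0" using w by (metis ennreal_eq_0_iff not_le)
      ultimately show ?thesis by (metis ennreal_mult_le_mult_iff ennreal_neq_top)
    qed
    define U where "U x = lim (\<lambda>i. ?u i x)" for x
    have Ulim: "(\<lambda>i. ?u i x) \<longlonglongrightarrow> U x" for x unfolding U_def using conv by (simp add: convergent_LIMSEQ_iff)
    have Um[measurable]: "U \<in> borel_measurable borel"
      by (rule borel_measurable_LIMSEQ_metric[where f = ?u]) (use Ulim in measurable)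
    have U1: "0 \<le> U x" "U x \<le> 1" for x
      using Ulim[of x] ball_avg_bounds[OF \<delta> E] by (auto intro: LIMSEQ_le_const LIMSEQ_le_const2)
    \<comment> \<open>For the fixed radius \<open>\<delta> m\<close> the averages converge
      everywhere and stay in [0, 1], so dominated convergence applies on the shell.\<close>
    have "(\<lambda>i. \<integral>\<^sup>+x. indicator ?S x * ennreal \<bar>?u i x - U x\<bar> \<partial>lborel) \<longlonglongrightarrow> (\<integral>\<^sup>+x. 0 \<partial>(lborel :: 'a measure))"
    proof (rule nn_integral_dominated_convergence[where w = "\<lambda>x. indicator ?S x"])
      show "(\<integral>\<^sup>+x. indicator ?S x \<partial>lborel) < \<infinity>" using emeasure_shell_finite[of a b, where 'a = 'a] by simp
      show "AE x in lborel. indicator ?S x * ennreal \<bar>?u i x - U x\<bar> \<le> indicator ?S x" for i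
      proof (rule AE_I2)
        fix x
        have "\<bar>?u i x - U x\<bar> \<le> 1" using U1[of x] ball_avg_bounds[OF \<delta> E, of "r1 i" m x] by auto
        then have "ennreal \<bar>?u i x - U x\<bar> \<le> 1" by simp
        then show "indicator ?S x * ennreal \<bar>?u i x - U x\<bar> \<le> indicator ?S x" by (simp add: indicator_def)
      qed
      show "AE x in lborel. (\<lambda>i. indicator ?S x * ennreal \<bar>?u i x - U x\<bar>) \<longlonglongrightarrow> 0"
      proof (rule AE_I2)
        fix x
        have "(\<lambda>i. ennreal \<bar>?u i x - U x\<bar>) \<longlonglongrightarrow> ennreal \<bar>U x - U x\<bar>"
          by (intro tendsto_ennrealI tendsto_intros Ulim)
        then show "(\<lambda>i. indicator ?S x * ennreal \<bar>?u i x - U x\<bar>) \<longlonglongrightarrow> 0" by (simp add: indicator_def)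
      qed
    qed measurable
    then have "eventually (\<lambda>i. (\<integral>\<^sup>+x. indicator ?S x * ennreal \<bar>?u i x - U x\<bar> \<partial>lborel) < ennreal (e / 8)) sequentially"
      by (rule order_tendstoD) (use e in simp)
    then obtain N where N: "\<And>i. i \<ge> N \<Longrightarrow> (\<integral>\<^sup>+x. indicator ?S x * ennreal \<bar>?u i x - U x\<bar> \<partial>lborel) < ennreal (e / 8)"
      by (auto simp: eventually_sequentially)
    have close: "(\<integral>\<^sup>+x. indicator ?S x * ennreal \<bar>s i x - U x\<bar> \<partial>lborel) \<le> ennreal (e / 4)" if "i \<ge> N" for i
    proof -
      have "(\<integral>\<^sup>+x. indicator ?S x * ennreal \<bar>s i x - U x\<bar> \<partial>lborel)
        \<le> (\<integral>\<^sup>+x. indicator ?S x * ennreal \<bar>s i x - ?u i x\<bar> + indicator ?S x * ennreal \<bar>?u i x - U x\<bar> \<partial>lborel)"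
      proof (rule nn_integral_mono)
        fix x
        have "ennreal \<bar>s i x - U x\<bar> \<le> ennreal (\<bar>s i x - ?u i x\<bar> + \<bar>?u i x - U x\<bar>)" by (rule ennreal_leI) linarith
        also have "\<dots> = ennreal \<bar>s i x - ?u i x\<bar> + ennreal \<bar>?u i x - U x\<bar>" by (rule ennreal_plus) auto
        finally show "indicator ?S x * ennreal \<bar>s i x - U x\<bar> \<le> indicator ?S x * ennreal \<bar>s i x - ?u i x\<bar> + indicator ?S x * ennreal \<bar>?u i x - U x\<bar>"
          by (simp add: indicator_def)
      qed
      also have "\<dots> = (\<integral>\<^sup>+x. indicator ?S x * ennreal \<bar>s i x - ?u i x\<bar> \<partial>lborel) + (\<integral>\<^sup>+x. indicator ?S x * ennreal \<bar>?u i x - U x\<bar> \<partial>lborel)"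
        by (rule nn_integral_add) measurable
      also have "\<dots> \<le> ennreal (e / 8) + ennreal (e / 8)" using dev N[OF that] by (intro add_mono) auto
      also have "\<dots> = ennreal (e / 8 + e / 8)" using e by (intro ennreal_plus[symmetric]) auto
      also have "e / 8 + e / 8 = e / 4" by simp
      finally show ?thesis .
    qed
    have [measurable]: "- ?S \<in> sets borel" by (rule borel_comp) simp
    show ?thesis
    proof (intro exI[of _ N] allI impI)
      fix i j assume ij: "N \<le> i" "N \<le> j"
      have "(\<integral>\<^sup>+x. ennreal \<bar>s i x - s j x\<bar> \<partial>M) \<le> (\<integral>\<^sup>+x. (indicator ?S x * ennreal \<bar>s i x - U x\<bar> + indicator ?S x * ennreal \<bar>s j x - U x\<bar>) + indicator (- ?S) x \<partial>M)"
      proof (rule nn_integral_mono)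
        fix x
        show "ennreal \<bar>s i x - s j x\<bar> \<le> (indicator ?S x * ennreal \<bar>s i x - U x\<bar> + indicator ?S x * ennreal \<bar>s j x - U x\<bar>) + indicator (- ?S) x"
        proof (cases "x \<in> ?S")
          case True
          have "ennreal \<bar>s i x - s j x\<bar> \<le> ennreal (\<bar>s i x - U x\<bar> + \<bar>s j x - U x\<bar>)" by (rule ennreal_leI) linarith
          also have "\<dots> = ennreal \<bar>s i x - U x\<bar> + ennreal \<bar>s j x - U x\<bar>" by (rule ennreal_plus) auto
          finally show ?thesis using True by simp
        next
          case False
          have "\<bar>s i x - s j x\<bar> \<le> 1" by (auto simp: s_def indicator_def)
          then have "ennreal \<bar>s i x - s j x\<bar> \<le> 1" by simp
          then show ?thesis using False by simp
        qed
      qed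
      also have "\<dots> = (\<integral>\<^sup>+x. indicator ?S x * ennreal \<bar>s i x - U x\<bar> + indicator ?S x * ennreal \<bar>s j x - U x\<bar> \<partial>M) + (\<integral>\<^sup>+x. indicator (- ?S) x \<partial>M)"
        by (rule nn_integral_add) measurable
      also have "(\<integral>\<^sup>+x. indicator (- ?S) x \<partial>M) = emeasure M (- ?S)" by (rule nn_integral_indicator) measurable
      also have "(\<integral>\<^sup>+x. indicator ?S x * ennreal \<bar>s i x - U x\<bar> + indicator ?S x * ennreal \<bar>s j x - U x\<bar> \<partial>M)
        = (\<integral>\<^sup>+x. indicator ?S x * ennreal \<bar>s i x - U x\<bar> \<partial>M) + (\<integral>\<^sup>+x. indicator ?S x * ennreal \<bar>s j x - U x\<bar> \<partial>M)"
        by (rule nn_integral_add) measurable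
      also have "((\<integral>\<^sup>+x. indicator ?S x * ennreal \<bar>s i x - U x\<bar> \<partial>M) + (\<integral>\<^sup>+x. indicator ?S x * ennreal \<bar>s j x - U x\<bar> \<partial>M)) + emeasure M (- ?S)
        \<le> (ennreal (e / 4) + ennreal (e / 4)) + ennreal (measure M (- ?S))"
        unfolding M.emeasure_eq_measure by (intro add_mono order_trans[OF Mle close[OF ij(1)]] order_trans[OF Mle close[OF ij(2)]]) auto
      also have "\<dots> = ennreal (e / 4 + e / 4 + measure M (- ?S))" using e by (simp add: ennreal_plus[symmetric] del: ennreal_plus)
      finally have le: "(\<integral>\<^sup>+x. ennreal \<bar>s i x - s j x\<bar> \<partial>M) \<le> ennreal (e / 4 + e / 4 + measure M (- ?S))" .
      have int: "integrable M (\<lambda>x. \<bar>s i x - s j x\<bar>)"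
        by (rule M.integrable_const_bound[where B = 1]) (auto simp: s_def indicator_def intro!: AE_I2)
      have "ennreal (\<integral>x. \<bar>s i x - s j x\<bar> \<partial>M) \<le> ennreal (e / 4 + e / 4 + measure M (- ?S))"
        using le nn_integral_eq_integral[OF int] by simp
      then have "(\<integral>x. \<bar>s i x - s j x\<bar> \<partial>M) \<le> e / 4 + e / 4 + measure M (- ?S)"
        using e by (subst (asm) ennreal_le_iff) auto
      then show "(\<integral>x. norm (s i x - s j x) \<partial>M) < e" using outside e by simp
    qed
  qed
  have sint: "integrable M (s i)" for i
    by (rule M.integrable_const_bound[where B = 1]) (auto simp: s_def indicator_def)
  obtain r2 where r2: "strict_mono r2" "AE x in M. Cauchy (\<lambda>i. s (r2 i) x)"
    using cauchy_L1_AE_cauchy_subseq[of M s, OF sint L1] by blast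
  \<comment> \<open>A Cauchy sequence of zeros and ones is eventually constant, so this lower limit
    of the sets is their limit almost everywhere.\<close>
  define F where "F = {x. \<forall>\<^sub>F i in sequentially. x \<in> E (r1 (r2 i))}"
  have Fm: "F \<in> sets borel"
  proof -
    have "F = (\<Union>N. \<Inter>i\<in>{N..}. E (r1 (r2 i)))" by (auto simp: F_def eventually_sequentially)
    also have "\<dots> \<in> sets borel" by (intro sets.countable_UN sets.countable_INT') (use E in auto)
    finally show ?thesis .
  qed
  show ?thesis
  proof (rule that[of "r1 \<circ> r2" F])
    show "strict_mono (r1 \<circ> r2)" using r1(1) r2(1) by (rule strict_mono_o)
    show "F \<in> sets borel" by (rule Fm)
    have "AE x in lborel. Cauchy (\<lambda>i. s (r2 i) x)"
      using r2(2) unfolding M_def by (subst (asm) AE_density) (use hp(1) in auto)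
    then show "AE x in (lborel :: 'a measure). \<forall>\<^sub>F i in sequentially. x \<in> E ((r1 \<circ> r2) i) \<longleftrightarrow> x \<in> F"
    proof eventually_elim
      case (elim x)
      obtain N where N: "\<And>i j. i \<ge> N \<Longrightarrow> j \<ge> N \<Longrightarrow> norm (s (r2 i) x - s (r2 j) x) < 1"
        using CauchyD[OF elim, of 1] by auto
      have eq: "x \<in> E (r1 (r2 i)) \<longleftrightarrow> x \<in> E (r1 (r2 N))" if "i \<ge> N" for i
        using N[OF that order_refl] by (auto simp: s_def indicator_def split: if_splits)
      have "x \<in> F \<longleftrightarrow> x \<in> E (r1 (r2 N))"
        unfolding F_def mem_Collect_eq eventually_sequentially using eq by (metis nle_le)
      then have "x \<in> E ((r1 \<circ> r2) i) \<longleftrightarrow> x \<in> F" if "i \<ge> N" for i using eq[OF that] by simp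
      then show ?case unfolding eventually_sequentially by blast
    qed
  qed
qed

context radial_weights
begin

subsection \<open>Perimeter and translations\<close>

lemma inner_sgn_square_le: "(v \<bullet> sgn (x::'a))\<^sup>2 \<le> (norm v)\<^sup>2"
proof -
  have "\<bar>v \<bullet> sgn x\<bar> \<le> norm v * norm (sgn x)" by (rule Cauchy_Schwarz_ineq2)
  also have "\<dots> \<le> norm v * 1" by (rule mult_left_mono) (auto simp: norm_sgn)
  finally have "\<bar>v \<bullet> sgn x\<bar> \<le> \<bar>norm v\<bar>" by simp
  then show ?thesis by (rule abs_le_square_iff[THEN iffD1])
qed

lemma rnorm_nonneg: "0 \<le> rnorm h (x::'a) v"
  unfolding rnorm_def using inner_sgn_square_le[of v x] by (intro real_sqrt_ge_zero add_nonneg_nonneg mult_nonneg_nonneg) auto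

lemma rnorm_le:
  assumes "x \<noteq> 0" shows "rnorm h (x::'a) v \<le> (1 + h (norm x) / norm x) * norm v"
proof -
  let ?A = "h (norm x) / norm x" and ?t = "v \<bullet> sgn x"
  have A: "0 \<le> ?A" using h_pos assms by (simp add: less_imp_le)
  have t: "?t\<^sup>2 \<le> (norm v)\<^sup>2" by (rule inner_sgn_square_le)
  have "?A\<^sup>2 * ((norm v)\<^sup>2 - ?t\<^sup>2) \<le> ?A\<^sup>2 * (norm v)\<^sup>2" by (intro mult_left_mono) auto
  then have "?t\<^sup>2 + ?A\<^sup>2 * ((norm v)\<^sup>2 - ?t\<^sup>2) \<le> (norm v)\<^sup>2 + ?A\<^sup>2 * (norm v)\<^sup>2" using t by linarith
  also have "\<dots> \<le> (norm v)\<^sup>2 + ?A\<^sup>2 * (norm v)\<^sup>2 + 2 * ?A * (norm v)\<^sup>2"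
  proof -
    have "0 \<le> 2 * ?A * (norm v)\<^sup>2" using A by (intro mult_nonneg_nonneg) auto
    then show ?thesis by linarith
  qed
  also have "\<dots> = ((1 + ?A) * norm v)\<^sup>2" by (simp add: power2_eq_square algebra_simps)
  finally show ?thesis unfolding rnorm_def using A by (intro real_le_lsqrt) auto
qed

text \<open>The rate of change of p(x - t v) in t is the divergence of - p(x - t v) v. As |v| <=
  a/2, this field stays at radii between a/2 and b + a/2, away from the origin, and there M0
  compares Euclidean lengths with the constraint.\<close>

lemma translation_flux:
  assumes a: "0 < a" "a < b" and M0: "0 < M0" "\<And>r. a / 2 \<le> r \<Longrightarrow> r \<le> b + a / 2 \<Longrightarrow> 1 + h r / r \<le> M0 * G r"
    and E: "E \<in> sets borel" and per: "\<And>b. per_le E 0 b C" and v: "v \<noteq> 0" "norm v \<le> a / 2"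
    and p: "C1_on UNIV p" "\<And>x. \<bar>p x\<bar> \<le> 1" and L: "compact L" "L \<subseteq> shell a b" "\<And>x. x \<notin> L \<Longrightarrow> p x = 0"
  shows "(\<integral>x. indicator E x * (p (x - v) - p x) \<partial>lborel) \<le> M0 * norm (v::'a) * C"
proof -
  obtain p' where p': "\<And>x. (p has_derivative blinfun_apply (p' x)) (at x)" "continuous_on UNIV p'"
    using C1_onE[OF p(1)] by (metis UNIV_I)
  have p'0: "p' y = 0" if "y \<notin> L" for y
    using has_derivative_zero_off_compact[OF p'(1) L(1) _ that] L(3) by blast
  define K where "K = {x::'a. a / 2 \<le> norm x \<and> norm x \<le> b + a / 2}"
  have "K = cball 0 (b + a / 2) - ball 0 (a / 2)" by (auto simp: K_def)
  then have K: "compact K" by (simp add: compact_diff)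
  have KS: "K \<subseteq> shell 0 (b + a)" using a by (auto simp: K_def shell_def)
  have KL: "x - t *\<^sub>R v \<notin> L" if "x \<notin> K" "0 \<le> t" "t \<le> 1" for x t
  proof
    assume "x - t *\<^sub>R v \<in> L"
    then have "a < norm (x - t *\<^sub>R v)" "norm (x - t *\<^sub>R v) < b" using L(2) by (auto simp: shell_def)
    moreover have "norm (t *\<^sub>R v) \<le> 1 * (a / 2)" unfolding norm_scaleR using that v by (intro mult_mono) auto
    moreover have "norm (x - t *\<^sub>R v) \<le> norm x + norm (t *\<^sub>R v)" by (rule norm_triangle_ineq4)
    moreover have "norm x \<le> norm (x - t *\<^sub>R v) + norm (t *\<^sub>R v)" using norm_triangle_ineq[of "x - t *\<^sub>R v" "t *\<^sub>R v"] by simp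
    ultimately show False using that(1) by (auto simp: K_def)
  qed
  define d where "d t x = - blinfun_apply (p' (x - t *\<^sub>R v)) v" for t x
  have "(\<integral>x. indicator E x * (p (x - 1 *\<^sub>R v) - p (x - 0 *\<^sub>R v)) \<partial>lborel) \<le> M0 * norm v * C"
  proof (rule flow_estimate[OF E K, where d = d and u = "\<lambda>t x. p (x - t *\<^sub>R v)"])
    fix t :: real and x :: 'a assume t: "0 \<le> t" "t \<le> 1"
    have 1: "((\<lambda>t. x - t *\<^sub>R v) has_derivative (\<lambda>s. - (s *\<^sub>R v))) (at t)"
      by (auto intro!: derivative_eq_intros)
    have "((\<lambda>t. p (x - t *\<^sub>R v)) has_derivative (\<lambda>s. blinfun_apply (p' (x - t *\<^sub>R v)) (- (s *\<^sub>R v)))) (at t)"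
      by (rule has_derivative_compose[OF 1 p'(1)])
    moreover have "(\<lambda>s. blinfun_apply (p' (x - t *\<^sub>R v)) (- (s *\<^sub>R v))) = (*) (d t x)"
      by (auto simp: d_def blinfun.minus_right blinfun.scaleR_right)
    ultimately show "((\<lambda>t. p (x - t *\<^sub>R v)) has_real_derivative d t x) (at t)"
      unfolding has_field_derivative_def by simp
    show "d t x = 0" if "x \<notin> K" using p'0[OF KL[OF that t]] by (simp add: d_def)
  next
    show "continuous_on ({0..1} \<times> K) (\<lambda>(t, x). d t x)"
      unfolding d_def case_prod_beta
      by (intro continuous_intros continuous_on_compose2[OF p'(2)]) auto
  next
    fix t :: real assume t: "0 \<le> t" "t \<le> 1"
    define Y where "Y x = (- p (x - t *\<^sub>R v)) *\<^sub>R v" for x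
    have o: "open (UNIV :: 'a set)" by simp
    have CY: "C1_on UNIV Y" unfolding Y_def
      by (rule C1_on_scaleR[OF C1_on_uminus[OF C1_on_compose[OF p(1) C1_on_diff[OF C1_on_ident[OF o] C1_on_const[OF o]]]] C1_on_const[OF o]]) simp
    have Y0: "Y x = 0" if "x \<notin> K" for x using L(3)[OF KL[OF that t]] by (simp add: Y_def)
    have Yc: "C1c_field Y"
      by (rule C1_on_imp_C1c_field[OF CY K _ _ Y0]) (use a in \<open>auto simp: K_def\<close>)
    have dY: "divergence Y x = d t x" for x
    proof -
      have 1: "((\<lambda>x. x - t *\<^sub>R v) has_derivative (\<lambda>s. s)) (at x)" by (auto intro!: derivative_eq_intros)
      have 2: "((\<lambda>x. - p (x - t *\<^sub>R v)) has_derivative (\<lambda>s. - blinfun_apply (p' (x - t *\<^sub>R v)) s)) (at x)"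
        by (rule has_derivative_minus[OF has_derivative_compose[OF 1 p'(1)]])
      have "divergence (\<lambda>_. v) x = 0" by (subst divergence_eq[OF has_derivative_const]) simp
      then show ?thesis unfolding Y_def d_def using divergence_scaleR[OF 2 has_derivative_const[of v]] by simp
    qed
    have "flux E Y \<le> M0 * norm v * C"
    proof (rule per_le_scaled[OF per Yc K KS Y0])
      show "M0 * norm v > 0" using M0 v by simp
      fix x :: 'a assume x: "x \<in> K" "x \<noteq> 0"
      have "rnorm h x (Y x) = \<bar>- p (x - t *\<^sub>R v)\<bar> * rnorm h x v" unfolding Y_def by (rule rnorm_scaleR)
      also have "\<dots> \<le> 1 * ((1 + h (norm x) / norm x) * norm v)"
        using p(2)[of "x - t *\<^sub>R v"] by (intro mult_mono rnorm_le[OF x(2)] rnorm_nonneg) auto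
      also have "\<dots> = (1 + h (norm x) / norm x) * norm v" by simp
      also have "\<dots> \<le> (M0 * G (norm x)) * norm v"
        using M0(2)[of "norm x"] x by (intro mult_right_mono) (auto simp: K_def)
      finally show "rnorm h x (Y x) \<le> M0 * norm v * (g (norm x) * \<mu> x)" unfolding G_eq by (simp add: mult_ac)
    qed
    then show "(\<integral>x. indicator E x * d t x \<partial>lborel) \<le> M0 * norm v * C" by (simp add: flux_def dY)
  qed
  then show ?thesis by simp
qed

text \<open>Duality: let p approximate the difference of the indicators of A1 and A2, the parts of
  the shell that v carries into E and out of E. Integrating p against the increment of the indicator
  of E gives the measure of the oscillation set up to e, and a change of variables moves the shift
  from E to p. The constant depends on the shell only.\<close>

lemma translation_estimate:
  assumes a: "0 < a" "a < b"
  shows "\<exists>D\<ge>0. \<forall>E\<in>sets borel. \<forall>C. (\<forall>\<beta>. per_le E 0 \<beta> C) \<longrightarrow> (\<forall>v. norm v \<le> a / 2 \<longrightarrow>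
    emeasure lborel (shell a b \<inter> osc_set E (v::'a)) \<le> ennreal (D * C * norm v))"
proof -
  let ?I = "{a / 2..b + a / 2}"
  have Gnz: "G r \<noteq> 0" if "r \<in> ?I" for r using G_pos[of r] that a by auto
  have "?I \<subseteq> {0<..}" using a by auto
  then have "continuous_on ?I (\<lambda>r. (1 + h r / r) / G r)"
    by (intro continuous_on_divide continuous_on_add continuous_on_const continuous_on_id
        continuous_on_subset[OF h_cont] continuous_on_subset[OF G_cont]) (use Gnz in auto)
  then have "compact ((\<lambda>r. (1 + h r / r) / G r) ` ?I)" by (rule compact_continuous_image) simp
  then have "bounded ((\<lambda>r. (1 + h r / r) / G r) ` ?I)" by (rule compact_imp_bounded)
  then obtain M1 where M1: "\<forall>y\<in>(\<lambda>r. (1 + h r / r) / G r) ` ?I. norm y \<le> M1" unfolding bounded_iff by blast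
  define M0 where "M0 = max M1 1"
  have M0: "0 < M0" by (simp add: M0_def)
  have M0G: "1 + h r / r \<le> M0 * G r" if "a / 2 \<le> r" "r \<le> b + a / 2" for r
  proof -
    have "norm ((1 + h r / r) / G r) \<le> M1" using M1 that by auto
    then have "(1 + h r / r) / G r \<le> M0"
      using abs_ge_self[of "(1 + h r / r) / G r"] unfolding real_norm_def M0_def by linarith
    then show ?thesis using G_pos[of r] that a by (simp add: divide_le_eq)
  qed
  show ?thesis
  proof (intro exI[of _ M0] conjI ballI allI impI)
    show "0 \<le> M0" using M0 by simp
    fix E :: "'a set" and C :: real and v :: 'a
    assume E[measurable]: "E \<in> sets borel" and per': "\<forall>\<beta>. per_le E 0 \<beta> C" and v: "norm v \<le> a / 2"
    then have per: "\<And>\<beta>. per_le E 0 \<beta> C" by blast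
    let ?S = "shell a b :: 'a set"
    show "emeasure lborel (?S \<inter> osc_set E v) \<le> ennreal (M0 * C * norm v)"
    proof (cases "v = 0")
      case True
      then show ?thesis by (simp add: osc_set_def)
    next
      case False
      define A1 where "A1 = ?S \<inter> {x. x \<notin> E \<and> x + v \<in> E}"
      define A2 where "A2 = ?S \<inter> {x. x \<in> E \<and> x + v \<notin> E}"
      have [measurable]: "A1 \<in> sets borel" "A2 \<in> sets borel" unfolding A1_def A2_def by measurable
      have fin: "emeasure lborel (?S \<inter> osc_set E v) < \<infinity>"
        using emeasure_mono[of "?S \<inter> osc_set E v" ?S lborel] emeasure_shell_finite[of a b] by (auto intro: le_less_trans)
      have "measure lborel (?S \<inter> osc_set E v) \<le> M0 * norm v * C"
      proof (rule field_le_epsilon)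
        fix e :: real assume e: "0 < e"
        then have e2: "e / 2 > 0" by simp
        have sub: "A1 \<subseteq> ?S" "A2 \<subseteq> ?S" by (auto simp: A1_def A2_def)
        obtain p1 :: "'a \<Rightarrow> real" and L1 where p1: "C1_on UNIV p1" "\<And>x. 0 \<le> p1 x" "\<And>x. p1 x \<le> 1"
          "compact L1" "L1 \<subseteq> ?S" "\<And>x. x \<notin> L1 \<Longrightarrow> p1 x = 0"
          "integrable lborel (\<lambda>x. \<bar>p1 x - indicator A1 x\<bar>)" "(\<integral>x. \<bar>p1 x - indicator A1 x\<bar> \<partial>lborel) < e / 2"
          using C1_approx_indicator_lborel[OF open_shell emeasure_shell_finite \<open>A1 \<in> sets borel\<close> sub(1) e2] by blast
        obtain p2 :: "'a \<Rightarrow> real" and L2 where p2: "C1_on UNIV p2" "\<And>x. 0 \<le> p2 x" "\<And>x. p2 x \<le> 1"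
          "compact L2" "L2 \<subseteq> ?S" "\<And>x. x \<notin> L2 \<Longrightarrow> p2 x = 0"
          "integrable lborel (\<lambda>x. \<bar>p2 x - indicator A2 x\<bar>)" "(\<integral>x. \<bar>p2 x - indicator A2 x\<bar> \<partial>lborel) < e / 2"
          using C1_approx_indicator_lborel[OF open_shell emeasure_shell_finite \<open>A2 \<in> sets borel\<close> sub(2) e2] by blast
        define p where "p x = p1 x - p2 x" for x
        have pC: "C1_on UNIV p" unfolding p_def by (rule C1_on_diff[OF p1(1) p2(1)])
        have pabs: "\<bar>p x\<bar> \<le> 1" for x using p1(2,3)[of x] p2(2,3)[of x] by (auto simp: p_def)
        have L: "compact (L1 \<union> L2)" "L1 \<union> L2 \<subseteq> ?S" "\<And>x. x \<notin> L1 \<union> L2 \<Longrightarrow> p x = 0"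
          using p1 p2 by (auto simp: p_def)
        have pc: "continuous_on UNIV p" by (rule C1_on_imp_continuous_on[OF pC])
        have [measurable]: "p \<in> borel_measurable borel" by (rule borel_measurable_continuous_onI[OF pc])
        define Ev where "Ev = {x. x + v \<in> E}"
        have Ev[measurable]: "Ev \<in> sets borel" unfolding Ev_def by measurable
        have i1: "integrable lborel (\<lambda>x. indicator E x * p x)"
          by (rule integrable_indicator_compact_support[OF E L(1) continuous_on_subset[OF pc] L(3)]) auto
        have i2: "integrable lborel (\<lambda>x. indicator Ev x * p x)"
          by (rule integrable_indicator_compact_support[OF Ev L(1) continuous_on_subset[OF pc] L(3)]) auto
        have sh: "(\<lambda>x. indicator Ev (- v + x) * p (- v + x)) = (\<lambda>x. indicator E x * p (x - v))"
          by (auto simp: Ev_def indicator_def fun_eq_iff)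
        have i3: "integrable lborel (\<lambda>x. indicator E x * p (x - v))"
          and eq3: "(\<integral>x. indicator E x * p (x - v) \<partial>lborel) = (\<integral>x. indicator Ev x * p x \<partial>lborel)"
        proof -
          have "integrable (distr lborel borel ((+) (- v))) (\<lambda>x. indicator Ev x * p x)" using i2 by (simp add: lborel_distr_plus)
          then have "integrable lborel (\<lambda>x. indicator Ev (- v + x) * p (- v + x))"
            by (subst (asm) integrable_distr_eq) auto
          then show "integrable lborel (\<lambda>x. indicator E x * p (x - v))" unfolding sh .
          have "(\<integral>x. indicator Ev x * p x \<partial>lborel) = (\<integral>x. indicator Ev x * p x \<partial>distr lborel borel ((+) (- v)))"
            by (simp add: lborel_distr_plus)
          also have "\<dots> = (\<integral>x. indicator Ev (- v + x) * p (- v + x) \<partial>lborel)"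
            by (rule integral_distr) auto
          finally show "(\<integral>x. indicator E x * p (x - v) \<partial>lborel) = (\<integral>x. indicator Ev x * p x \<partial>lborel)" unfolding sh by simp
        qed
        have "measure lborel (?S \<inter> osc_set E v) = (\<integral>x. indicator (?S \<inter> osc_set E v) x \<partial>lborel)" by simp
        also have "\<dots> \<le> (\<integral>x. (indicator Ev x * p x - indicator E x * p x) + (\<bar>p1 x - indicator A1 x\<bar> + \<bar>p2 x - indicator A2 x\<bar>) \<partial>lborel)"
        proof (rule Bochner_Integration.integral_mono)
          show "integrable lborel (indicat_real (?S \<inter> osc_set E v))" using fin by (intro integrable_real_indicator) auto
          show "integrable lborel (\<lambda>x. (indicator Ev x * p x - indicator E x * p x) + (\<bar>p1 x - indicator A1 x\<bar> + \<bar>p2 x - indicator A2 x\<bar>))"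
            by (intro Bochner_Integration.integrable_add Bochner_Integration.integrable_diff i1 i2 p1(7) p2(7))
          fix x :: 'a
          show "indicat_real (?S \<inter> osc_set E v) x \<le> (indicator Ev x * p x - indicator E x * p x) + (\<bar>p1 x - indicator A1 x\<bar> + \<bar>p2 x - indicator A2 x\<bar>)"
          proof (cases "x \<in> ?S")
            case False
            then have "x \<notin> L1" "x \<notin> L2" "x \<notin> A1" "x \<notin> A2" using p1(5) p2(5) sub by auto
            then show ?thesis using False p1(6) p2(6) by (simp add: p_def)
          next
            case True
            then show ?thesis using p1(2,3)[of x] p2(2,3)[of x]
              by (cases "x \<in> E"; cases "x + v \<in> E") (auto simp: p_def A1_def A2_def Ev_def osc_set_def indicator_def)
          qed
        qed
        also have "\<dots> = ((\<integral>x. indicator Ev x * p x \<partial>lborel) - (\<integral>x. indicator E x * p x \<partial>lborel))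
          + ((\<integral>x. \<bar>p1 x - indicator A1 x\<bar> \<partial>lborel) + (\<integral>x. \<bar>p2 x - indicator A2 x\<bar> \<partial>lborel))"
          by (simp add: i1 i2 p1(7) p2(7))
        also have "(\<integral>x. indicator Ev x * p x \<partial>lborel) - (\<integral>x. indicator E x * p x \<partial>lborel) = (\<integral>x. indicator E x * (p (x - v) - p x) \<partial>lborel)"
          unfolding eq3[symmetric] right_diff_distrib by (rule Bochner_Integration.integral_diff[OF i3 i1, symmetric])
        finally show "measure lborel (?S \<inter> osc_set E v) \<le> M0 * norm v * C + e"
          using translation_flux[OF a M0 M0G E per False v pC pabs L] p1(8) p2(8) by linarith
      qed
      then have "ennreal (measure lborel (?S \<inter> osc_set E v)) \<le> ennreal (M0 * C * norm v)"
        by (intro ennreal_leI) (simp add: mult_ac)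
      then show ?thesis using fin by (simp add: emeasure_eq_ennreal_measure less_top)
    qed
  qed
qed

subsection \<open>Existence of minimizers\<close>

text \<open>Competitors are Lebesgue measurable, while the estimates are made for Borel sets. Volume
  and fluxes are integrals over the set, hence blind to null sets.\<close>

lemma borel_representative:
  assumes "E \<in> sets (lebesgue :: 'a measure)"
  obtains E' :: "'a set" where "E' \<in> sets borel" "wvol f h E' = wvol f h E" "wper g h E' = wper g h E"
proof -
  obtain S N N' where N: "E = S \<union> N" "N \<subseteq> N'" "N' \<in> null_sets lborel" "S \<in> sets lborel"
    using sets_completionE[OF assms] by blast
  have "N' \<in> null_sets lebesgue" using N(3) by (rule null_sets_completionI)
  then have "AE x in lebesgue. x \<notin> N'" by (rule AE_not_in)
  then have ae: "AE x in lebesgue. x \<in> S \<longleftrightarrow> x \<in> E" using N(1,2) by (auto elim!: eventually_mono)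
  have S: "S \<in> sets borel" using N(4) by simp
  have SL: "S \<in> sets lebesgue" using N(4) by simp
  have 1: "wvol f h S = wvol f h E" unfolding wvol_def
    by (rule nn_integral_cong_AE) (use ae in \<open>auto elim!: eventually_mono simp: indicator_def\<close>)
  have 2: "set_lebesgue_integral lebesgue S (divergence Y) = set_lebesgue_integral lebesgue E (divergence Y)" if "C1c_field Y" for Y :: "'a \<Rightarrow> 'a"
  proof -
    have [measurable]: "divergence Y \<in> borel_measurable borel"
    proof -
      obtain K where K: "compact K" "\<And>x. x \<notin> K \<Longrightarrow> Y x = 0" using \<open>C1c_field Y\<close> unfolding C1c_field_def by blast
      show ?thesis by (rule borel_measurable_continuous_onI[OF C1c_field_divergence(1)[OF \<open>C1c_field Y\<close> K(2) compact_imp_closed[OF K(1)]]])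
    qed
    have m: "divergence Y \<in> borel_measurable lebesgue" by (rule measurable_completion) simp
    show ?thesis unfolding set_lebesgue_integral_def
      by (rule integral_cong_AE) (use ae assms SL m in \<open>auto elim!: eventually_mono simp: indicator_def\<close>)
  qed
  have "wper g h S = wper g h E" unfolding wper_def by (rule SUP_cong) (auto simp: 2)
  then show ?thesis by (rule that[OF S 1])
qed

text \<open>The class of fields in \<open>wper\<close>; \<open>admissible\<close> additionally fixes
  a shell that contains the support.\<close>

definition test_field :: "('a \<Rightarrow> 'a) \<Rightarrow> bool" where
  "test_field Y \<longleftrightarrow> C1c_field Y \<and> (\<forall>x. x \<noteq> 0 \<longrightarrow> rnorm h x (Y x) \<le> g (norm x) * \<mu> x)"

lemma wper_eq:
  assumes E: "E \<in> sets borel"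
  shows "wper g h E = (SUP Y \<in> {Y. test_field Y}. ereal (flux E Y))"
  unfolding wper_def test_field_def
proof (rule SUP_cong[OF refl])
  fix Y :: "'a \<Rightarrow> 'a" assume "Y \<in> {Y. C1c_field Y \<and> (\<forall>x. x \<noteq> 0 \<longrightarrow> rnorm h x (Y x) \<le> g (norm x) * \<mu> x)}"
  then have Y: "C1c_field Y" by simp
  have "(\<lambda>x. indicator E x *\<^sub>R divergence Y x) \<in> borel_measurable lborel"
    using integrable_divergence[OF Y E] by (simp add: borel_measurable_integrable)
  then show "ereal (set_lebesgue_integral lebesgue E (divergence Y)) = ereal (flux E Y)"
    unfolding set_lebesgue_integral_def flux_def by (subst integral_completion) auto
qed

lemma wper_le_iff:
  assumes E: "E \<in> sets borel"
  shows "wper g h E \<le> ereal C \<longleftrightarrow> (\<forall>Y. test_field Y \<longrightarrow> flux E Y \<le> C)"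
  unfolding wper_eq[OF E] by (auto simp: SUP_le_iff)

lemma wper_le_per_le:
  assumes "E \<in> sets borel" "wper g h E \<le> ereal C" shows "per_le E a b C"
  using assms(2) unfolding wper_le_iff[OF assms(1)] per_le_def admissible_def test_field_def by blast

lemma wper_nonneg: "E \<in> sets borel \<Longrightarrow> 0 \<le> wper g h (E :: 'a set)"
proof -
  assume E: "E \<in> sets borel"
  have "test_field (\<lambda>x. 0)" using admissible_zero[of 0 0] by (auto simp: admissible_def test_field_def)
  then have "ereal (flux E (\<lambda>x. 0)) \<le> wper g h E" unfolding wper_eq[OF E] by (intro SUP_upper) simp
  then show ?thesis by (simp add: flux_zero zero_ereal_def)
qed

lemma W_cball_SUP: "(SUP i. emeasure W (A \<inter> cball 0 (real i))) = emeasure W A" if A: "A \<in> sets borel"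
proof -
  have "(SUP i. emeasure W (A \<inter> cball 0 (real i))) = emeasure W (\<Union>i. A \<inter> cball 0 (real i))"
    by (rule SUP_emeasure_incseq) (use A in \<open>auto simp: incseq_def\<close>)
  moreover have "\<exists>i. norm x \<le> real i" for x :: 'a by (rule real_arch_simple)
  then have "(\<Union>i. A \<inter> cball 0 (real i)) = A" by auto
  ultimately show ?thesis by simp
qed

text \<open>The volume of balls is Lipschitz in the radius, starts at 0 and eventually exceeds V, so
  some ball centred at the origin has volume V.\<close>

lemma exists_volume:
  assumes V: "0 < V" "ennreal V < emeasure W UNIV"
  obtains E where "E \<in> sets borel" "emeasure W E = ennreal V"
proof -
  have "ennreal V < (SUP i. emeasure W (UNIV \<inter> cball 0 (real i)))" using V W_cball_SUP[of UNIV] by simp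
  then obtain i where i: "ennreal V < emeasure W (cball 0 (real i))" by (auto simp: less_SUP_iff)
  define R where "R = real i + 1"
  have R: "R > 0" by (simp add: R_def)
  have iR: "emeasure W (cball 0 (real i)) \<le> emeasure W (cball 0 R)" by (intro emeasure_mono) (auto simp: R_def)
  define \<Phi> where "\<Phi> r = measure W (cball 0 r)" for r
  have e\<Phi>: "emeasure W (cball 0 r) = ennreal (\<Phi> r)" for r
    unfolding \<Phi>_def using W_cball_finite[of r] by (simp add: emeasure_eq_ennreal_measure less_top)
  obtain D where D: "D \<ge> 0" "\<forall>r s. 0 \<le> r \<and> r \<le> s \<and> s \<le> R \<longrightarrow> emeasure W {x. r < norm x \<and> norm x \<le> s} \<le> ennreal (D * (s - r))"
    using W_cball_increment[OF R] by blast
  have inc: "\<Phi> r \<le> \<Phi> s \<and> \<Phi> s \<le> \<Phi> r + D * (s - r)" if "0 \<le> r" "r \<le> s" "s \<le> R" for r s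
  proof
    have "emeasure W (cball 0 r) \<le> emeasure W (cball 0 s)" using that by (intro emeasure_mono) auto
    then show "\<Phi> r \<le> \<Phi> s" unfolding e\<Phi> by (subst (asm) ennreal_le_iff) (auto simp: \<Phi>_def)
    have "emeasure W (cball 0 s) \<le> emeasure W (cball 0 r \<union> {x. r < norm x \<and> norm x \<le> s})"
      by (intro emeasure_mono) auto
    also have "\<dots> \<le> emeasure W (cball 0 r) + emeasure W {x. r < norm x \<and> norm x \<le> s}"
      by (rule emeasure_subadditive) auto
    also have "\<dots> \<le> ennreal (\<Phi> r) + ennreal (D * (s - r))" using D(2) that by (intro add_mono) (auto simp: e\<Phi>)
    also have "\<dots> = ennreal (\<Phi> r + D * (s - r))" using D(1) that by (intro ennreal_plus[symmetric]) (auto simp: \<Phi>_def)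
    finally show "\<Phi> s \<le> \<Phi> r + D * (s - r)" unfolding e\<Phi>
      using D(1) that by (subst (asm) ennreal_le_iff) (auto simp: \<Phi>_def)
  qed
  have cont: "continuous_on {0..R} \<Phi>"
  proof (rule lipschitz_on_continuous_on, rule lipschitz_onI[OF _ D(1)])
    fix r s assume "r \<in> {0..R}" "s \<in> {0..R}"
    then show "dist (\<Phi> r) (\<Phi> s) \<le> D * dist r s"
      using inc[of r s] inc[of s r] by (cases "r \<le> s") (auto simp: dist_real_def abs_if algebra_simps)
  qed
  have "\<Phi> 0 = 0" by (simp add: \<Phi>_def measure_def W_singleton_0)
  moreover have "V \<le> \<Phi> R"
  proof -
    have "ennreal V \<le> ennreal (\<Phi> R)" using i iR unfolding e\<Phi> by simp
    then show ?thesis by (subst (asm) ennreal_le_iff) (auto simp: \<Phi>_def)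
  qed
  ultimately obtain r where "\<Phi> r = V" using IVT'[of \<Phi> 0 V R] cont V R by auto
  then show ?thesis using that[of "cball 0 r"] e\<Phi>[of r] by auto
qed

lemma tail_finite_volume:
  assumes fin: "emeasure W UNIV \<noteq> \<infinity>" and \<eta>: "\<eta> > 0"
  shows "\<exists>R>0. emeasure W {x. R < norm x} \<le> ennreal \<eta>"
proof -
  interpret W: finite_measure W by (rule finite_measureI) (use fin in auto)
  have "(SUP i. emeasure W (cball 0 (real i))) = ennreal (measure W UNIV)"
    using W_cball_SUP[of UNIV] by (simp add: W.emeasure_eq_measure)
  have "\<exists>i. measure W UNIV - \<eta> < measure W (cball 0 (real i))"
  proof (rule ccontr)
    assume "\<not> ?thesis"
    then have le: "measure W (cball 0 (real i)) \<le> measure W UNIV - \<eta>" for i by (simp add: not_less)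
    then have 0: "0 \<le> measure W UNIV - \<eta>" using measure_nonneg order_trans by blast
    have "(SUP i. emeasure W (cball 0 (real i))) \<le> ennreal (measure W UNIV - \<eta>)"
      unfolding W.emeasure_eq_measure by (rule SUP_least) (rule ennreal_leI[OF le])
    then have "ennreal (measure W UNIV) \<le> ennreal (measure W UNIV - \<eta>)"
      using \<open>(SUP i. emeasure W (cball 0 (real i))) = ennreal (measure W UNIV)\<close> by (simp only:)
    then show False using \<eta> 0 by (subst (asm) ennreal_le_iff) auto
  qed
  then obtain i where i: "measure W UNIV - \<eta> < measure W (cball 0 (real i))" by blast
  have "{x. real i + 1 < norm x} \<subseteq> UNIV - cball 0 (real i)" by auto
  then have "measure W {x. real i + 1 < norm x} \<le> measure W (UNIV - cball 0 (real i))" by (rule W.finite_measure_mono) simp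
  also have "\<dots> = measure W UNIV - measure W (cball 0 (real i))" using W.finite_measure_compl[of "cball 0 (real i)"] by simp
  finally have "measure W {x. real i + 1 < norm x} \<le> \<eta>" using i by linarith
  then show ?thesis by (intro exI[of _ "real i + 1"]) (auto simp: W.emeasure_eq_measure ennreal_leI)
qed

lemma isoperimetric_region_exists:
  assumes V: "0 < V" "ennreal V < wvol f h (UNIV :: 'a set)"
  shows "\<exists>E :: 'a set. isoperimetric_region f g h E V"
proof -
  have VW: "ennreal V < emeasure W UNIV" using V(2) by (simp add: wvol_eq)
  define S where "S = {F \<in> sets (lebesgue :: 'a measure). wvol f h F = ennreal V}"
  define I where "I = (INF F\<in>S. wper g h F)"
  obtain E0 where E0: "E0 \<in> sets borel" "emeasure W E0 = ennreal V" using exists_volume[OF V(1) VW] by blast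
  have E0S: "E0 \<in> S" using E0 by (simp add: S_def wvol_eq)
  show ?thesis
  proof (cases "I = \<infinity>")
    \<comment> \<open>If no competitor has finite perimeter, each of them is minimizing.\<close>
    case True
    have "wper g h F = \<infinity>" if "F \<in> S" for F
      using INF_lower[OF that, of "wper g h"] True unfolding I_def[symmetric] by simp
    then have "isoperimetric_region f g h E0 V"
      using E0S unfolding isoperimetric_region_def S_def by auto
    then show ?thesis by blast
  next
    case False
    have I0: "0 \<le> I" unfolding I_def
    proof (rule INF_greatest)
      fix F assume "F \<in> S"
      then obtain F' :: "'a set" where F': "F' \<in> sets borel" "wper g h F' = wper g h F"
        using borel_representative[of F] unfolding S_def by blast
      show "0 \<le> wper g h F" using wper_nonneg[OF F'(1)] unfolding F'(2) .
    qed
    obtain i where i: "I = ereal i" "0 \<le> i" using I0 False by (cases I) auto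
    have "\<exists>E. E \<in> sets borel \<and> emeasure W E = ennreal V \<and> wper g h E \<le> ereal (i + 1 / real (Suc k))" for k
    proof -
      have "I < ereal (i + 1 / real (Suc k))" unfolding i by simp
      then obtain F where F: "F \<in> S" "wper g h F < ereal (i + 1 / real (Suc k))"
        unfolding I_def INF_less_iff by blast
      then obtain F' :: "'a set" where F': "F' \<in> sets borel" "wvol f h F' = wvol f h F" "wper g h F' = wper g h F"
        using borel_representative[of F] unfolding S_def by blast
      have "emeasure W F' = ennreal V" using F(1) F'(2) unfolding wvol_eq[OF F'(1)] by (simp add: S_def)
      moreover have "wper g h F' \<le> ereal (i + 1 / real (Suc k))" using F(2) unfolding F'(3) by (rule less_imp_le)
      ultimately show ?thesis using F'(1) by blast
    qed
    then obtain E where E: "\<And>k. E k \<in> sets borel" "\<And>k. emeasure W (E k) = ennreal V"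
      "\<And>k. wper g h (E k) \<le> ereal (i + 1 / real (Suc k))" by metis
    \<comment> \<open>One perimeter bound for the whole sequence, since 1 / (k + 1) is at most
      1.\<close>
    define C where "C = i + 1"
    have C: "C > 0" using i by (simp add: C_def)
    have perC: "per_le (E k) a b C" for k a b
    proof (rule wper_le_per_le[OF E(1)])
      have "i + 1 / real (Suc k) \<le> C" by (simp add: C_def)
      then show "wper g h (E k) \<le> ereal C" using E(3)[of k] order_trans ereal_less_eq(3) by metis
    qed
    obtain r F where r: "strict_mono r" and F[measurable]: "F \<in> sets borel"
      and ae: "AE x in (lborel :: 'a measure). \<forall>\<^sub>F j in sequentially. x \<in> E (r j) \<longleftrightarrow> x \<in> F"
    proof (rule set_sequence_compactness[OF E(1)])
      fix a b :: real assume ab: "0 < a" "a < b"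
      obtain D where D: "D \<ge> 0" "\<forall>E\<in>sets borel. \<forall>C. (\<forall>\<beta>. per_le E 0 \<beta> C) \<longrightarrow> (\<forall>v. norm v \<le> a / 2 \<longrightarrow>
        emeasure lborel (shell a b \<inter> osc_set E (v::'a)) \<le> ennreal (D * C * norm v))"
        using translation_estimate[OF ab] by blast
      show "\<exists>D\<ge>0. \<forall>k v. norm v \<le> a / 2 \<longrightarrow> emeasure lborel (shell a b \<inter> osc_set (E k) v) \<le> ennreal (D * norm v)"
        using D(1) C D(2)[rule_format, OF E(1) perC] by (intro exI[of _ "D * C"]) auto
    qed blast
    define A where "A j = E (r j)" for j
    have A[measurable]: "\<And>j. A j \<in> sets borel" using E by (simp add: A_def)
    have AV: "emeasure W (A j) = ennreal V" for j using E by (simp add: A_def)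
    have aeA: "AE x in (lborel :: 'a measure). \<forall>\<^sub>F j in sequentially. x \<in> A j \<longleftrightarrow> x \<in> F" using ae by (simp add: A_def)
    have aeW: "AE x in W. \<forall>\<^sub>F j in sequentially. x \<in> A j \<longleftrightarrow> x \<in> F"
      unfolding W_def by (subst AE_density) (use aeA in \<open>auto elim!: eventually_mono\<close>)
    \<comment> \<open>Almost everywhere convergence gives convergence of volumes only inside balls;
      the whole space is reached through the uniform tail bound below.\<close>
    have lim: "(\<lambda>j. emeasure W (A j \<inter> cball 0 R)) \<longlonglongrightarrow> emeasure W (F \<inter> cball 0 R)" for R
    proof -
      have "(\<lambda>j. \<integral>\<^sup>+x. indicator (A j \<inter> cball 0 R) x \<partial>W) \<longlonglongrightarrow> (\<integral>\<^sup>+x. indicator (F \<inter> cball 0 R) x \<partial>W)"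
      proof (rule nn_integral_dominated_convergence[where w = "indicator (cball 0 R)"])
        have [measurable]: "cball (0::'a) R \<in> sets borel" by simp
        show "indicator (cball 0 R) \<in> borel_measurable W" by measurable
        show "(\<lambda>x. indicator (A j \<inter> cball 0 R) x :: ennreal) \<in> borel_measurable W" for j by measurable
        show "(\<lambda>x. indicator (F \<inter> cball 0 R) x :: ennreal) \<in> borel_measurable W" by measurable
        show "(\<integral>\<^sup>+x. indicator (cball 0 R) x \<partial>W) < \<infinity>" using W_cball_finite[of R] by simp
        show "AE x in W. (\<lambda>j. indicator (A j \<inter> cball 0 R) x :: ennreal) \<longlonglongrightarrow> indicator (F \<inter> cball 0 R) x"
          using aeW
        proof eventually_elim
          case (elim x)
          then have "\<forall>\<^sub>F j in sequentially. indicator (A j \<inter> cball 0 R) x = (indicator (F \<inter> cball 0 R) x :: ennreal)"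
            by eventually_elim (simp add: indicator_def)
          then show ?case by (rule tendsto_eventually)
        qed
      qed (auto simp: indicator_def)
      then show ?thesis by (simp add: A F)
    qed
    have upper: "emeasure W F \<le> ennreal V"
    proof -
      have le: "emeasure W (F \<inter> cball 0 R) \<le> ennreal V" for R
      proof (rule LIMSEQ_le_const2[OF lim])
        have "emeasure W (A j \<inter> cball 0 R) \<le> ennreal V" for j unfolding AV[of j, symmetric] by (intro emeasure_mono) auto
        then show "\<exists>N. \<forall>j\<ge>N. emeasure W (A j \<inter> cball 0 R) \<le> ennreal V" by blast
      qed
      show ?thesis unfolding W_cball_SUP[OF F, symmetric] by (rule SUP_least) (rule le)
    qed
    have tail: "\<exists>R>0. \<forall>j. emeasure W (A j \<inter> {x. R < norm x}) \<le> ennreal \<eta>" if \<eta>: "\<eta> > 0" for \<eta>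
    proof (cases "emeasure W UNIV = \<infinity>")
      case True
      have "\<exists>R>0. \<forall>E\<in>sets borel. emeasure W E \<le> ennreal V \<longrightarrow> (\<forall>b. per_le E 0 b C) \<longrightarrow> emeasure W (E \<inter> {x. R < norm x}) \<le> ennreal \<eta>"
        by (rule tail_infinite_volume[OF True C _ \<eta>]) (use V in simp)
      then obtain R where R: "R > 0" "\<And>E. E \<in> sets borel \<Longrightarrow> emeasure W E \<le> ennreal V \<Longrightarrow> \<forall>b. per_le E 0 b C \<Longrightarrow>
          emeasure W (E \<inter> {x. R < norm x}) \<le> ennreal \<eta>" by blast
      have "\<forall>b. per_le (A j) 0 b C" for j using perC by (simp add: A_def)
      then have "emeasure W (A j \<inter> {x. R < norm x}) \<le> ennreal \<eta>" for j
        using R(2)[OF A, of j] AV[of j] by simp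
      then show ?thesis using R(1) by blast
    next
      case False
      obtain R where R: "R > 0" "emeasure W {x. R < norm x} \<le> ennreal \<eta>" using tail_finite_volume[OF False \<eta>] by blast
      have "emeasure W (A j \<inter> {x. R < norm x}) \<le> emeasure W {x. R < norm x}" for j
        by (rule emeasure_mono) auto
      then show ?thesis using R order_trans by blast
    qed
    \<comment> \<open>For every j the ball holds all but \<eta> of the volume. The limit in j is
      taken first, with R fixed, and \<eta> tends to 0 afterwards.\<close>
    have lower: "ennreal V \<le> emeasure W F"
    proof (rule ennreal_le_epsilon)
      fix \<eta> :: real assume \<eta>: "0 < \<eta>"
      obtain R where R: "\<And>j. emeasure W (A j \<inter> {x. R < norm x}) \<le> ennreal \<eta>" using tail[OF \<eta>] by blast
      have "ennreal V \<le> emeasure W (A j \<inter> cball 0 R) + ennreal \<eta>" for j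
      proof -
        have "A j \<subseteq> (A j \<inter> cball 0 R) \<union> (A j \<inter> {x. R < norm x})" by auto
        then have "emeasure W (A j) \<le> emeasure W ((A j \<inter> cball 0 R) \<union> (A j \<inter> {x. R < norm x}))"
          by (rule emeasure_mono) (auto simp: A)
        also have "\<dots> \<le> emeasure W (A j \<inter> cball 0 R) + emeasure W (A j \<inter> {x. R < norm x})"
          by (rule emeasure_subadditive) (auto simp: A)
        also have "\<dots> \<le> emeasure W (A j \<inter> cball 0 R) + ennreal \<eta>" by (intro add_left_mono R)
        finally show ?thesis by (simp add: AV)
      qed
      then have "ennreal V \<le> emeasure W (F \<inter> cball 0 R) + ennreal \<eta>"
        by (intro LIMSEQ_le_const[OF tendsto_add[OF lim tendsto_const]]) auto
      also have "\<dots> \<le> emeasure W F + ennreal \<eta>" by (intro add_right_mono emeasure_mono) auto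
      finally show "ennreal V \<le> emeasure W F + ennreal \<eta>" .
    qed
    have FV: "wvol f h F = ennreal V" using upper lower by (simp add: wvol_eq[OF F])
    \<comment> \<open>Lower semicontinuity: the divergence of one fixed field is integrable and
      dominates, so its flux passes to the limit; the supremum over fields is taken only
      afterwards.\<close>
    have "flux F Y \<le> i" if Y: "test_field Y" for Y
    proof -
      have Yc: "C1c_field Y" using Y by (simp add: test_field_def)
      have int: "integrable lborel (\<lambda>x. indicator B x * divergence Y x)" if "B \<in> sets borel" for B
        by (rule integrable_divergence[OF Yc that])
      have "(\<lambda>j. flux (A j) Y) \<longlonglongrightarrow> flux F Y" unfolding flux_def
      proof (rule integral_dominated_convergence[where w = "\<lambda>x. norm (indicator UNIV x * divergence Y x)"])
        show "integrable lborel (\<lambda>x. norm (indicator UNIV x * divergence Y x))"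
          by (rule integrable_norm[OF int]) simp
        show "(\<lambda>x. indicator F x * divergence Y x) \<in> borel_measurable lborel" using int[OF F] by (rule borel_measurable_integrable)
        show "(\<lambda>x. indicator (A j) x * divergence Y x) \<in> borel_measurable lborel" for j using int[OF A] by (rule borel_measurable_integrable)
        show "AE x in lborel. norm (indicator (A j) x * divergence Y x) \<le> norm (indicator UNIV x * divergence Y x)" for j
          by (auto simp: indicator_def)
        show "AE x in lborel. (\<lambda>j. indicator (A j) x * divergence Y x) \<longlonglongrightarrow> indicator F x * divergence Y x"
          using aeA
        proof eventually_elim
          case (elim x)
          then have "\<forall>\<^sub>F j in sequentially. indicator (A j) x * divergence Y x = indicator F x * divergence Y x"
            by eventually_elim (simp add: indicator_def)
          then show ?case by (rule tendsto_eventually)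
        qed
      qed
      moreover have "(\<lambda>j. i + 1 / real (Suc (r j))) \<longlonglongrightarrow> i + 0"
      proof (intro tendsto_add tendsto_const)
        have "(\<lambda>m. 1 / real (Suc m)) \<longlonglongrightarrow> 0" by (rule LIMSEQ_Suc[OF lim_1_over_n])
        then show "(\<lambda>j. 1 / real (Suc (r j))) \<longlonglongrightarrow> 0" using LIMSEQ_subseq_LIMSEQ[OF _ r] by (fastforce simp: o_def)
      qed
      moreover have "flux (A j) Y \<le> i + 1 / real (Suc (r j))" for j
        using E(3)[of "r j"] Y unfolding wper_le_iff[OF E(1)] A_def by blast
      ultimately show ?thesis using LIMSEQ_le[of "\<lambda>j. flux (A j) Y" "flux F Y" "\<lambda>j. i + 1 / real (Suc (r j))" "i + 0"] by auto
    qed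
    then have "wper g h F \<le> I" unfolding i wper_le_iff[OF F] by blast
    then have "isoperimetric_region f g h F V"
      unfolding isoperimetric_region_def using F FV
      by (auto simp: I_def S_def intro: order_trans INF_lower)
    then show ?thesis by blast
  qed
qed

end

theorem theorem3p2:
  fixes f g h :: "real \<Rightarrow> real"
  assumes dim: "DIM('a::euclidean_space) \<ge> 2"
    and h_pos: "\<forall>r>0. h r > 0"
    and h_cont: "continuous_on {0<..} h"
    and h_mono: "mono_on {0<..} h"
    and f_pos: "\<forall>r\<ge>0. f r > 0" and f_cont: "continuous_on {0..} f"
    and g_pos: "\<forall>r\<ge>0. g r > 0" and g_cont: "continuous_on {0..} g"
    and g_inf: "filterlim g at_top at_top"
    and fg: "\<exists>c. \<forall>r\<ge>0. f r \<le> c * g r"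
  shows "\<forall>V::real. 0 < V \<and> ennreal V < wvol f h (UNIV :: 'a set) \<longrightarrow>
           (\<exists>E :: 'a set. isoperimetric_region f g h E V)"
proof -
  obtain c where c: "\<forall>r\<ge>0. f r \<le> c * g r" using fg by blast
  interpret radial_weights f g h c "DIM('a)" "TYPE('a)"
    by unfold_locales (use assms c in auto)
  show ?thesis using isoperimetric_region_exists by blast
qed

end
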